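(* Let $(M,h)$ be a Riemannian manifold of dimension $n\ge 2$. Assume that $N$ is an integer with $1\le N\le \frac n2$ if $n$ is even, and $N\ge 1$ if $n$ is odd. Then $$4N\,c_N\,Q_{2N} = 2N\,v_{2N} + \sum_{j=1}^{N-1}(2N-2j)\,\mathcal T_{2j}^*\!\left(\tfrac n2-N\right)(v_{2N-2j})$$ as functions on $M$, where $1/c_N = (-1)^N 2^{2N} N!\,(N-1)!$. Here $Q_{2N}=Q_{2N}(h)$ are the $Q$-curvatures of $h$, $v_{2j}$ are the holographic coefficients of $h$, and $\mathcal T_{2j}^*(\lambda)$ is the formal adjoint of the operator $\mathcal T_{2j}(\lambda)=\mathcal T_{2j}(h;\lambda)$.
   Context: Poincaré-Einstein metric. On $M\times(0,\varepsilon)$ consider $g_+=r^{-2}(dr^2+h_r)$, where $h_r$ is a one-parameter family of metrics on $M$ with $h_0=h$. For odd $n$, $h_r=h+r^2h_{(2)}+r^4h_{(4)}+\cdots$ is the unique formal even power series for which $\mathrm{Ric}(g_+)+n g_+=0$ to all orders in $r$. For even $n$, $h_r=h+r^2h_{(2)}+\dots+r^{n-2}h_{(n-2)}+r^n(h_{(n)}+\log r\,\bar h_{(n)})+\cdots$ is such that $\mathrm{Ric}(g_+)+n g_+=O(r^{n-2})$ and the restriction to $TM$ of $r^{2-n}(\mathrm{Ric}(g_+)+n g_+)$ at $r=0$ has vanishing trace with respect to $h$. These conditions determine $h_{(2)},\dots,h_{(n-2)}$ and $\mathrm{tr}_h(h_{(n)})$ uniquely in terms of $h$, and $\mathrm{tr}_h(\bar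 h_{(n)})=0$; the quantities below depend only on these data. Holographic coefficients. Write $v(r)=\mathrm{dvol}(h_r)/\mathrm{dvol}(h)=1+v_2r^2+v_4r^4+\cdots$ and $v_0=1$. The functions $v_{2j}\in C^\infty(M)$ are determined by $h$ for all $j$ with $2j\le n$ if $n$ is even, and for all $j\ge 0$ if $n$ is odd. Operators $\mathcal T_{2j}(\lambda)$. All Laplacians $\Delta$ are non-positive. For $f\in C^\infty(M)$ and generic $\lambda\in\mathbb C$, there are unique coefficients $\mathcal T_{2j}(\lambda)f$ with $\mathcal T_0(\lambda)=\mathrm{Id}$ such that $u=\sum_{j} r^{\lambda+2j}\,\mathcal T_{2j}(\lambda)f$ solves $-\Delta_{g_+}u=\lambda(n-\lambda)u$ asymptotically: formally to all orders in $r$ if $n$ is odd (sum over all $j\ge0$), and with $\Delta_{g_+}u+\lambda(n-\lambda)u=O(r^{\lambda+n+1})$ if $n$ is even (sum over $0\le j\le n/2$). The $\mathcal T_{2j}(\lambda)=\mathcal T_{2j}(h;\lambda)$ are differential operators on $M$, rational in $\lambda$, with $$\mathcal T_{2j}(h;\lambda)=\frac{1}{2^{2j}j!\,(\frac n2-\lambda-1)\cdots(\frac n2-\lambda-j)}\,P_{2j}(h;\lambda),$$ where $P_{2j}(h;\lambda)$ is polynomial in $\lambda$ with leading part $\Delta_h^j$. The formal adjoint $\mathcal T_{2j}^*(\lambda)$ is taken with respect to $\mathrm{dvol}(h)$ and the bilinear pairing: $\int_M \mathcal T_{2j}(\lambda)(f)\,g\,\mathrm{dvol}(h)=\int_M f\,\mathcal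 T_{2j}^*(\lambda)(g)\,\mathrm{dvol}(h)$ for compactly supported $f$. $Q$-curvatures. $P_{2N}(h)$ denotes the GJMS-operator (the conformally covariant power of the Laplacian, with leading part $\Delta_h^N$), for $1\le N\le n/2$ if $n$ is even and $N\ge1$ if $n$ is odd; it satisfies $P_{2N}(h)=P_{2N}(h;\frac n2-N)$. For $2N\ne n$ the $Q$-curvature $Q_{2N}(h)\in C^\infty(M)$ is defined by $P_{2N}(h)(1)=(-1)^N(\frac n2-N)Q_{2N}(h)$. For even $n$, the critical $Q$-curvature $Q_n(h)$ is obtained from the subcritical ones by analytic continuation in the dimension (dividing $P_{2N}(h)(1)$ by $(-1)^N(\frac n2-N)$ and then setting $n=2N$ in the resulting universal formula); equivalently $Q_n(h)=(-1)^{n/2}\frac{d}{d\lambda}\big|_{\lambda=0}P_n(h;\lambda)(1)$. *)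

theory Defs
  imports "HOL-Analysis.Analysis" "HOL-Library.Landau_Symbols"
begin

section \<open>Calculus in coordinates\<close>

definition pd :: "'m::finite \<Rightarrow> (real^'m \<Rightarrow> 'b::real_normed_vector) \<Rightarrow> real^'m \<Rightarrow> 'b" where
  "pd i f x = frechet_derivative f (at x) (axis i 1)"

text \<open>Intended for open \<open>S\<close>: all iterated partial derivatives exist and are differentiable on \<open>S\<close>.\<close>

definition smooth_on :: "(real^'m::finite) set \<Rightarrow> (real^'m \<Rightarrow> 'b::real_normed_vector) \<Rightarrow> bool" where
  "smooth_on S f \<longleftrightarrow> (\<forall>ks. \<forall>x\<in>S. foldr pd ks f differentiable (at x))"

text \<open>A metric on (an open subset of) coordinate space is given by its component matrix.\<close>

definition christoffel ::
  "(real^'m \<Rightarrow> real^'m^'m) \<Rightarrow> real^'m \<Rightarrow> 'm::finite \<Rightarrow> 'm \<Rightarrow> 'm \<Rightarrow> real" where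
  "christoffel g y k i j =
     (\<Sum>l\<in>UNIV. matrix_inv (g y) $ k $ l *
        (pd i (\<lambda>z. g z $ j $ l) y + pd j (\<lambda>z. g z $ i $ l) y - pd l (\<lambda>z. g z $ i $ j) y)) / 2"

definition ricci :: "(real^'m \<Rightarrow> real^'m^'m) \<Rightarrow> real^'m \<Rightarrow> real^'m::finite^'m" where
  "ricci g y = (\<chi> i j.
     (\<Sum>k\<in>UNIV. pd k (\<lambda>z. christoffel g z k i j) y - pd j (\<lambda>z. christoffel g z k i k) y) +
     (\<Sum>k\<in>UNIV. \<Sum>l\<in>UNIV. christoffel g y k k l * christoffel g y l i j
                         - christoffel g y k j l * christoffel g y l i k))"

text \<open>The non-positive Laplace--Beltrami operator.\<close>

definition laplacian ::
  "(real^'m \<Rightarrow> real^'m^'m) \<Rightarrow> (real^'m \<Rightarrow> complex) \<Rightarrow> real^'m::finite \<Rightarrow> complex" where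
  "laplacian g u y =
     (\<Sum>a\<in>UNIV. \<Sum>b\<in>UNIV.
        pd a (\<lambda>z. (sqrt (det (g z)) * matrix_inv (g z) $ a $ b) *\<^sub>R pd b u z) y) /\<^sub>R sqrt (det (g y))"


section \<open>Manifolds, functions and symmetric 2-tensors\<close>

text \<open>The manifold is the set of points of an abstract topology \<open>X\<close>, with a smooth atlas \<open>A\<close>.
  A chart is a pair of its domain and its coordinate map.\<close>

type_synonym ('a, 'n) chart = "'a set \<times> ('a \<Rightarrow> real^'n)"

definition chart_image :: "('a, 'n) chart \<Rightarrow> (real^'n::finite) set" where
  "chart_image c = snd c ` fst c"

definition chart_point :: "('a, 'n) chart \<Rightarrow> real^'n::finite \<Rightarrow> 'a" where
  "chart_point c = inv_into (fst c) (snd c)"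

definition smooth_atlas :: "'a topology \<Rightarrow> ('a, 'n::finite) chart set \<Rightarrow> bool" where
  "smooth_atlas X A \<longleftrightarrow>
     Hausdorff_space X \<and> second_countable X \<and>
     (\<Union>c\<in>A. fst c) = topspace X \<and>
     (\<forall>c\<in>A. openin X (fst c) \<and> open (chart_image c) \<and>
        homeomorphic_map (subtopology X (fst c)) (top_of_set (chart_image c)) (snd c)) \<and>
     (\<forall>c\<in>A. \<forall>d\<in>A. smooth_on (snd c ` (fst c \<inter> fst d)) (snd d \<circ> chart_point c))"

definition smooth_fun :: "('a, 'n::finite) chart set \<Rightarrow> ('a \<Rightarrow> 'b::real_normed_vector) \<Rightarrow> bool" where
  "smooth_fun A f \<longleftrightarrow> (\<forall>c\<in>A. smooth_on (chart_image c) (f \<circ> chart_point c))"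

text \<open>A 2-tensor field is given by its components in every chart of the atlas, as functions of the
  coordinates of that chart.\<close>

type_synonym ('a, 'n) tensor2 = "('a, 'n) chart \<Rightarrow> real^'n \<Rightarrow> real^'n^'n"

definition sym_tensor :: "('a, 'n::finite) chart set \<Rightarrow> ('a, 'n) tensor2 \<Rightarrow> bool" where
  "sym_tensor A t \<longleftrightarrow>
     (\<forall>c\<in>A. smooth_on (chart_image c) (t c) \<and>
            (\<forall>x\<in>chart_image c. transpose (t c x) = t c x)) \<and>
     (\<forall>c\<in>A. \<forall>d\<in>A. \<forall>p \<in> fst c \<inter> fst d.
        let J = matrix (frechet_derivative (snd d \<circ> chart_point c) (at (snd c p)))
        in t c (snd c p) = transpose J ** t d (snd d p) ** J)"

definition riemannian_metric :: "('a, 'n::finite) chart set \<Rightarrow> ('a, 'n) tensor2 \<Rightarrow> bool" where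
  "riemannian_metric A h \<longleftrightarrow> sym_tensor A h \<and>
     (\<forall>c\<in>A. \<forall>x\<in>chart_image c. \<forall>w. w \<noteq> 0 \<longrightarrow> w \<bullet> (h c x *v w) > 0)"

text \<open>The Riemannian volume measure \<open>dvol(h)\<close> on the Borel sets of the manifold; it is uniquely
  determined because the manifold is a countable union of chart domains.\<close>

definition riemannian_volume ::
  "'a topology \<Rightarrow> ('a, 'n::finite) chart set \<Rightarrow> ('a, 'n) tensor2 \<Rightarrow> 'a measure \<Rightarrow> bool" where
  "riemannian_volume X A h \<mu> \<longleftrightarrow>
     space \<mu> = topspace X \<and> sets \<mu> = sigma_sets (topspace X) {U. openin X U} \<and>
     (\<forall>c\<in>A. \<forall>B\<in>sets \<mu>. B \<subseteq> fst c \<longrightarrow>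
        emeasure \<mu> B = (\<integral>\<^sup>+x\<in>snd c ` B. ennreal (sqrt (det (h c x))) \<partial>lborel))"

definition formal_adjoint ::
  "'a topology \<Rightarrow> ('a, 'n::finite) chart set \<Rightarrow> 'a measure \<Rightarrow>
   (('a \<Rightarrow> complex) \<Rightarrow> 'a \<Rightarrow> complex) \<Rightarrow> (('a \<Rightarrow> complex) \<Rightarrow> 'a \<Rightarrow> complex) \<Rightarrow> bool" where
  "formal_adjoint X A \<mu> S S' \<longleftrightarrow>
     (\<forall>g. smooth_fun A g \<longrightarrow> smooth_fun A (S' g)) \<and>
     (\<forall>f g. smooth_fun A f \<and> (\<exists>K. compactin X K \<and> (\<forall>p\<in>topspace X - K. f p = 0)) \<and> smooth_fun A g \<longrightarrow>
        (LINT p|\<mu>. S f p * g p) = (LINT p|\<mu>. f p * S' g p))"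


section \<open>Poincare-Einstein metrics\<close>

text \<open>Coordinates on \<open>M \<times> (0,\<epsilon>)\<close> are indexed by \<open>'n option\<close>, where \<open>None\<close> is the index of \<open>r\<close>.\<close>

definition join :: "real^'n \<Rightarrow> real \<Rightarrow> real^('n::finite option)" where
  "join x r = (\<chi> a. case a of None \<Rightarrow> r | Some i \<Rightarrow> x $ i)"

definition base_part :: "real^('n::finite option) \<Rightarrow> real^'n" where
  "base_part y = (\<chi> i. y $ Some i)"

text \<open>\<open>g\<^sub>+ = r\<^sup>-\<^sup>2 (dr\<^sup>2 + h\<^sub>r)\<close>.\<close>

definition g_plus ::
  "(real \<Rightarrow> real^'n \<Rightarrow> real^'n^'n) \<Rightarrow> real^('n::finite option) \<Rightarrow> real^('n option)^('n option)" where
  "g_plus H y = (\<chi> a b. case (a, b) of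
       (None, None) \<Rightarrow> 1 / (y $ None)\<^sup>2
     | (Some i, Some j) \<Rightarrow> H (y $ None) (base_part y) $ i $ j / (y $ None)\<^sup>2
     | _ \<Rightarrow> 0)"

text \<open>The family \<open>h\<^sub>r\<close>, where \<open>hs j\<close> stands for \<open>h\<^sub>(\<^sub>2\<^sub>j\<^sub>)\<close>. For odd \<open>n\<close> these are the partial sums
  of the even formal power series, and an identity holds to all orders if for every \<open>L\<close> it holds
  up to \<open>O(r\<^sup>L)\<close> for all sufficiently long partial sums. For even \<open>n\<close> only \<open>K = n div 2\<close> is used;
  the terms beyond \<open>r\<^sup>n\<close> are dropped, as no condition below depends on them.
  The orders in \<open>r\<close> are taken at fixed points of \<open>M\<close>: at each of these, the expressions involved expand
  in powers of \<open>r\<close> and \<open>log r\<close>, so this is a condition on their coefficients.\<close>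

definition fg_family ::
  "(nat \<Rightarrow> ('a, 'n) tensor2) \<Rightarrow> ('a, 'n) tensor2 \<Rightarrow> nat \<Rightarrow> ('a, 'n) chart \<Rightarrow>
   real \<Rightarrow> real^'n \<Rightarrow> real^'n::finite^'n" where
  "fg_family hs hbar K c r x =
     (\<Sum>j\<le>K. r ^ (2*j) *\<^sub>R hs j c x) +
     (if even CARD('n) then (r ^ CARD('n) * ln r) *\<^sub>R hbar c x else 0)"

definition einstein_defect ::
  "(real \<Rightarrow> real^'n \<Rightarrow> real^'n^'n) \<Rightarrow> real^'n::finite \<Rightarrow> real \<Rightarrow> real^('n option)^('n option)" where
  "einstein_defect H x r =
     ricci (g_plus H) (join x r) + real CARD('n) *\<^sub>R g_plus H (join x r)"

definition poincare_einstein ::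
  "('a, 'n::finite) chart set \<Rightarrow> ('a, 'n) tensor2 \<Rightarrow> (nat \<Rightarrow> ('a, 'n) tensor2) \<Rightarrow>
   ('a, 'n) tensor2 \<Rightarrow> bool" where
  "poincare_einstein A h hs hbar \<longleftrightarrow>
     (let n = CARD('n) in
      hs 0 = h \<and>
      (if even n then
         (\<forall>j. 2*j \<le> n \<longrightarrow> sym_tensor A (hs j)) \<and> sym_tensor A hbar \<and>
         (\<forall>c\<in>A. \<forall>x\<in>chart_image c.
            let E = einstein_defect (fg_family hs hbar (n div 2) c) x in
            (\<forall>a b. (\<lambda>r. E r $ a $ b) \<in> O[at_right 0](\<lambda>r. r ^ (n - 2))) \<and>
            (\<exists>S::real^'n^'n.
               (\<forall>i j. ((\<lambda>r. E r $ Some i $ Some j / r ^ (n - 2)) \<longlongrightarrow> S $ i $ j) (at_right 0)) \<and>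
               trace (matrix_inv (h c x) ** S) = 0))
       else
         (\<forall>j. sym_tensor A (hs j)) \<and>
         (\<forall>c\<in>A. \<forall>x\<in>chart_image c. \<forall>L::nat. \<forall>\<^sub>F K in sequentially. \<forall>a b.
            (\<lambda>r. einstein_defect (fg_family hs hbar K c) x r $ a $ b) \<in> O[at_right 0](\<lambda>r. r ^ L))))"


section \<open>Holographic coefficients\<close>

text \<open>\<open>v j\<close> stands for \<open>v\<^sub>2\<^sub>j\<close>.\<close>

definition holographic_coeffs ::
  "('a, 'n::finite) chart set \<Rightarrow> ('a, 'n) tensor2 \<Rightarrow> (nat \<Rightarrow> ('a, 'n) tensor2) \<Rightarrow>
   ('a, 'n) tensor2 \<Rightarrow> (nat \<Rightarrow> 'a \<Rightarrow> real) \<Rightarrow> bool" where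
  "holographic_coeffs A h hs hbar v \<longleftrightarrow>
     (let n = CARD('n);
          R = (\<lambda>K c x r. sqrt (det (fg_family hs hbar K c r x)) / sqrt (det (h c x))
                 - (\<Sum>j\<le>K. v j (chart_point c x) * r ^ (2*j)))
      in
      (if even n then
         (\<forall>j. 2*j \<le> n \<longrightarrow> smooth_fun A (v j)) \<and>
         (\<forall>c\<in>A. \<forall>x\<in>chart_image c. R (n div 2) c x \<in> o[at_right 0](\<lambda>r. r ^ n))
       else
         (\<forall>j. smooth_fun A (v j)) \<and>
         (\<forall>c\<in>A. \<forall>x\<in>chart_image c. \<forall>L::nat. \<forall>\<^sub>F K in sequentially.
            R K c x \<in> O[at_right 0](\<lambda>r. r ^ L))))"


section \<open>Solution operators, GJMS-operators and Q-curvatures\<close>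

text \<open>The spectral parameter is written \<open>s\<close>: \<open>P j s\<close> stands for \<open>P\<^sub>2\<^sub>j(h;s)\<close> and \<open>T_op n P j s\<close> for
  \<open>\<T>\<^sub>2\<^sub>j(h;s)\<close>. The operators act on complex-valued functions.\<close>

definition T_op ::
  "nat \<Rightarrow> (nat \<Rightarrow> complex \<Rightarrow> ('a \<Rightarrow> complex) \<Rightarrow> 'a \<Rightarrow> complex) \<Rightarrow>
   nat \<Rightarrow> complex \<Rightarrow> ('a \<Rightarrow> complex) \<Rightarrow> 'a \<Rightarrow> complex" where
  "T_op n P j s f p =
     P j s f p / (2 ^ (2*j) * fact j * (\<Prod>i=1..j. of_nat n / 2 - s - of_nat i))"

definition poisson_sum ::
  "(nat \<Rightarrow> complex \<Rightarrow> ('a \<Rightarrow> complex) \<Rightarrow> 'a \<Rightarrow> complex) \<Rightarrow> ('a, 'n) chart \<Rightarrow> nat \<Rightarrow>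
   complex \<Rightarrow> ('a \<Rightarrow> complex) \<Rightarrow> real^('n::finite option) \<Rightarrow> complex" where
  "poisson_sum P c K s f y =
     (\<Sum>j\<le>K. complex_of_real (y $ None) powr (s + 2 * of_nat j) *
        T_op CARD('n) P j s f (chart_point c (base_part y)))"

definition eigen_defect ::
  "(nat \<Rightarrow> ('a, 'n) tensor2) \<Rightarrow> ('a, 'n) tensor2 \<Rightarrow>
   (nat \<Rightarrow> complex \<Rightarrow> ('a \<Rightarrow> complex) \<Rightarrow> 'a \<Rightarrow> complex) \<Rightarrow> nat \<Rightarrow> ('a, 'n) chart \<Rightarrow>
   complex \<Rightarrow> ('a \<Rightarrow> complex) \<Rightarrow> real^'n::finite \<Rightarrow> real \<Rightarrow> complex" where
  "eigen_defect hs hbar P K c s f x r =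
     laplacian (g_plus (fg_family hs hbar K c)) (poisson_sum P c K s f) (join x r) +
     s * (of_nat CARD('n) - s) * poisson_sum P c K s f (join x r)"

text \<open>The exceptional values of \<open>s\<close> are the zeros of the denominators in \<open>T_op\<close>. The eigenvalue
  equation determines \<open>T_op n P j s\<close> for generic \<open>s\<close>; polynomiality then determines \<open>P j s\<close> for
  all \<open>s\<close>, and \<open>T_op n P j s\<close> wherever its own denominator does not vanish.\<close>

definition poisson_operators ::
  "('a, 'n::finite) chart set \<Rightarrow> (nat \<Rightarrow> ('a, 'n) tensor2) \<Rightarrow> ('a, 'n) tensor2 \<Rightarrow>
   (nat \<Rightarrow> complex \<Rightarrow> ('a \<Rightarrow> complex) \<Rightarrow> 'a \<Rightarrow> complex) \<Rightarrow> bool" where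
  "poisson_operators A hs hbar P \<longleftrightarrow>
     (let n = CARD('n) in
      (\<forall>s f. smooth_fun A f \<longrightarrow> (\<forall>p \<in> (\<Union>c\<in>A. fst c). P 0 s f p = f p)) \<and>
      (\<forall>j. (even n \<longrightarrow> 2*j \<le> n) \<longrightarrow>
         (\<exists>d C. (\<forall>k f. smooth_fun A f \<longrightarrow> smooth_fun A (C k f)) \<and>
                (\<forall>s f. smooth_fun A f \<longrightarrow>
                   (\<forall>p \<in> (\<Union>c\<in>A. fst c). P j s f p = (\<Sum>k\<le>(d::nat). s ^ k * C k f p))))) \<and>
      (\<forall>s. (\<forall>i::nat. i \<ge> 1 \<longrightarrow> s \<noteq> of_nat n / 2 - of_nat i) \<longrightarrow>
         (\<forall>f. smooth_fun A f \<longrightarrow>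
            (\<forall>c\<in>A. \<forall>x\<in>chart_image c.
               if even n then
                 eigen_defect hs hbar P (n div 2) c s f x
                   \<in> O[at_right 0](\<lambda>r. complex_of_real r powr (s + of_nat n + 1))
               else
                 (\<forall>L::nat. \<forall>\<^sub>F K in sequentially.
                    eigen_defect hs hbar P K c s f x
                      \<in> O[at_right 0](\<lambda>r. complex_of_real r powr (s + of_nat L)))))))"

text \<open>The GJMS-operator \<open>P\<^sub>2\<^sub>N(h)\<close>, in the form due to Graham and Zworski.\<close>

definition gjms ::
  "nat \<Rightarrow> (nat \<Rightarrow> complex \<Rightarrow> ('a \<Rightarrow> complex) \<Rightarrow> 'a \<Rightarrow> complex) \<Rightarrow>
   nat \<Rightarrow> ('a \<Rightarrow> complex) \<Rightarrow> 'a \<Rightarrow> complex" where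
  "gjms n P N = P N (of_nat n / 2 - of_nat N)"

text \<open>\<open>Q\<^sub>2\<^sub>N(h)\<close>. In the critical case \<open>2N = n\<close> the derivative in \<open>s\<close> yields the same function as
  analytic continuation of the subcritical formula in the dimension.\<close>

definition Q_curvature ::
  "nat \<Rightarrow> (nat \<Rightarrow> complex \<Rightarrow> ('a \<Rightarrow> complex) \<Rightarrow> 'a \<Rightarrow> complex) \<Rightarrow> nat \<Rightarrow> 'a \<Rightarrow> complex" where
  "Q_curvature n P N p =
     (if 2*N \<noteq> n
      then gjms n P N (\<lambda>_. 1) p / ((-1) ^ N * (of_nat n / 2 - of_nat N))
      else (-1) ^ N * deriv (\<lambda>s. P N s (\<lambda>_. 1) p) 0)"

definition c_const :: "nat \<Rightarrow> complex" where
  "c_const N = 1 / ((-1) ^ N * 2 ^ (2*N) * fact N * fact (N - 1))"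

end

theory Submission
  imports Defs "HOL-Complex_Analysis.Complex_Analysis"
begin

text \<open>
  Write \<open>V\<^sub>r\<close> for the volume density \<open>sqrt (det h\<^sub>r)\<close> in a chart and \<open>W\<^sub>r = V\<^sub>r h\<^sub>r\<^sup>-\<^sup>1\<close>. In these terms
  \<open>\<Delta> u = r\<^sup>n\<^sup>+\<^sup>1 V\<^sub>r\<^sup>-\<^sup>1 (\<partial>\<^sub>r (r\<^sup>1\<^sup>-\<^sup>n V\<^sub>r \<partial>\<^sub>r u) + r\<^sup>1\<^sup>-\<^sup>n div (W\<^sub>r grad u))\<close>. Comparing coefficients of powers of \<open>r\<close> in the
  eigenvalue equation for \<open>u = \<Sum>\<^sub>j r\<^sup>s\<^sup>+\<^sup>2\<^sup>j T\<^sub>j f\<close> gives, for each order \<open>k\<close>, the recursion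
  \<open>\<Sum>\<^sub>j \<alpha>\<^sub>j\<^sub>k V\<^sub>k\<^sub>-\<^sub>j T\<^sub>j f + \<Sum>\<^sub>j div (w\<^sub>k\<^sub>-\<^sub>1\<^sub>-\<^sub>j grad T\<^sub>j f) = 0\<close> with \<open>\<alpha>\<^sub>j\<^sub>k = (s + 2j)(s + 2k - n) + s(n - s)\<close>
  (\<open>solution_recursion\<close>); here \<open>V\<^sub>k\<close> is \<open>sqrt (det h)\<close> times the holographic coefficient and \<open>w\<^sub>k\<close> is a symmetric
  matrix, the coefficient of \<open>W\<^sub>r\<close>.

  Two integral identities follow, because operators in divergence form with symmetric coefficients are formally
  self-adjoint. Let \<open>f\<close> be a test function in a chart. Integrating the recursion of order \<open>N\<close> gives
  \<open>\<Sum>\<^sub>j\<^sub>\<le>\<^sub>N \<alpha>\<^sub>j\<^sub>N a\<^sub>j = 0\<close> for \<open>a\<^sub>j = \<integral> V\<^sub>N\<^sub>-\<^sub>j T\<^sub>j f\<close> (\<open>pair_first\<close>). Pairing the solutions with boundary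
  values \<open>1\<close> and \<open>f\<close>, which is Green's formula on the hypersurfaces of constant \<open>r\<close>, gives
  \<open>\<Sum>\<^sub>i\<^sub>+\<^sub>j\<^sub>\<le>\<^sub>N (j - i) \<integral> V\<^sub>N\<^sub>-\<^sub>i\<^sub>-\<^sub>j T\<^sub>j f T\<^sub>i 1 = 0\<close> (\<open>pair_second\<close>). Eliminating \<open>\<integral> T\<^sub>N f\<close> expresses \<open>\<integral> f P\<^sub>N(s) 1\<close> by
  the operators of order below \<open>N\<close>, in an identity that is regular at \<open>s = n/2 - N\<close> (\<open>pairing_identity\<close>). It is
  proved for large real \<open>s\<close> and extends by analytic continuation. If \<open>2N \<noteq> n\<close>, its value at \<open>s = n/2 - N\<close> is the
  theorem, tested against \<open>f\<close>. If \<open>2N = n\<close>, that point is \<open>s = 0\<close>, where both sides vanish; since constants solve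
  the equation for \<open>s = 0\<close>, the terms with \<open>i > 0\<close> drop out there, and the derivative at \<open>0\<close> is the theorem
  (\<open>Q_pairing\<close>). The formal adjoints move the operators from \<open>f\<close> to the holographic coefficients, and \<open>f\<close> is arbitrary.

  The analytic difficulty is that the expansions in \<open>r\<close> are given pointwise on \<open>M\<close> and without control of derivatives. A
  pointwise expansion of \<open>V\<^sub>r\<close> says nothing about \<open>\<partial>\<^sub>r V\<^sub>r\<close>, so the radial equation is integrated instead of
  differentiated (\<open>expands_ode\<close>). Derivatives along \<open>M\<close> are recovered from the algebraic equations \<open>V\<^sub>r\<^sup>2 = det h\<^sub>r\<close> and
  \<open>h\<^sub>r W\<^sub>r = V\<^sub>r\<close>, whose data are explicit (\<open>jet_expands_volume\<close>, \<open>jet_expands_dual_density\<close>). All integrals are taken only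
  after coefficients have been compared at each point.
\<close>

section \<open>Calculus of smooth functions in coordinates\<close>

lemma pd_at:
  assumes "(f has_derivative f') (at x)"
  shows "pd i f x = f' (axis i 1)"
  using frechet_derivative_at[OF assms] by (simp add: pd_def)

lemma has_derivative_cong_open:
  assumes "open S" "x \<in> S" "\<And>z. z \<in> S \<Longrightarrow> f z = g z"
  shows "(f has_derivative f') (at x) \<longleftrightarrow> (g has_derivative f') (at x)"
proof
  show "(g has_derivative f') (at x)" if "(f has_derivative f') (at x)"
    by (rule has_derivative_transform_within_open[OF that assms(1,2)]) (rule assms(3))
  show "(f has_derivative f') (at x)" if "(g has_derivative f') (at x)"
    by (rule has_derivative_transform_within_open[OF that assms(1,2)]) (rule assms(3)[symmetric])
qed

lemma pd_cong:
  assumes "open S" "x \<in> S" "\<And>z. z \<in> S \<Longrightarrow> f z = g z"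
  shows "pd i f x = pd i g x"
  unfolding pd_def frechet_derivative_def
  by (subst has_derivative_cong_open[OF assms]) auto

lemma differentiable_cong_open:
  assumes "open S" "x \<in> S" "\<And>z. z \<in> S \<Longrightarrow> f z = g z"
  shows "f differentiable (at x) \<longleftrightarrow> g differentiable (at x)"
  unfolding differentiable_def by (subst has_derivative_cong_open[OF assms]) auto

text \<open>Smoothness is an infinite conjunction over the length of the differentiation string; the closure
  properties are proved by induction on that length.\<close>

primrec diff_upto :: "nat \<Rightarrow> (real^'m::finite) set \<Rightarrow> (real^'m \<Rightarrow> 'b::real_normed_vector) \<Rightarrow> bool" where
  "diff_upto 0 S f = (\<forall>x\<in>S. f differentiable (at x))"
| "diff_upto (Suc k) S f = ((\<forall>x\<in>S. f differentiable (at x)) \<and> (\<forall>i. diff_upto k S (pd i f)))"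

lemma diff_uptoD: "diff_upto k S f \<Longrightarrow> x \<in> S \<Longrightarrow> f differentiable (at x)"
  by (cases k) auto

lemma diff_upto_Suc_D: "diff_upto (Suc k) S f \<Longrightarrow> diff_upto k S f"
  by (induction k arbitrary: f) auto

lemma diff_upto_cong:
  assumes "open S" "\<And>z. z \<in> S \<Longrightarrow> f z = g z"
  shows "diff_upto k S f = diff_upto k S g"
  using assms(2)
proof (induction k arbitrary: f g)
  case 0
  have "(f differentiable (at x)) = (g differentiable (at x))" if "x \<in> S" for x
    by (rule differentiable_cong_open[OF assms(1) that]) (rule 0)
  then show ?case by simp
next
  case (Suc k)
  have "diff_upto k S (pd i f) = diff_upto k S (pd i g)" for i
    by (rule Suc.IH) (rule pd_cong[OF assms(1)], auto simp: Suc.prems)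
  moreover have "(f differentiable (at x)) = (g differentiable (at x))" if "x \<in> S" for x
    by (rule differentiable_cong_open[OF assms(1) that]) (rule Suc.prems)
  ultimately show ?case by simp
qed

lemma diff_upto_foldr:
  "diff_upto k S f \<longleftrightarrow> (\<forall>ks. length ks \<le> k \<longrightarrow> (\<forall>x\<in>S. foldr pd ks f differentiable (at x)))"
proof (induction k arbitrary: f)
  case 0
  then show ?case by simp
next
  case (Suc k)
  show ?case
  proof
    assume *: "diff_upto (Suc k) S f"
    show "\<forall>ks. length ks \<le> Suc k \<longrightarrow> (\<forall>x\<in>S. foldr pd ks f differentiable (at x))"
    proof (intro allI impI)
      fix ks :: "'a list" assume l: "length ks \<le> Suc k"
      show "\<forall>x\<in>S. foldr pd ks f differentiable (at x)"
      proof (cases ks rule: rev_cases)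
        case Nil
        then show ?thesis using * by simp
      next
        case (snoc ks' i)
        then have "diff_upto k S (pd i f)" "length ks' \<le> k" using * l by auto
        then show ?thesis using Suc.IH[of "pd i f"] snoc by auto
      qed
    qed
  next
    assume *: "\<forall>ks. length ks \<le> Suc k \<longrightarrow> (\<forall>x\<in>S. foldr pd ks f differentiable (at x))"
    have "diff_upto k S (pd i f)" for i
    proof -
      have "\<forall>x\<in>S. foldr pd ks (pd i f) differentiable (at x)" if "length ks \<le> k" for ks
        using *[rule_format, of "ks @ [i]"] that by auto
      then show ?thesis using Suc.IH by blast
    qed
    moreover have "\<forall>x\<in>S. f differentiable (at x)" using *[rule_format, of "[]"] by simp
    ultimately show "diff_upto (Suc k) S f" by simp
  qed
qed

lemma smooth_on_diff_upto: "smooth_on S f \<longleftrightarrow> (\<forall>k. diff_upto k S f)"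
  unfolding smooth_on_def diff_upto_foldr by blast

lemma smooth_on_pd: "smooth_on S f \<Longrightarrow> smooth_on S (pd i f)"
  unfolding smooth_on_diff_upto using diff_upto.simps(2) by blast

lemma smooth_on_differentiable: "smooth_on S f \<Longrightarrow> x \<in> S \<Longrightarrow> f differentiable (at x)"
  unfolding smooth_on_diff_upto using diff_uptoD by blast

lemma smooth_on_continuous_on: "smooth_on S f \<Longrightarrow> continuous_on S f"
  by (meson continuous_at_imp_continuous_on differentiable_imp_continuous_within smooth_on_differentiable)

lemma smooth_on_cong:
  assumes "open S" "\<And>z. z \<in> S \<Longrightarrow> f z = g z" "smooth_on S g"
  shows "smooth_on S f"
  using diff_upto_cong[of S f g] assms unfolding smooth_on_diff_upto by auto

lemma smooth_on_subset: "smooth_on S f \<Longrightarrow> T \<subseteq> S \<Longrightarrow> smooth_on T f"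
  unfolding smooth_on_def by blast

lemma smooth_on_Un: "smooth_on S f \<Longrightarrow> smooth_on T f \<Longrightarrow> smooth_on (S \<union> T) f"
  unfolding smooth_on_def by blast

lemma pd_const [simp]: "pd i (\<lambda>x. c) = (\<lambda>x. 0)"
  by (rule ext) (rule pd_at[of _ "\<lambda>_. 0"], simp)

lemma diff_upto_const: "diff_upto k S (\<lambda>x. c)"
  by (induction k arbitrary: c) auto

lemma smooth_on_const: "smooth_on S (\<lambda>x. c)"
  by (simp add: smooth_on_diff_upto diff_upto_const)

lemma pd_add:
  assumes "f differentiable (at x)" "g differentiable (at x)"
  shows "pd i (\<lambda>x. f x + g x) x = pd i f x + pd i g x"
proof -
  obtain f' g' where *: "(f has_derivative f') (at x)" "(g has_derivative g') (at x)"
    using assms by (auto simp: differentiable_def)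
  show ?thesis using pd_at[OF has_derivative_add[OF *]] pd_at[OF *(1)] pd_at[OF *(2)] by simp
qed

lemma pd_linear:
  assumes "bounded_linear L" "f differentiable (at x)"
  shows "pd i (\<lambda>x. L (f x)) x = L (pd i f x)"
proof -
  obtain f' where *: "(f has_derivative f') (at x)"
    using assms by (auto simp: differentiable_def)
  show ?thesis using pd_at[OF bounded_linear.has_derivative[OF assms(1) *]] pd_at[OF *(1)] by simp
qed

lemma differentiable_linear:
  assumes "bounded_linear L" "f differentiable F"
  shows "(\<lambda>x. L (f x)) differentiable F"
  using assms bounded_linear.has_derivative unfolding differentiable_def by blast

lemma differentiable_bilinear:
  assumes "bounded_bilinear bp" "f differentiable (at x)" "g differentiable (at x)"
  shows "(\<lambda>x. bp (f x) (g x)) differentiable (at x)"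
  using assms bounded_bilinear.FDERIV unfolding differentiable_def by blast

lemma pd_bilinear:
  assumes "bounded_bilinear bp" "f differentiable (at x)" "g differentiable (at x)"
  shows "pd i (\<lambda>x. bp (f x) (g x)) x = bp (f x) (pd i g x) + bp (pd i f x) (g x)"
proof -
  obtain f' g' where *: "(f has_derivative f') (at x)" "(g has_derivative g') (at x)"
    using assms by (auto simp: differentiable_def)
  show ?thesis using pd_at[OF bounded_bilinear.FDERIV[OF assms(1) *]] pd_at[OF *(1)] pd_at[OF *(2)] by simp
qed

lemma pd_sum:
  assumes "\<And>j. j \<in> I \<Longrightarrow> f j differentiable (at x)"
  shows "pd i (\<lambda>x. \<Sum>j\<in>I. f j x) x = (\<Sum>j\<in>I. pd i (f j) x)"
proof -
  have "\<forall>j\<in>I. \<exists>f'. (f j has_derivative f') (at x)"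
    using assms by (auto simp: differentiable_def)
  then obtain f' where *: "\<And>j. j \<in> I \<Longrightarrow> (f j has_derivative f' j) (at x)" by metis
  have "((\<lambda>x. \<Sum>j\<in>I. f j x) has_derivative (\<lambda>y. \<Sum>j\<in>I. f' j y)) (at x)"
    by (rule has_derivative_sum) (rule *)
  from pd_at[OF this] show ?thesis using pd_at[OF *] by simp
qed

lemma diff_upto_add:
  assumes "open S" "diff_upto k S f" "diff_upto k S g"
  shows "diff_upto k S (\<lambda>x. f x + g x)"
  using assms(2,3)
proof (induction k arbitrary: f g)
  case (Suc k)
  have "diff_upto k S (\<lambda>x. pd i f x + pd i g x)" for i
    using Suc by simp
  then have "diff_upto k S (pd i (\<lambda>x. f x + g x))" for i
    by (subst diff_upto_cong[OF assms(1), where g="\<lambda>x. pd i f x + pd i g x"])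
       (use Suc.prems in \<open>auto intro!: pd_add\<close>)
  then show ?case using Suc.prems by auto
qed auto

lemma diff_upto_sum:
  assumes "open S" "\<And>j. j \<in> I \<Longrightarrow> diff_upto k S (f j)"
  shows "diff_upto k S (\<lambda>x. \<Sum>j\<in>I. f j x)"
proof (cases "finite I")
  case True
  then show ?thesis using assms(2)
    by (induction I rule: finite_induct) (auto intro!: diff_upto_const diff_upto_add[OF assms(1)])
qed (simp add: diff_upto_const)

lemma diff_upto_linear:
  assumes "open S" "bounded_linear L" "diff_upto k S f"
  shows "diff_upto k S (\<lambda>x. L (f x))"
  using assms(3)
proof (induction k arbitrary: f)
  case 0
  then show ?case by (simp add: differentiable_linear[OF assms(2)])
next
  case (Suc k)
  then have "diff_upto k S (\<lambda>x. L (pd i f x))" for i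
    by simp
  then have "diff_upto k S (pd i (\<lambda>x. L (f x)))" for i
    by (subst diff_upto_cong[OF assms(1), where g="\<lambda>x. L (pd i f x)"])
       (use Suc.prems in \<open>auto intro!: pd_linear assms(2)\<close>)
  then show ?case using Suc.prems by (simp add: differentiable_linear[OF assms(2)])
qed

lemma diff_upto_bilinear:
  assumes "open S" "bounded_bilinear bp" "diff_upto k S f" "diff_upto k S g"
  shows "diff_upto k S (\<lambda>x. bp (f x) (g x))"
  using assms(3,4)
proof (induction k arbitrary: f g)
  case 0
  then show ?case by (simp add: differentiable_bilinear[OF assms(2)])
next
  case (Suc k)
  have "diff_upto k S (\<lambda>x. bp (f x) (pd i g x))" "diff_upto k S (\<lambda>x. bp (pd i f x) (g x))" for i
    using Suc.IH diff_upto_Suc_D[OF Suc.prems(1)] diff_upto_Suc_D[OF Suc.prems(2)] Suc.prems by auto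
  then have "diff_upto k S (\<lambda>x. bp (f x) (pd i g x) + bp (pd i f x) (g x))" for i
    using diff_upto_add[OF assms(1)] by blast
  then have "diff_upto k S (pd i (\<lambda>x. bp (f x) (g x)))" for i
    by (subst diff_upto_cong[OF assms(1), where g="\<lambda>x. bp (f x) (pd i g x) + bp (pd i f x) (g x)"])
       (use Suc.prems in \<open>auto intro!: pd_bilinear assms(2)\<close>)
  then show ?case using Suc.prems by (simp add: differentiable_bilinear[OF assms(2)])
qed

lemma smooth_on_add: "open S \<Longrightarrow> smooth_on S f \<Longrightarrow> smooth_on S g \<Longrightarrow> smooth_on S (\<lambda>x. f x + g x)"
  by (simp add: smooth_on_diff_upto diff_upto_add)

lemma smooth_on_linear: "open S \<Longrightarrow> bounded_linear L \<Longrightarrow> smooth_on S f \<Longrightarrow> smooth_on S (\<lambda>x. L (f x))"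
  by (simp add: smooth_on_diff_upto diff_upto_linear)

lemma smooth_on_bilinear:
  "open S \<Longrightarrow> bounded_bilinear bp \<Longrightarrow> smooth_on S f \<Longrightarrow> smooth_on S g \<Longrightarrow>
    smooth_on S (\<lambda>x. bp (f x) (g x))"
  by (simp add: smooth_on_diff_upto diff_upto_bilinear)

lemma smooth_on_minus: "open S \<Longrightarrow> smooth_on S f \<Longrightarrow> smooth_on S (\<lambda>x. - f x)"
  by (rule smooth_on_linear[OF _ bounded_linear_minus[OF bounded_linear_ident]])

lemma smooth_on_diff: "open S \<Longrightarrow> smooth_on S f \<Longrightarrow> smooth_on S g \<Longrightarrow> smooth_on S (\<lambda>x. f x - g x)"
  using smooth_on_add[of S f "\<lambda>x. - g x"] smooth_on_minus[of S g] by simp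

lemmas smooth_on_mult = smooth_on_bilinear[OF _ bounded_bilinear_mult]
lemmas smooth_on_scaleR = smooth_on_bilinear[OF _ bounded_bilinear_scaleR]

lemma smooth_on_sum:
  assumes "open S" "\<And>j. j \<in> I \<Longrightarrow> smooth_on S (f j)"
  shows "smooth_on S (\<lambda>x. \<Sum>j\<in>I. f j x)"
  using assms by (auto simp: smooth_on_diff_upto intro!: diff_upto_sum)

lemma smooth_on_prod:
  fixes f :: "'j \<Rightarrow> real^'m::finite \<Rightarrow> 'b::{real_normed_algebra_1, comm_monoid_mult}"
  assumes "open S" "\<And>j. j \<in> I \<Longrightarrow> smooth_on S (f j)"
  shows "smooth_on S (\<lambda>x. \<Prod>j\<in>I. f j x)"
proof (cases "finite I")
  case True
  then show ?thesis using assms(2)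
    by (induction I rule: finite_induct) (auto intro!: smooth_on_const smooth_on_mult assms(1))
qed (simp add: smooth_on_const)

lemma smooth_on_vec_iff:
  fixes f :: "real^'m::finite \<Rightarrow> 'b::real_normed_vector^'k::finite"
  assumes "open S"
  shows "smooth_on S f \<longleftrightarrow> (\<forall>i. smooth_on S (\<lambda>x. f x $ i))"
proof (intro iffI allI)
  show "smooth_on S (\<lambda>x. f x $ i)" if "smooth_on S f" for i
    by (rule smooth_on_linear[OF assms bounded_linear_vec_nth that])
next
  assume *: "\<forall>i. smooth_on S (\<lambda>x. f x $ i)"
  have "bounded_linear (axis i :: 'b \<Rightarrow> 'b^'k)" for i
  proof (rule bounded_linear_intro[where K=1])
    show "axis i (x + y) = (axis i x + axis i y :: 'b^'k)" for x y
      by (simp add: axis_def vec_eq_iff)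
    show "axis i (r *\<^sub>R x) = (r *\<^sub>R axis i x :: 'b^'k)" for r x
      by (simp add: axis_def vec_eq_iff)
    show "norm (axis i x :: 'b^'k) \<le> norm x * 1" for x
      
    proof -
      have "(axis i x :: 'b^'k) $ j = 0" if "j \<noteq> i" for j using that by (simp add: axis_def)
      then have "norm (axis i x :: 'b^'k) = norm ((axis i x :: 'b^'k) $ i)"
        unfolding norm_vec_def L2_set_def by (subst sum.remove[of _ i]) auto
      then show ?thesis by simp
    qed
  qed
  then have "smooth_on S (\<lambda>x. \<Sum>i\<in>UNIV. (axis i (f x $ i) :: 'b^'k))"
    using * by (intro smooth_on_sum assms) (auto intro: smooth_on_linear[OF assms])
  moreover have "f = (\<lambda>x. \<Sum>i\<in>UNIV. axis i (f x $ i))"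
    by (simp add: fun_eq_iff vec_eq_iff axis_def)
  ultimately show "smooth_on S f" by simp
qed

lemma pd_compose:
  fixes f :: "real^'k::finite \<Rightarrow> 'b::real_normed_vector" and g :: "real^'m::finite \<Rightarrow> real^'k"
  assumes "g differentiable (at x)" "f differentiable (at (g x))"
  shows "pd i (\<lambda>x. f (g x)) x = (\<Sum>k\<in>UNIV. pd i (\<lambda>x. g x $ k) x *\<^sub>R pd k f (g x))"
proof -
  obtain g' f' where *: "(g has_derivative g') (at x)" "(f has_derivative f') (at (g x))"
    using assms by (auto simp: differentiable_def)
  have "pd i (\<lambda>x. f (g x)) x = f' (g' (axis i 1))"
    using pd_at[OF has_derivative_compose[OF *]] by simp
  also have "g' (axis i 1) = (\<Sum>k\<in>UNIV. (g' (axis i 1) $ k) *\<^sub>R axis k 1)"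
    using basis_expansion[of "g' (axis i 1)"] by (simp add: scalar_mult_eq_scaleR)
  also have "f' \<dots> = (\<Sum>k\<in>UNIV. (g' (axis i 1) $ k) *\<^sub>R f' (axis k 1))"
    by (simp add: linear_sum[OF has_derivative_linear[OF *(2)]] linear_scale[OF has_derivative_linear[OF *(2)]])
  also have "\<dots> = (\<Sum>k\<in>UNIV. pd i (\<lambda>x. g x $ k) x *\<^sub>R pd k f (g x))"
    using pd_at[OF *(1)] pd_at[OF *(2)] pd_linear[OF bounded_linear_vec_nth assms(1)] by simp
  finally show ?thesis .
qed

lemma diff_upto_compose:
  fixes f :: "real^'k::finite \<Rightarrow> 'b::real_normed_vector" and g :: "real^'m::finite \<Rightarrow> real^'k"
  assumes "open S" "smooth_on S g" "g ` S \<subseteq> T" "diff_upto k T f"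
  shows "diff_upto k S (\<lambda>x. f (g x))"
  using assms(4)
proof (induction k arbitrary: f)
  case 0
  show ?case
  proof (simp, intro ballI)
    fix x assume x: "x \<in> S"
    have "f differentiable (at (g x))" using 0 x assms(3) by auto
    then show "(\<lambda>x. f (g x)) differentiable (at x)"
      using differentiable_chain_at[OF smooth_on_differentiable[OF assms(2) x]] by (simp add: comp_def)
  qed
next
  case (Suc k)
  have dg: "g differentiable (at x)" if "x \<in> S" for x
    using smooth_on_differentiable[OF assms(2) that] .
  have df: "f differentiable (at (g x))" if "x \<in> S" for x
    using Suc.prems assms(3) that by auto
  have "smooth_on S (\<lambda>x. g x $ j)" for j
    using smooth_on_linear[OF assms(1) bounded_linear_vec_nth assms(2)] .
  then have "diff_upto k S (\<lambda>x. pd i (\<lambda>x. g x $ j) x)" for i j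
    using smooth_on_pd smooth_on_diff_upto by blast
  moreover have "diff_upto k S (\<lambda>x. pd j f (g x))" for j
    using Suc by auto
  ultimately have "diff_upto k S (\<lambda>x. pd i (\<lambda>x. g x $ j) x *\<^sub>R pd j f (g x))" for i j
    by (rule diff_upto_bilinear[OF assms(1) bounded_bilinear_scaleR])
  then have s: "diff_upto k S (\<lambda>x. \<Sum>j\<in>UNIV. pd i (\<lambda>x. g x $ j) x *\<^sub>R pd j f (g x))" for i
    by (intro diff_upto_sum[OF assms(1)])
  have "diff_upto k S (pd i (\<lambda>x. f (g x)))" for i
    by (subst diff_upto_cong[OF assms(1), where g="\<lambda>x. \<Sum>j\<in>UNIV. pd i (\<lambda>x. g x $ j) x *\<^sub>R pd j f (g x)"])
       (auto intro!: pd_compose dg df s)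
  moreover have "\<forall>x\<in>S. (\<lambda>x. f (g x)) differentiable (at x)"
    using differentiable_chain_at[OF dg df] by (simp add: comp_def)
  ultimately show ?case by simp
qed

lemma smooth_on_compose:
  fixes f :: "real^'k::finite \<Rightarrow> 'b::real_normed_vector" and g :: "real^'m::finite \<Rightarrow> real^'k"
  assumes "open S" "smooth_on S g" "g ` S \<subseteq> T" "smooth_on T f"
  shows "smooth_on S (\<lambda>x. f (g x))"
  unfolding smooth_on_diff_upto
proof
  fix k
  have "diff_upto k T f" using assms(4) unfolding smooth_on_diff_upto by (rule spec)
  then show "diff_upto k S (\<lambda>x. f (g x))" by (rule diff_upto_compose[OF assms(1-3)])
qed

text \<open>A smooth function of one variable is
  presented as a member of a family that is closed under differentiation.\<close>

lemma smooth_on_real_compose: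
  fixes F :: "real^'m::finite \<Rightarrow> real" and \<G> :: "(real \<Rightarrow> real) set"
  assumes "open S" "smooth_on S F"
    and der: "\<And>g. g \<in> \<G> \<Longrightarrow> \<exists>g'\<in>\<G>. \<forall>x\<in>S. (g has_real_derivative g' (F x)) (at (F x))"
    and "g \<in> \<G>"
  shows "smooth_on S (\<lambda>x. g (F x))"
proof -
  have "diff_upto k S (\<lambda>x. g (F x))" for k
    using assms(4)
  proof (induction k arbitrary: g)
    case 0
    obtain g' where g': "\<forall>x\<in>S. (g has_real_derivative g' (F x)) (at (F x))" using der[OF 0] by blast
    show ?case
    proof (simp, intro ballI)
      fix x assume x: "x \<in> S"
      have "g differentiable (at (F x))" using g' x by (meson real_differentiable_def)
      then show "(\<lambda>x. g (F x)) differentiable (at x)"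
        using differentiable_chain_at[OF smooth_on_differentiable[OF assms(2) x], of g] by (simp add: comp_def)
    qed
  next
    case (Suc k)
    obtain g' where g': "g' \<in> \<G>" "\<forall>x\<in>S. (g has_real_derivative g' (F x)) (at (F x))" using der[OF Suc.prems] by blast
    have "diff_upto k S (\<lambda>x. g' (F x))" using Suc.IH[OF g'(1)] .
    moreover have "diff_upto k S (pd i F)" for i
      using smooth_on_pd[OF assms(2)] smooth_on_diff_upto by blast
    ultimately have *: "diff_upto k S (\<lambda>x. g' (F x) * pd i F x)" for i
      by (rule diff_upto_bilinear[OF assms(1) bounded_bilinear_mult])
    have pd: "pd i (\<lambda>x. g (F x)) x = g' (F x) * pd i F x" "(\<lambda>x. g (F x)) differentiable (at x)" if x: "x \<in> S" for i x
    proof -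
      obtain F' where F': "(F has_derivative F') (at x)"
        using smooth_on_differentiable[OF assms(2) x] by (auto simp: differentiable_def)
      have "(g has_derivative (\<lambda>h. g' (F x) * h)) (at (F x))"
        using g'(2) x by (simp add: has_field_derivative_def)
      from has_derivative_compose[OF F' this]
      have *: "((\<lambda>x. g (F x)) has_derivative (\<lambda>h. g' (F x) * F' h)) (at x)" .
      then show "pd i (\<lambda>x. g (F x)) x = g' (F x) * pd i F x" "(\<lambda>x. g (F x)) differentiable (at x)"
        using pd_at[OF *] pd_at[OF F'] by (auto simp: differentiable_def)
    qed
    have "diff_upto k S (pd i (\<lambda>x. g (F x)))" for i
      by (subst diff_upto_cong[OF assms(1), where g="\<lambda>x. g' (F x) * pd i F x"]) (auto simp: pd *)
    then show ?case using pd by auto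
  qed
  then show ?thesis by (simp add: smooth_on_diff_upto)
qed

lemma smooth_on_powr:
  fixes F :: "real^'m::finite \<Rightarrow> real"
  assumes "open S" "smooth_on S F" "\<And>x. x \<in> S \<Longrightarrow> F x > 0"
  shows "smooth_on S (\<lambda>x. F x powr a)"
proof (rule smooth_on_real_compose[OF assms(1,2), where \<G>="{g. \<exists>c a. g = (\<lambda>t. c * t powr a)}"])
  fix g :: "real \<Rightarrow> real" assume "g \<in> {g. \<exists>c a. g = (\<lambda>t. c * t powr a)}"
  then obtain c a where g: "g = (\<lambda>t. c * t powr a)" by blast
  have "(g has_real_derivative (c * a) * F x powr (a - 1)) (at (F x))" if "x \<in> S" for x
    unfolding g using assms(3)[OF that] by (auto intro!: derivative_eq_intros)
  then show "\<exists>g'\<in>{g. \<exists>c a. g = (\<lambda>t. c * t powr a)}. \<forall>x\<in>S. (g has_real_derivative g' (F x)) (at (F x))"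
    by (intro bexI[of _ "\<lambda>t. (c * a) * t powr (a - 1)"]) auto
qed (rule CollectI, rule exI[of _ 1], rule exI[of _ a], simp)

lemma smooth_on_sqrt:
  fixes F :: "real^'m::finite \<Rightarrow> real"
  assumes "open S" "smooth_on S F" "\<And>x. x \<in> S \<Longrightarrow> F x > 0"
  shows "smooth_on S (\<lambda>x. sqrt (F x))"
  by (rule smooth_on_cong[OF assms(1) _ smooth_on_powr[OF assms, of "1/2"]])
     (use assms(3) in \<open>auto simp: powr_half_sqrt less_imp_le\<close>)

lemma smooth_on_inverse:
  fixes F :: "real^'m::finite \<Rightarrow> real"
  assumes "open S" "smooth_on S F" "\<And>x. x \<in> S \<Longrightarrow> F x > 0"
  shows "smooth_on S (\<lambda>x. inverse (F x))"
  by (rule smooth_on_cong[OF assms(1) _ smooth_on_powr[OF assms, of "-1"]])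
     (use assms(3) in \<open>auto simp: powr_minus less_imp_le abs_of_pos\<close>)

lemma smooth_on_ident:
  assumes "open S"
  shows "smooth_on S (\<lambda>x. x)"
proof -
  have pdi: "pd i (\<lambda>x::real^'a. x) = (\<lambda>x. axis i 1)" for i
    by (rule ext) (rule pd_at[of _ "\<lambda>h. h"], simp)
  have "diff_upto k S (\<lambda>x. x)" for k
    by (cases k) (auto simp: pdi diff_upto_const)
  then show ?thesis by (simp add: smooth_on_diff_upto)
qed

section \<open>Determinants and inverses of matrix-valued functions\<close>

lemma matrix_inv_right: "det A \<noteq> 0 \<Longrightarrow> A ** matrix_inv A = mat 1"
  and matrix_inv_left: "det A \<noteq> 0 \<Longrightarrow> matrix_inv A ** A = mat 1" for A :: "real^'n^'n"
  using someI_ex[of "\<lambda>A'. A ** A' = mat 1 \<and> A' ** A = mat 1"]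
  unfolding invertible_det_nz[symmetric] invertible_def matrix_inv_def by blast+

lemma matrix_inv_unique:
  fixes A B :: "real^'n^'n"
  assumes "A ** B = mat 1"
  shows "matrix_inv A = B"
proof -
  have "det A \<noteq> 0" using assms matrix_left_right_inverse unfolding invertible_det_nz[symmetric] invertible_def by blast
  then have "matrix_inv A ** (A ** B) = B"
    by (simp add: matrix_mul_assoc matrix_inv_left)
  then show ?thesis using assms by simp
qed

text \<open>Cramer's rule presents the inverse as a rational function of the entries, which makes it smooth.\<close>

lemma matrix_inv_entry:
  fixes A :: "real^'n^'n"
  assumes "det A \<noteq> 0"
  shows "matrix_inv A $ k $ l = det (\<chi> i j. if j = k then (mat 1 :: real^'n^'n) $ i $ l else A $ i $ j) / det A"
proof -
  let ?x = "\<chi> k. matrix_inv A $ k $ l" and ?b = "\<chi> i. (mat 1 :: real^'n^'n) $ i $ l"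
  have "A *v ?x = ?b"
    using matrix_inv_right[OF assms] by (simp add: vec_eq_iff matrix_vector_mult_def matrix_matrix_mult_def)
  then have "?x = (\<chi> k. det (\<chi> i j. if j = k then ?b $ i else A $ i $ j) / det A)"
    using cramer[OF assms] by blast
  then have "?x $ k = (\<chi> k. det (\<chi> i j. if j = k then ?b $ i else A $ i $ j) / det A) $ k" by (rule arg_cong)
  then show ?thesis by (simp only: vec_lambda_beta)
qed

lemma bounded_bilinear_matrix_mult:
  "bounded_bilinear ((**) :: real^'n^'m \<Rightarrow> real^'p^'n \<Rightarrow> real^'p^'m)"
proof (subst bilinear_conv_bounded_bilinear[symmetric])
  show "bilinear ((**) :: real^'n^'m \<Rightarrow> real^'p^'n \<Rightarrow> real^'p^'m)"
    unfolding bilinear_def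
    by (auto intro!: linearI simp: vec_eq_iff matrix_matrix_mult_def
        sum.distrib sum_distrib_left algebra_simps)
qed

lemma smooth_on_entry:
  fixes A :: "real^'m::finite \<Rightarrow> real^'k^'l"
  assumes "open S" "smooth_on S A"
  shows "smooth_on S (\<lambda>x. A x $ i $ j)"
  using smooth_on_linear[OF assms(1) bounded_linear_vec_nth smooth_on_linear[OF assms(1) bounded_linear_vec_nth assms(2)]] .

lemma smooth_on_matrixI:
  fixes A :: "real^'m::finite \<Rightarrow> real^'k^'l"
  assumes "open S" "\<And>i j. smooth_on S (\<lambda>x. A x $ i $ j)"
  shows "smooth_on S A"
  using assms smooth_on_vec_iff[OF assms(1), of A] smooth_on_vec_iff[OF assms(1), of "\<lambda>x. A x $ _"] by blast

lemma smooth_on_det: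
  fixes A :: "real^'m::finite \<Rightarrow> real^'n^'n"
  assumes "open S" "smooth_on S A"
  shows "smooth_on S (\<lambda>x. det (A x))"
  unfolding det_def
  by (intro smooth_on_sum smooth_on_mult smooth_on_const smooth_on_prod smooth_on_entry assms)

lemma smooth_on_matrix_inv:
  fixes A :: "real^'m::finite \<Rightarrow> real^'n^'n"
  assumes "open S" "smooth_on S A" "\<And>x. x \<in> S \<Longrightarrow> det (A x) > 0"
  shows "smooth_on S (\<lambda>x. matrix_inv (A x))"
proof (rule smooth_on_matrixI[OF assms(1)])
  fix k l
  have m: "smooth_on S (\<lambda>x. \<chi> i j. if j = k then (mat 1 :: real^'n^'n) $ i $ l else A x $ i $ j)"
  proof (rule smooth_on_matrixI[OF assms(1)])
    show "smooth_on S (\<lambda>x. (\<chi> i j. if j = k then (mat 1 :: real^'n^'n) $ i $ l else A x $ i $ j) $ i $ j)" for i j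
      by (cases "j = k") (simp_all add: smooth_on_const smooth_on_entry[OF assms(1,2)])
  qed
  show "smooth_on S (\<lambda>x. matrix_inv (A x) $ k $ l)"
  proof (rule smooth_on_cong[OF assms(1)])
    show "matrix_inv (A x) $ k $ l =
        det (\<chi> i j. if j = k then (mat 1 :: real^'n^'n) $ i $ l else A x $ i $ j) * inverse (det (A x))"
      if "x \<in> S" for x
      using matrix_inv_entry[of "A x" k l] assms(3)[OF that] by (simp add: divide_inverse)
    show "smooth_on S (\<lambda>x. det (\<chi> i j. if j = k then (mat 1 :: real^'n^'n) $ i $ l else A x $ i $ j) * inverse (det (A x)))"
      by (intro smooth_on_mult smooth_on_inverse smooth_on_det m assms)
  qed
qed

text \<open>All matrices on the segment from the identity to \<open>A\<close> are definite, hence invertible, so the determinant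
  keeps its sign along it.\<close>

lemma pos_def_det_pos:
  fixes A :: "real^'n^'n"
  assumes "\<And>w. w \<noteq> 0 \<Longrightarrow> w \<bullet> (A *v w) > 0"
  shows "det A > 0"
proof -
  define B where "B t = (1 - t) *\<^sub>R mat 1 + t *\<^sub>R A" for t :: real
  have nz: "det (B t) \<noteq> 0" if "t \<in> {0..1}" for t
  proof -
    have "x = 0" if "B t *v x = 0" for x
    proof (rule ccontr)
      assume x: "x \<noteq> 0"
      have "x \<bullet> (B t *v x) = (1 - t) * (x \<bullet> x) + t * (x \<bullet> (A *v x))"
        by (simp add: B_def matrix_vector_mult_add_rdistrib scaleR_matrix_vector_assoc[symmetric] inner_add_right)
      moreover have "\<dots> > 0"
      proof (cases "t = 0")
        case True
        then show ?thesis using x by simp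
      next
        case False
        then have "t * (x \<bullet> (A *v x)) > 0" using \<open>t \<in> {0..1}\<close> assms[OF x] by simp
        moreover have "(1 - t) * (x \<bullet> x) \<ge> 0" using \<open>t \<in> {0..1}\<close> by simp
        ultimately show ?thesis by simp
      qed
      ultimately show False using that by simp
    qed
    then have "invertible (B t)"
      by (metis invertible_left_inverse matrix_left_invertible_ker)
    then show ?thesis by (simp add: invertible_det_nz)
  qed
  have "continuous_on {0..1} (\<lambda>t. det (B t))"
    unfolding B_def det_def by (intro continuous_intros)
  then have conn: "connected ((\<lambda>t. det (B t)) ` {0..1})"
    by (intro connected_continuous_image) auto
  show ?thesis
  proof (rule ccontr)
    assume "\<not> ?thesis"
    then have "det (B 1) \<le> 0" by (simp add: B_def)
    moreover have "det (B 0) = 1" by (simp add: B_def)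
    ultimately have "0 \<in> (\<lambda>t. det (B t)) ` {0..1}"
      using connectedD_interval[OF conn, of "det (B 1)" "det (B 0)" 0] by auto
    then show False using nz by auto
  qed
qed

lemma sum_option: "sum f (UNIV :: 'n::finite option set) = f None + (\<Sum>i\<in>UNIV. f (Some i))"
  unfolding UNIV_option_conv by (subst sum.insert) (auto simp: sum.reindex)

lemma prod_option: "prod f (UNIV :: 'n::finite option set) = f None * (\<Prod>i\<in>UNIV. f (Some i))"
  unfolding UNIV_option_conv by (subst prod.insert) (auto simp: prod.reindex)

text \<open>Only the permutations that fix \<open>None\<close> contribute.\<close>

lemma det_option_block:
  fixes A :: "real^('n::finite option)^('n option)"
  assumes "\<And>i. A $ None $ Some i = 0"
  shows "det A = A $ None $ None * det (\<chi> i j. A $ Some i $ Some j)"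
proof -
  let ?M = "\<lambda>p. map_permutation (UNIV::'n set) Some p"
  have bij: "bij_betw ?M {p. p permutes (UNIV::'n set)} {q. q permutes range (Some :: 'n \<Rightarrow> _)}"
  proof -
    have "bij_betw (Some :: 'n \<Rightarrow> _) UNIV (range Some)" by (simp add: bij_betw_def)
    from bij_betw_permutations[OF this]
    have "bij_betw (\<lambda>\<pi> x. if x \<in> range Some then Some (\<pi> (inv_into UNIV Some x)) else x)
        {p. p permutes (UNIV::'n set)} {q. q permutes range (Some :: 'n \<Rightarrow> _)}" .
    then show ?thesis
      by (rule bij_betw_cong[THEN iffD1, rotated]) (auto simp: map_permutation_def restrict_id_def fun_eq_iff)
  qed
  have MN: "?M p None = None" and MS: "?M p (Some i) = Some (p i)" for p i
    by (auto simp: map_permutation_def restrict_id_def)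
  define F where "F q = of_int (sign q) * (\<Prod>i\<in>UNIV. A $ i $ q i)" for q
  have fin: "finite {q. q permutes range (Some :: 'n \<Rightarrow> _)}" by (rule finite_permutations) simp
  have "det A = sum F {q. q permutes insert None (range Some)}"
    by (simp add: det_def F_def UNIV_option_conv)
  also have "\<dots> = (\<Sum>b\<in>insert None (range Some). \<Sum>q | q permutes range Some. F (Transposition.transpose None b \<circ> q))"
    by (rule sum_over_permutations_insert) auto
  also have "\<dots> = (\<Sum>b\<in>{None}. \<Sum>q | q permutes range Some. F (Transposition.transpose None b \<circ> q))"
  proof (rule sum.mono_neutral_right)
    show "\<forall>b\<in>insert None (range Some) - {None}. (\<Sum>q | q permutes range Some. F (Transposition.transpose None b \<circ> q)) = 0"
    proof
      fix b :: "'n option" assume "b \<in> insert None (range Some) - {None}"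
      then obtain i where b: "b = Some i" by auto
      have "F (Transposition.transpose None b \<circ> q) = 0" if "q permutes range Some" for q
      proof -
        have "q None = None" using that by (auto simp: permutes_def)
        then have "(Transposition.transpose None b \<circ> q) None = Some i" by (simp add: b)
        then show ?thesis unfolding F_def prod_option by (simp add: assms)
      qed
      then show "(\<Sum>q | q permutes range Some. F (Transposition.transpose None b \<circ> q)) = 0" by simp
    qed
  qed auto
  also have "\<dots> = (\<Sum>q | q permutes range Some. F q)" by simp
  also have "\<dots> = (\<Sum>p | p permutes (UNIV::'n set). F (?M p))"
    using sum.reindex_bij_betw[OF bij] by metis
  also have "\<dots> = (\<Sum>p | p permutes (UNIV::'n set). A $ None $ None * (of_int (sign p) * (\<Prod>i\<in>UNIV. A $ Some i $ Some (p i))))"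
  proof (rule sum.cong)
    fix p :: "'n \<Rightarrow> 'n" assume "p \<in> {p. p permutes UNIV}"
    then have "sign (?M p) = sign p" by (intro sign_map_permutation) auto
    then show "F (?M p) = A $ None $ None * (of_int (sign p) * (\<Prod>i\<in>UNIV. A $ Some i $ Some (p i)))"
      by (simp add: F_def prod_option MN MS)
  qed simp
  also have "\<dots> = A $ None $ None * det (\<chi> i j. A $ Some i $ Some j)"
    by (simp add: det_def sum_distrib_left)
  finally show ?thesis .
qed

section \<open>The Laplacian of the Poincare-Einstein metric\<close>

lemma g_plus_entries:
  "g_plus H y $ None $ None = 1 / (y $ None)\<^sup>2"
  "g_plus H y $ None $ Some i = 0"
  "g_plus H y $ Some i $ None = 0"
  "g_plus H y $ Some i $ Some j = H (y $ None) (base_part y) $ i $ j / (y $ None)\<^sup>2"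
  by (simp_all add: g_plus_def)

lemma det_scaleR: "det (c *\<^sub>R A) = c ^ CARD('n) * det A" for A :: "real^'n::finite^'n"
proof -
  have "c *\<^sub>R A = (\<chi> i. c *s (A $ i))" by (simp add: vec_eq_iff)
  then show ?thesis using det_rows_mul[of "\<lambda>_. c" "\<lambda>i. A $ i"] by simp
qed

lemma det_g_plus:
  fixes H :: "real \<Rightarrow> real^'n::finite \<Rightarrow> real^'n^'n"
  shows "det (g_plus H y) = det (H (y $ None) (base_part y)) / (y $ None) ^ (2 * CARD('n) + 2)"
proof -
  have "(\<chi> i j. g_plus H y $ Some i $ Some j) = (1 / (y $ None)\<^sup>2) *\<^sub>R H (y $ None) (base_part y)"
    by (simp add: vec_eq_iff g_plus_entries)
  then have "det (g_plus H y) = (1 / (y $ None)\<^sup>2) * ((1 / (y $ None)\<^sup>2) ^ CARD('n) * det (H (y $ None) (base_part y)))"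
    by (subst det_option_block) (simp_all add: g_plus_entries det_scaleR)
  also have "(1 / (y $ None)\<^sup>2) * (1 / (y $ None)\<^sup>2) ^ CARD('n) = 1 / (y $ None) ^ (2 * CARD('n) + 2)"
    by (simp add: power_one_over power_mult power_add) (simp add: power2_eq_square)
  then have "(1 / (y $ None)\<^sup>2) * ((1 / (y $ None)\<^sup>2) ^ CARD('n) * d) = d / (y $ None) ^ (2 * CARD('n) + 2)" for d
    by (metis mult.assoc mult.commute mult.right_neutral times_divide_eq_right)
  finally show ?thesis .
qed

lemma matrix_inv_g_plus:
  fixes H :: "real \<Rightarrow> real^'n::finite \<Rightarrow> real^'n^'n"
  assumes "y $ None \<noteq> 0" "det (H (y $ None) (base_part y)) \<noteq> 0"
  shows "matrix_inv (g_plus H y) $ None $ None = (y $ None)\<^sup>2"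
    "matrix_inv (g_plus H y) $ None $ Some i = 0"
    "matrix_inv (g_plus H y) $ Some i $ None = 0"
    "matrix_inv (g_plus H y) $ Some i $ Some j = (y $ None)\<^sup>2 * matrix_inv (H (y $ None) (base_part y)) $ i $ j"
proof -
  let ?h = "H (y $ None) (base_part y)"
  define B :: "real^('n option)^('n option)" where
    "B = (\<chi> a b. case (a, b) of (None, None) \<Rightarrow> (y $ None)\<^sup>2
       | (Some i, Some j) \<Rightarrow> (y $ None)\<^sup>2 * matrix_inv ?h $ i $ j | _ \<Rightarrow> 0)"
  have "(g_plus H y ** B) $ a $ b = (mat 1 :: real^('n option)^('n option)) $ a $ b" for a b
  proof -
    have *: "(\<Sum>k\<in>UNIV. ?h $ i $ k * matrix_inv ?h $ k $ j) = (mat 1 :: real^'n^'n) $ i $ j" for i j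
      using arg_cong[OF matrix_inv_right[OF assms(2)], of "\<lambda>M. M $ i $ j"]
      by (simp add: matrix_matrix_mult_def)
    show ?thesis using assms(1) *
      by (cases a; cases b) (simp_all add: matrix_matrix_mult_def sum_option g_plus_entries B_def mat_def)
  qed
  then have "g_plus H y ** B = mat 1" by (simp add: vec_eq_iff)
  then have "matrix_inv (g_plus H y) = B" by (rule matrix_inv_unique)
  then show "matrix_inv (g_plus H y) $ None $ None = (y $ None)\<^sup>2"
    "matrix_inv (g_plus H y) $ None $ Some i = 0"
    "matrix_inv (g_plus H y) $ Some i $ None = 0"
    "matrix_inv (g_plus H y) $ Some i $ Some j = (y $ None)\<^sup>2 * matrix_inv ?h $ i $ j"
    by (simp_all add: B_def)
qed

lemma join_base [simp]: "join x r $ None = r" "join x r $ Some i = x $ i" "base_part (join x r) = x"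
  by (simp_all add: join_def base_part_def vec_eq_iff)

lemma bounded_linear_base_part: "bounded_linear base_part"
  by (rule linear_conv_bounded_linear[THEN iffD1], rule linearI) (auto simp: base_part_def vec_eq_iff)

lemma open_cylinder:
  fixes S :: "(real^'n::finite) set"
  assumes "open S"
  shows "open {y :: real^('n option). y $ None > 0 \<and> base_part y \<in> S}"
proof -
  have "{y. y $ None > 0 \<and> base_part y \<in> S} = {y. y $ None > 0} \<inter> base_part -` S" by auto
  moreover have "open {y :: real^('n option). y $ None > 0}" by (intro open_Collect_less continuous_intros)
  moreover have "open (base_part -` S :: (real^('n option)) set)"
    using bounded_linear.continuous_on[OF bounded_linear_base_part continuous_on_id]
    by (intro open_vimage assms) auto
  ultimately show ?thesis by auto
qed

lemma bounded_linear_join_left: "bounded_linear (\<lambda>x. join x 0)"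
  by (rule linear_conv_bounded_linear[THEN iffD1], rule linearI) (auto simp: join_def vec_eq_iff split: option.split)

lemma join_add: "join x r = join x 0 + r *\<^sub>R axis None 1"
  by (auto simp: join_def vec_eq_iff axis_def split: option.split)

lemma pd_Some_join:
  assumes "F differentiable (at (join x r))"
  shows "pd (Some i) F (join x r) = pd i (\<lambda>x. F (join x r)) x"
    and "(\<lambda>x. F (join x r)) differentiable (at x)"
proof -
  obtain F' where F': "(F has_derivative F') (at (join x r))"
    using assms by (auto simp: differentiable_def)
  have "((\<lambda>x. join x r) has_derivative (\<lambda>v. join v 0)) (at x)"
    by (subst join_add) (auto intro!: derivative_eq_intros bounded_linear.has_derivative[OF bounded_linear_join_left])
  from has_derivative_compose[OF this F']
  have *: "((\<lambda>x. F (join x r)) has_derivative (\<lambda>v. F' (join v 0))) (at x)" .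
  have "join (axis i 1) 0 = axis (Some i) 1"
    by (auto simp: join_def vec_eq_iff axis_def split: option.split)
  then show "pd (Some i) F (join x r) = pd i (\<lambda>x. F (join x r)) x"
    using pd_at[OF F'] pd_at[OF *] by simp
  show "(\<lambda>x. F (join x r)) differentiable (at x)" using * by (auto simp: differentiable_def)
qed

lemma pd_None_join:
  assumes "F differentiable (at (join x r))"
  shows "((\<lambda>r. F (join x r)) has_vector_derivative pd None F (join x r)) (at r)"
proof -
  obtain F' where F': "(F has_derivative F') (at (join x r))"
    using assms by (auto simp: differentiable_def)
  have "((\<lambda>r. join x r) has_derivative (\<lambda>v. v *\<^sub>R axis None 1)) (at r)"
    by (subst join_add) (auto intro!: derivative_eq_intros)
  from has_derivative_compose[OF this F']
  have *: "((\<lambda>r. F (join x r)) has_derivative (\<lambda>v. F' (v *\<^sub>R axis None 1))) (at r)" .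
  then show ?thesis
    using pd_at[OF F'] by (simp add: has_vector_derivative_def linear_scale[OF has_derivative_linear[OF F']])
qed

text \<open>The radial part is kept as the derivative of one product \<open>Y\<close>: this is the form in which it can later be
  integrated, without expanding the radial derivative of the volume density.\<close>

lemma laplacian_g_plus:
  fixes H :: "real \<Rightarrow> real^'n::finite \<Rightarrow> real^'n^'n" and u :: "real^('n option) \<Rightarrow> complex"
  assumes \<Omega>: "open \<Omega>" "\<And>y. y \<in> \<Omega> \<Longrightarrow> y $ None > 0" "\<And>y. y \<in> \<Omega> \<Longrightarrow> det (H (y $ None) (base_part y)) > 0"
    and H: "smooth_on \<Omega> (\<lambda>y. H (y $ None) (base_part y))"
    and u: "smooth_on \<Omega> u"
    and x: "join x r \<in> \<Omega>"
  defines "Y \<equiv> \<lambda>r. (r powr (1 - real CARD('n)) * sqrt (det (H r x))) *\<^sub>R vector_derivative (\<lambda>r. u (join x r)) (at r)"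
  defines "Z \<equiv> (\<Sum>i\<in>UNIV. \<Sum>j\<in>UNIV. pd i (\<lambda>z. (sqrt (det (H r z)) * matrix_inv (H r z) $ i $ j) *\<^sub>R pd j (\<lambda>z. u (join z r)) z) x)"
  shows "(Y has_vector_derivative
      (r powr (- real CARD('n) - 1) * sqrt (det (H r x))) *\<^sub>R laplacian (g_plus H) u (join x r)
        - r powr (1 - real CARD('n)) *\<^sub>R Z) (at r)"
proof -
  define n where "n = real CARD('n)"
  define \<rho> where "\<rho> y = y $ None" for y :: "real^('n option)"
  define V where "V y = sqrt (det (H (\<rho> y) (base_part y)))" for y
  define W where "W i j y = V y * matrix_inv (H (\<rho> y) (base_part y)) $ i $ j" for i j y
  have \<rho>: "smooth_on \<Omega> \<rho>" 
    unfolding \<rho>_def by (rule smooth_on_linear[OF \<Omega>(1) bounded_linear_vec_nth smooth_on_ident[OF \<Omega>(1)]])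
  have V: "smooth_on \<Omega> V" unfolding V_def \<rho>_def by (intro smooth_on_sqrt smooth_on_det \<Omega> H)
  have W: "smooth_on \<Omega> (W i j)" for i j
    unfolding W_def \<rho>_def
    by (rule smooth_on_mult[OF \<Omega>(1) V[unfolded \<rho>_def] smooth_on_entry[OF \<Omega>(1) smooth_on_matrix_inv[OF \<Omega>(1) H \<Omega>(3)]]])
  have P: "smooth_on \<Omega> (\<lambda>y. \<rho> y powr a)" for a
    using smooth_on_powr[OF \<Omega>(1) \<rho>] \<Omega>(2) by (simp add: \<rho>_def)
  have detg: "sqrt (det (g_plus H y)) = \<rho> y powr (- n - 1) * V y" if "y \<in> \<Omega>" for y
  proof -
    have r: "\<rho> y > 0" using \<Omega>(2)[OF that] by (simp add: \<rho>_def)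
    have "sqrt ((\<rho> y) ^ (2 * CARD('n) + 2)) = (\<rho> y) ^ (CARD('n) + 1)"
    proof (rule real_sqrt_unique)
      show "((\<rho> y) ^ (CARD('n) + 1))\<^sup>2 = (\<rho> y) ^ (2 * CARD('n) + 2)"
        by (subst power_mult[symmetric]) (rule arg_cong[where f="\<lambda>k. \<rho> y ^ k"], simp)
    qed (use r in simp)
    moreover have "\<rho> y powr (- n - 1) = 1 / (\<rho> y) ^ (CARD('n) + 1)"
    proof -
      have "- n - 1 = - real (CARD('n) + 1)" by (simp add: n_def)
      then show ?thesis by (simp only: powr_minus_divide powr_realpow[OF r])
    qed
    ultimately show ?thesis
      by (simp add: det_g_plus V_def \<rho>_def real_sqrt_divide)
  qed
  define G where "G a b = (\<lambda>z. (sqrt (det (g_plus H z)) * matrix_inv (g_plus H z) $ a $ b) *\<^sub>R pd b u z)" for a b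
  have pw: "\<rho> y powr (- n - 1) * (\<rho> y)\<^sup>2 = \<rho> y powr (1 - n)" if "y \<in> \<Omega>" for y
    using \<Omega>(2)[OF that] powr_add[of "\<rho> y" "- n - 1" 2] by (simp add: \<rho>_def)
  have GN: "G None None y = (\<rho> y powr (1 - n) * V y) *\<^sub>R pd None u y" if "y \<in> \<Omega>" for y
    using matrix_inv_g_plus(1)[of y H] \<Omega>(2,3)[OF that] pw[OF that]
    by (simp add: G_def detg[OF that] flip: \<rho>_def)
  have G0: "G None (Some i) y = 0" "G (Some i) None y = 0" if "y \<in> \<Omega>" for y i
    using matrix_inv_g_plus(2,3)[of y H] \<Omega>(2,3)[OF that] unfolding G_def by auto
  have GS: "G (Some i) (Some j) y = (\<rho> y powr (1 - n)) *\<^sub>R (W i j y *\<^sub>R pd (Some j) u y)" if "y \<in> \<Omega>" for y i j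
    using matrix_inv_g_plus(4)[of y H] \<Omega>(2,3)[OF that] pw[OF that]
    by (simp add: G_def detg[OF that] W_def flip: \<rho>_def)
  have pdG0: "pd None (G None (Some i)) (join x r) = 0" "pd (Some i) (G (Some i) None) (join x r) = 0" for i
    using pd_cong[OF \<Omega>(1) x, of "G None (Some i)" "\<lambda>_. 0"] pd_cong[OF \<Omega>(1) x, of "G (Some i) None" "\<lambda>_. 0"] G0 by auto
  have du: "u differentiable (at y)" if "y \<in> \<Omega>" for y using smooth_on_differentiable[OF u that] .
  have r: "r > 0" using \<Omega>(2)[OF x] by simp
  have contj: "continuous_on UNIV (\<lambda>z. join z r)" "continuous_on UNIV (\<lambda>r. join x r)" for x :: "real^'n" and r
    by (subst join_add, intro continuous_intros linear_continuous_on bounded_linear_join_left)+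
  have op1: "open {z. join z r \<in> \<Omega>}" and op2: "open {r. join x r \<in> \<Omega>}"
    using open_vimage[OF \<Omega>(1) contj(1)[of r]] open_vimage[OF \<Omega>(1) contj(2)[of x]] by (auto simp: vimage_def)
  have lap: "laplacian (g_plus H) u (join x r) =
      (pd None (G None None) (join x r) + (\<Sum>i\<in>UNIV. \<Sum>j\<in>UNIV. pd (Some i) (G (Some i) (Some j)) (join x r)))
        /\<^sub>R (r powr (- n - 1) * V (join x r))"
    unfolding laplacian_def G_def[symmetric] sum_option
    by (simp add: pdG0 sum.distrib detg[OF x]) (simp add: \<rho>_def)
  define GN' where "GN' = (\<lambda>y. (\<rho> y powr (1 - n) * V y) *\<^sub>R pd None u y)"
  have "smooth_on \<Omega> GN'" unfolding GN'_def
    by (intro smooth_on_scaleR smooth_on_mult \<Omega> P V smooth_on_pd u)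
  then have "((\<lambda>r. GN' (join x r)) has_vector_derivative pd None GN' (join x r)) (at r)"
    by (rule pd_None_join[OF smooth_on_differentiable[OF _ x]])
  then have "(Y has_vector_derivative pd None GN' (join x r)) (at r)"
  proof (rule has_vector_derivative_transform_within_open[OF _ op2])
    fix r' assume "r' \<in> {r. join x r \<in> \<Omega>}"
    then have "join x r' \<in> \<Omega>" by simp
    then have "vector_derivative (\<lambda>r. u (join x r)) (at r') = pd None u (join x r')"
      by (intro vector_derivative_at pd_None_join du)
    then show "GN' (join x r') = Y r'" by (simp add: GN'_def Y_def \<rho>_def V_def n_def)
  qed (use x in simp)
  moreover have "pd None GN' (join x r) = pd None (G None None) (join x r)"
    using pd_cong[OF \<Omega>(1) x GN] by (simp add: GN'_def)
  moreover have "pd (Some i) (G (Some i) (Some j)) (join x r) =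
      r powr (1 - n) *\<^sub>R pd i (\<lambda>z. (sqrt (det (H r z)) * matrix_inv (H r z) $ i $ j) *\<^sub>R pd j (\<lambda>z. u (join z r)) z) x" for i j
  proof -
    define K where "K = (\<lambda>y. W i j y *\<^sub>R pd (Some j) u y)"
    have K: "smooth_on \<Omega> K" unfolding K_def by (intro smooth_on_scaleR \<Omega> W smooth_on_pd u)
    have "pd (Some i) (G (Some i) (Some j)) (join x r) = pd (Some i) (\<lambda>y. (\<rho> y powr (1 - n)) *\<^sub>R K y) (join x r)"
      by (rule pd_cong[OF \<Omega>(1) x]) (simp add: GS K_def)
    also have "\<dots> = pd i (\<lambda>z. (r powr (1 - n)) *\<^sub>R K (join z r)) x"
      using pd_Some_join(1)[OF smooth_on_differentiable[OF smooth_on_scaleR[OF \<Omega>(1) P K] x], of i "1 - n"]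
      by (simp add: \<rho>_def)
    also have "\<dots> = r powr (1 - n) *\<^sub>R pd i (\<lambda>z. K (join z r)) x"
      by (intro pd_linear bounded_linear_scaleR_right pd_Some_join(2) smooth_on_differentiable[OF K x])
    also have "pd i (\<lambda>z. K (join z r)) x = pd i (\<lambda>z. (sqrt (det (H r z)) * matrix_inv (H r z) $ i $ j) *\<^sub>R pd j (\<lambda>z. u (join z r)) z) x"
    proof (rule pd_cong[OF op1])
      fix z assume "z \<in> {z. join z r \<in> \<Omega>}"
      then show "K (join z r) = (sqrt (det (H r z)) * matrix_inv (H r z) $ i $ j) *\<^sub>R pd j (\<lambda>z. u (join z r)) z"
        by (simp add: K_def W_def V_def \<rho>_def pd_Some_join(1)[OF du])
    qed (use x in simp)
    finally show ?thesis .
  qed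
  moreover have "V (join x r) = sqrt (det (H r x))" "V (join x r) > 0"
    using \<Omega>(3)[OF x] by (simp_all add: V_def \<rho>_def)
  moreover have "(c * d) *\<^sub>R (L /\<^sub>R (c * d)) = L" if "c > 0" "d > 0" for c d :: real and L :: complex
    using that right_inverse[of "c * d"] by (simp only: scaleR_scaleR) simp
  ultimately show ?thesis
    using r unfolding lap Z_def n_def by (simp add: scaleR_sum_right del: scaleR_scaleR)
qed

section \<open>Even expansions in the radial variable\<close>

text \<open>The remainder is \<open>o(r\<^sup>2\<^sup>m)\<close>; coefficients with index above \<open>m\<close> carry no information.\<close>

definition expands :: "nat \<Rightarrow> (real \<Rightarrow> 'b::real_normed_vector) \<Rightarrow> (nat \<Rightarrow> 'b) \<Rightarrow> bool" where
  "expands m F a \<longleftrightarrow>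
     ((\<lambda>r. (F r - (\<Sum>k\<le>m. r ^ (2*k) *\<^sub>R a k)) /\<^sub>R r ^ (2*m)) \<longlongrightarrow> 0) (at_right 0)"

lemma eventually_pos: "\<forall>\<^sub>F r in at_right 0. (r::real) > 0"
  by (simp add: eventually_at_filter)

lemma expands_cong:
  assumes "\<forall>\<^sub>F r in at_right 0. F r = G r" "\<And>k. k \<le> m \<Longrightarrow> a k = b k"
  shows "expands m F a \<longleftrightarrow> expands m G b"
  unfolding expands_def
proof (rule tendsto_cong)
  have s: "(\<Sum>k\<le>m. r ^ (2*k) *\<^sub>R a k) = (\<Sum>k\<le>m. r ^ (2*k) *\<^sub>R b k)" for r
    by (rule sum.cong) (auto simp: assms(2))
  show "\<forall>\<^sub>F r in at_right 0. (F r - (\<Sum>k\<le>m. r ^ (2*k) *\<^sub>R a k)) /\<^sub>R r ^ (2*m) =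
      (G r - (\<Sum>k\<le>m. r ^ (2*k) *\<^sub>R b k)) /\<^sub>R r ^ (2*m)"
    using assms(1) by eventually_elim (simp add: s)
qed

lemma tendsto_power_zero: "((\<lambda>r::real. r ^ Suc j) \<longlongrightarrow> 0) (at_right 0)"
proof -
  have "((\<lambda>r::real. r ^ Suc j) \<longlongrightarrow> 0 ^ Suc j) (at_right 0)"
    by (intro tendsto_power tendsto_ident_at)
  then show ?thesis by simp
qed

lemma power_quotient:
  assumes "(r::real) \<noteq> 0" "j \<le> k"
  shows "inverse (r ^ j) * r ^ k = r ^ (k - j)"
  using assms by (simp add: power_diff field_simps)

lemma expands_partial_sum: "expands m (\<lambda>r. \<Sum>k\<le>m. r ^ (2*k) *\<^sub>R a k) a"
  by (simp add: expands_def)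

lemma expands_finite_sum:
  assumes "m \<le> K"
  shows "expands m (\<lambda>r. \<Sum>k\<le>K. r ^ (2*k) *\<^sub>R a k) a"
proof -
  have split: "(\<Sum>k\<le>K. r ^ (2*k) *\<^sub>R a k) - (\<Sum>k\<le>m. r ^ (2*k) *\<^sub>R a k) = (\<Sum>k\<in>{m<..K}. r ^ (2*k) *\<^sub>R a k)" for r
  proof -
    have "{..K} - {..m} = {m<..K}" by auto
    then show ?thesis using sum_diff[of "{..K}" "{..m}" "\<lambda>k. r ^ (2*k) *\<^sub>R a k"] assms by simp
  qed
  have "((\<lambda>r. \<Sum>k\<in>{m<..K}. r ^ Suc (2*k - 2*m - 1) *\<^sub>R a k) \<longlongrightarrow> (\<Sum>k\<in>{m<..K}. 0 *\<^sub>R a k)) (at_right 0)"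
    by (intro tendsto_sum tendsto_scaleR tendsto_power_zero tendsto_const)
  then have "((\<lambda>r. \<Sum>k\<in>{m<..K}. r ^ Suc (2*k - 2*m - 1) *\<^sub>R a k) \<longlongrightarrow> 0) (at_right 0)" by simp
  then show ?thesis
    unfolding expands_def
  proof (rule Lim_transform_eventually)
    show "\<forall>\<^sub>F r in at_right 0. (\<Sum>k\<in>{m<..K}. r ^ Suc (2*k - 2*m - 1) *\<^sub>R a k) =
        ((\<Sum>k\<le>K. r ^ (2*k) *\<^sub>R a k) - (\<Sum>k\<le>m. r ^ (2*k) *\<^sub>R a k)) /\<^sub>R r ^ (2*m)"
      using eventually_pos
    proof eventually_elim
      case (elim r)
      have "r ^ Suc (2*k - 2*m - 1) = inverse (r ^ (2*m)) * r ^ (2*k)" if "k \<in> {m<..K}" for k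
      proof -
        have "Suc (2*k - 2*m - 1) = 2*k - 2*m" using that by auto
        then show ?thesis using power_quotient[of r "2*m" "2*k"] elim that by simp
      qed
      then show ?case unfolding split by (simp add: scaleR_sum_right)
    qed
  qed
qed

lemma expands_remainder:
  assumes "expands m F a" "((\<lambda>r. G r /\<^sub>R r ^ (2*m)) \<longlongrightarrow> 0) (at_right 0)"
  shows "expands m (\<lambda>r. F r + G r) a"
  using tendsto_add[OF assms[unfolded expands_def]] unfolding expands_def
  by (simp add: algebra_simps)

lemma expands_add:
  assumes "expands m F a" "expands m G b"
  shows "expands m (\<lambda>r. F r + G r) (\<lambda>k. a k + b k)"
  using tendsto_add[OF assms[unfolded expands_def]] unfolding expands_def
  by (simp add: algebra_simps sum.distrib)

lemma expands_linear:
  assumes "bounded_linear L" "expands m F a"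
  shows "expands m (\<lambda>r. L (F r)) (\<lambda>k. L (a k))"
proof -
  interpret L: bounded_linear L by fact
  show ?thesis
    using L.tendsto[OF assms(2)[unfolded expands_def]] unfolding expands_def
    by (simp add: L.diff L.scaleR L.sum L.zero)
qed

lemma expands_minus: "expands m F a \<Longrightarrow> expands m (\<lambda>r. - F r) (\<lambda>k. - a k)"
  by (rule expands_linear[OF bounded_linear_minus[OF bounded_linear_ident]])

lemma expands_diff:
  assumes "expands m F a" "expands m G b"
  shows "expands m (\<lambda>r. F r - G r) (\<lambda>k. a k - b k)"
  using expands_add[OF assms(1) expands_minus[OF assms(2)]] by simp

lemma expands_const: "expands m (\<lambda>r. c) (\<lambda>k. if k = 0 then c else 0)"
proof -
  have "(\<Sum>k\<le>m. r ^ (2*k) *\<^sub>R (if k = 0 then c else 0)) = c" for r :: real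
    by (subst sum.remove[of _ 0]) auto
  then show ?thesis by (simp add: expands_def)
qed

lemma expands_zero: "expands m (\<lambda>r. 0) (\<lambda>k. 0)"
  by (simp add: expands_def)

lemma expands_sum:
  assumes "\<And>j. j \<in> I \<Longrightarrow> expands m (F j) (a j)"
  shows "expands m (\<lambda>r. \<Sum>j\<in>I. F j r) (\<lambda>k. \<Sum>j\<in>I. a j k)"
proof (cases "finite I")
  case True
  then show ?thesis using assms
    by (induction I rule: finite_induct) (auto intro!: expands_add expands_zero)
qed (simp add: expands_zero)

lemma expands_monom: "expands m (\<lambda>r. r ^ (2*j)) (\<lambda>k. if k = j then 1 else (0::real))"
proof -
  have "(\<Sum>k\<le>max m j. r ^ (2*k) *\<^sub>R (if k = j then 1 else (0::real))) = r ^ (2*j)" for r :: real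
    by (subst sum.remove[of _ j]) auto
  then show ?thesis using expands_finite_sum[of m "max m j" "\<lambda>k. if k = j then 1 else (0::real)"] by simp
qed

lemma expands_limit:
  assumes "expands m F a"
  shows "(F \<longlongrightarrow> a 0) (at_right 0)"
proof -
  have "((\<lambda>r. r ^ (2*m) *\<^sub>R ((F r - (\<Sum>k\<le>m. r ^ (2*k) *\<^sub>R a k)) /\<^sub>R r ^ (2*m))
        + (\<Sum>k\<le>m. r ^ (2*k) *\<^sub>R a k)) \<longlongrightarrow> 0 ^ (2*m) *\<^sub>R 0 + (\<Sum>k\<le>m. 0 ^ (2*k) *\<^sub>R a k)) (at_right 0)"
    using assms unfolding expands_def by (intro tendsto_intros) auto
  moreover have "(\<Sum>k\<le>m. (0::real) ^ (2*k) *\<^sub>R a k) = a 0"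
    by (subst sum.remove[of _ 0]) (auto intro!: sum.neutral)
  ultimately have *: "((\<lambda>r. r ^ (2*m) *\<^sub>R ((F r - (\<Sum>k\<le>m. r ^ (2*k) *\<^sub>R a k)) /\<^sub>R r ^ (2*m))
        + (\<Sum>k\<le>m. r ^ (2*k) *\<^sub>R a k)) \<longlongrightarrow> a 0) (at_right 0)" by simp
  show ?thesis
    by (rule Lim_transform_eventually[OF *]) (use eventually_pos in \<open>eventually_elim, simp\<close>)
qed

lemma expands_le:
  assumes "expands m F a" "k \<le> m"
  shows "expands k F a"
proof -
  have "((\<lambda>r. r ^ (2*m - 2*k) *\<^sub>R ((F r - (\<Sum>k\<le>m. r ^ (2*k) *\<^sub>R a k)) /\<^sub>R r ^ (2*m))) \<longlongrightarrow> 0 ^ (2*m - 2*k) *\<^sub>R 0) (at_right 0)"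
    using assms unfolding expands_def by (intro tendsto_intros) auto
  then have "((\<lambda>r. r ^ (2*m - 2*k) *\<^sub>R ((F r - (\<Sum>k\<le>m. r ^ (2*k) *\<^sub>R a k)) /\<^sub>R r ^ (2*m))) \<longlongrightarrow> 0) (at_right 0)" by simp
  then have "((\<lambda>r. (F r - (\<Sum>k\<le>m. r ^ (2*k) *\<^sub>R a k)) /\<^sub>R r ^ (2*k)) \<longlongrightarrow> 0) (at_right 0)"
  proof (rule Lim_transform_eventually)
    show "\<forall>\<^sub>F r in at_right 0. r ^ (2*m - 2*k) *\<^sub>R ((F r - (\<Sum>k\<le>m. r ^ (2*k) *\<^sub>R a k)) /\<^sub>R r ^ (2*m)) =
       (F r - (\<Sum>k\<le>m. r ^ (2*k) *\<^sub>R a k)) /\<^sub>R r ^ (2*k)"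
      using eventually_pos
    proof eventually_elim
      case (elim r)
      have "r ^ (2*m - 2*k) * inverse (r ^ (2*m)) = inverse (r ^ (2*k))"
        using elim assms(2) by (simp add: power_diff field_simps)
      then show ?case by simp
    qed
  qed
  from expands_remainder[OF expands_finite_sum[OF assms(2), of a] this] show ?thesis by simp
qed

lemma expands_unique:
  assumes "expands m F a" "expands m F b" "k \<le> m"
  shows "a k = b k"
  using assms
proof (induction m arbitrary: k)
  case 0
  then show ?case using tendsto_unique[OF _ expands_limit expands_limit] by (auto simp: trivial_limit_at_right_real)
next
  case (Suc m)
  have eq: "a k = b k" if "k \<le> m" for k
    using Suc.IH[OF expands_le[OF Suc.prems(1)] expands_le[OF Suc.prems(2)] that] by simp
  have "((\<lambda>r. (\<Sum>k\<le>Suc m. r ^ (2*k) *\<^sub>R (a k - b k)) /\<^sub>R r ^ (2*Suc m)) \<longlongrightarrow> 0) (at_right 0)"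
    using tendsto_minus[OF expands_diff[OF Suc.prems(1,2), unfolded expands_def]]
    by (simp del: sum.atMost_Suc)
  moreover have "\<forall>\<^sub>F r in at_right 0. (\<Sum>k\<le>Suc m. r ^ (2*k) *\<^sub>R (a k - b k)) /\<^sub>R r ^ (2*Suc m) = a (Suc m) - b (Suc m)"
    using eventually_pos
  proof eventually_elim
    case (elim r)
    have "(\<Sum>k\<le>Suc m. r ^ (2*k) *\<^sub>R (a k - b k)) = r ^ (2*Suc m) *\<^sub>R (a (Suc m) - b (Suc m))"
      using eq by simp
    moreover have "inverse (r ^ (2*Suc m)) * r ^ (2*Suc m) = 1" using elim by (intro left_inverse) simp
    ultimately show ?case by (simp only: scaleR_scaleR scaleR_one)
  qed
  ultimately have *: "((\<lambda>r::real. a (Suc m) - b (Suc m)) \<longlongrightarrow> 0) (at_right 0)"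
    by (rule Lim_transform_eventually)
  have "a (Suc m) - b (Suc m) = 0"
    by (rule tendsto_unique[OF _ tendsto_const *]) simp
  then show ?case using eq Suc.prems(3) by (cases "k = Suc m") auto
qed

lemma expands_bilinear:
  assumes "bounded_bilinear bp" "expands m F a" "expands m G b"
  shows "expands m (\<lambda>r. bp (F r) (G r)) (\<lambda>k. \<Sum>i\<le>k. bp (a i) (b (k - i)))"
proof -
  interpret bp: bounded_bilinear bp by fact
  define f where "f r = (\<Sum>k\<le>m. r ^ (2*k) *\<^sub>R a k)" for r :: real
  define g where "g r = (\<Sum>k\<le>m. r ^ (2*k) *\<^sub>R b k)" for r :: real
  have f0: "(f \<longlongrightarrow> a 0) (at_right 0)" unfolding f_def by (rule expands_limit[OF expands_partial_sum])
  have G0: "(G \<longlongrightarrow> b 0) (at_right 0)" by (rule expands_limit[OF assms(3)])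
  have "((\<lambda>r. bp ((F r - f r) /\<^sub>R r ^ (2*m)) (G r)) \<longlongrightarrow> bp 0 (b 0)) (at_right 0)"
    using assms(2) G0 unfolding expands_def f_def[symmetric] by (rule bp.tendsto)
  moreover have "((\<lambda>r. bp (f r) ((G r - g r) /\<^sub>R r ^ (2*m))) \<longlongrightarrow> bp (a 0) 0) (at_right 0)"
    using f0 assms(3) unfolding expands_def g_def[symmetric] by (rule bp.tendsto)
  ultimately have "((\<lambda>r. bp ((F r - f r) /\<^sub>R r ^ (2*m)) (G r) + bp (f r) ((G r - g r) /\<^sub>R r ^ (2*m)))
      \<longlongrightarrow> bp 0 (b 0) + bp (a 0) 0) (at_right 0)"
    by (rule tendsto_add)
  then have 1: "((\<lambda>r. (bp (F r) (G r) - bp (f r) (g r)) /\<^sub>R r ^ (2*m)) \<longlongrightarrow> 0) (at_right 0)"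
    by (simp add: bp.scaleR_left bp.scaleR_right bp.diff_left bp.diff_right bp.zero_left bp.zero_right
        scaleR_right_distrib[symmetric])
  let ?D = "{(i,j). i + j \<le> m}" and ?Q = "{..m} \<times> {..m}"
  have fg: "bp (f r) (g r) = (\<Sum>(i,j)\<in>?Q. r ^ (2*(i+j)) *\<^sub>R bp (a i) (b j))" for r
    unfolding f_def g_def sum.cartesian_product[symmetric]
    by (subst bp.sum_left, intro sum.cong refl, subst bp.sum_right)
       (simp add: bp.scaleR_left bp.scaleR_right power_add distrib_left mult.commute)
  have conv: "(\<Sum>k\<le>m. r ^ (2*k) *\<^sub>R (\<Sum>i\<le>k. bp (a i) (b (k - i)))) = (\<Sum>(i,j)\<in>?D. r ^ (2*(i+j)) *\<^sub>R bp (a i) (b j))" for r :: real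
    unfolding sum.triangle_reindex_eq by (simp add: scaleR_sum_right)
  have "finite ?Q" "?D \<subseteq> ?Q" by auto
  then have diff: "bp (f r) (g r) - (\<Sum>k\<le>m. r ^ (2*k) *\<^sub>R (\<Sum>i\<le>k. bp (a i) (b (k - i))))
      = (\<Sum>(i,j)\<in>?Q - ?D. r ^ (2*(i+j)) *\<^sub>R bp (a i) (b j))" for r
    unfolding fg conv by (simp add: sum_diff)
  have "((\<lambda>r. \<Sum>(i,j)\<in>?Q - ?D. r ^ Suc (2*(i+j) - 2*m - 1) *\<^sub>R bp (a i) (b j)) \<longlongrightarrow> (\<Sum>(i,j)\<in>?Q - ?D. 0 *\<^sub>R bp (a i) (b j))) (at_right 0)"
    unfolding split_def by (intro tendsto_sum tendsto_scaleR tendsto_power_zero tendsto_const)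
  then have "((\<lambda>r. \<Sum>(i,j)\<in>?Q - ?D. r ^ Suc (2*(i+j) - 2*m - 1) *\<^sub>R bp (a i) (b j)) \<longlongrightarrow> 0) (at_right 0)"
    by (simp add: split_def)
  then have 2: "((\<lambda>r. (bp (f r) (g r) - (\<Sum>k\<le>m. r ^ (2*k) *\<^sub>R (\<Sum>i\<le>k. bp (a i) (b (k - i))))) /\<^sub>R r ^ (2*m)) \<longlongrightarrow> 0) (at_right 0)"
  proof (rule Lim_transform_eventually)
    show "\<forall>\<^sub>F r in at_right 0. (\<Sum>(i,j)\<in>?Q - ?D. r ^ Suc (2*(i+j) - 2*m - 1) *\<^sub>R bp (a i) (b j)) =
      (bp (f r) (g r) - (\<Sum>k\<le>m. r ^ (2*k) *\<^sub>R (\<Sum>i\<le>k. bp (a i) (b (k - i))))) /\<^sub>R r ^ (2*m)"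
      using eventually_pos
    proof eventually_elim
      case (elim r)
      have "r ^ Suc (2*(i+j) - 2*m - 1) = inverse (r ^ (2*m)) * r ^ (2*(i+j))" if "(i,j) \<in> ?Q - ?D" for i j
      proof -
        have "Suc (2*(i+j) - 2*m - 1) = 2*(i+j) - 2*m" using that by auto
        then show ?thesis using power_quotient[of r "2*m" "2*(i+j)"] elim that by auto
      qed
      then show ?case by (subst diff, subst scaleR_sum_right, intro sum.cong) auto
    qed
  qed
  show ?thesis using tendsto_add[OF 1 2] by (simp add: expands_def scaleR_right_distrib[symmetric])
qed

text \<open>The truncated formal quotient solves the same equation up to \<open>o(r\<^sup>2\<^sup>m)\<close>, and the lower bound for the factor
  \<open>H r\<close> transfers this error to the quotient.\<close>

lemma expands_divide:
  assumes "bounded_bilinear bp" "expands m H h" "expands m (\<lambda>r. bp (H r) (W r)) b"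
    and "\<And>k. k \<le> m \<Longrightarrow> (\<Sum>i\<le>k. bp (h i) (w (k - i))) = b k"
    and coercive: "\<forall>\<^sub>F r in at_right 0. \<forall>X. norm X \<le> C * norm (bp (H r) X)"
  shows "expands m W w"
proof -
  interpret bp: bounded_bilinear bp by fact
  define w' where "w' r = (\<Sum>k\<le>m. r ^ (2*k) *\<^sub>R w k)" for r :: real
  have "expands m (\<lambda>r. bp (H r) (w' r)) (\<lambda>k. \<Sum>i\<le>k. bp (h i) (w (k - i)))"
    unfolding w'_def by (rule expands_bilinear[OF assms(1,2) expands_partial_sum])
  then have "expands m (\<lambda>r. bp (H r) (w' r)) b"
    by (rule expands_cong[THEN iffD1, rotated 2]) (auto simp: assms(4))
  from expands_diff[OF assms(3) this]
  have "expands m (\<lambda>r. bp (H r) (W r - w' r)) (\<lambda>k. 0)" by (simp add: bp.diff_right)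
  then have "((\<lambda>r. bp (H r) ((W r - w' r) /\<^sub>R r ^ (2*m))) \<longlongrightarrow> 0) (at_right 0)"
    by (simp add: expands_def bp.scaleR_right)
  then have "((\<lambda>r. C * norm (bp (H r) ((W r - w' r) /\<^sub>R r ^ (2*m)))) \<longlongrightarrow> C * 0) (at_right 0)"
    by (intro tendsto_mult tendsto_const) (rule tendsto_norm_zero)
  then have "((\<lambda>r. C * norm (bp (H r) ((W r - w' r) /\<^sub>R r ^ (2*m)))) \<longlongrightarrow> 0) (at_right 0)" by simp
  then show ?thesis
    unfolding expands_def w'_def[symmetric]
    by (rule Lim_null_comparison[rotated]) (use coercive in \<open>eventually_elim, blast\<close>)
qed

text \<open>An expansion of \<open>Y\<close> does not determine one of \<open>Y'\<close>, but the converse holds by the mean value theorem, as \<open>Y\<close> tends to \<open>0\<close>. If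
  both are known to have expansions, uniqueness therefore relates the coefficients.\<close>

lemma expands_ode:
  fixes Y :: "real \<Rightarrow> 'b::real_normed_vector"
  assumes e: "e \<ge> 1"
    and der: "\<forall>\<^sub>F r in at_right 0. (Y has_vector_derivative Y' r) (at r)"
    and Y: "expands m (\<lambda>r. r powr (- e) *\<^sub>R Y r) \<gamma>"
    and Y': "expands m (\<lambda>r. r powr (1 - e) *\<^sub>R Y' r) \<beta>"
    and k: "k \<le> m"
  shows "\<beta> k = (e + 2 * real k) *\<^sub>R \<gamma> k"
proof -
  define c where "c k = \<beta> k /\<^sub>R (e + 2 * real k)" for k
  define G where "G r = Y r - (\<Sum>k\<le>m. r powr (e + 2 * real k) *\<^sub>R c k)" for r
  define G' where "G' r = Y' r - (\<Sum>k\<le>m. r powr (e + 2 * real k - 1) *\<^sub>R \<beta> k)" for r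
  have derG: "\<forall>\<^sub>F r in at_right 0. (G has_vector_derivative G' r) (at r)"
    using der eventually_pos
  proof eventually_elim
    case (elim r)
    have "((\<lambda>r. r powr (e + 2 * real k) *\<^sub>R c k) has_vector_derivative r powr (e + 2 * real k - 1) *\<^sub>R \<beta> k) (at r)" for k
    proof -
      have "((\<lambda>r. r powr (e + 2 * real k)) has_real_derivative (e + 2 * real k) * r powr (e + 2 * real k - 1)) (at r)"
        using has_real_derivative_powr[OF elim(2)] .
      from has_vector_derivative_scaleR[OF this has_vector_derivative_const, of "c k"]
      have "((\<lambda>r. r powr (e + 2 * real k) *\<^sub>R c k) has_vector_derivative
          ((e + 2 * real k) * r powr (e + 2 * real k - 1)) *\<^sub>R c k) (at r)" by simp
      moreover have "e + 2 * real k \<noteq> 0" using e of_nat_0_le_iff[of k, where 'a=real] by linarith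
      then have "((e + 2 * real k) * r powr (e + 2 * real k - 1)) *\<^sub>R c k = r powr (e + 2 * real k - 1) *\<^sub>R \<beta> k"
        by (simp add: c_def)
      ultimately show ?thesis by simp
    qed
    then show ?case unfolding G_def G'_def
      by (intro has_vector_derivative_diff elim(1) has_vector_derivative_sum)
  qed
  have pw: "r powr (1 - e) *\<^sub>R G' r = r powr (1 - e) *\<^sub>R Y' r - (\<Sum>k\<le>m. r ^ (2*k) *\<^sub>R \<beta> k)"
    "r powr (- e) *\<^sub>R G r = r powr (- e) *\<^sub>R Y r - (\<Sum>k\<le>m. r ^ (2*k) *\<^sub>R c k)" if "r > 0" for r
    using that powr_realpow[OF that, symmetric]
    by (simp_all add: G'_def G_def scaleR_diff_right scaleR_sum_right powr_add[symmetric])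
  have small: "\<forall>\<^sub>F r in at_right 0. norm (G' r) \<le> \<delta> * (r powr (e - 1) * r ^ (2*m))" if "\<delta> > 0" for \<delta>
  proof -
    have "\<forall>\<^sub>F r in at_right 0. dist ((r powr (1 - e) *\<^sub>R Y' r - (\<Sum>k\<le>m. r ^ (2*k) *\<^sub>R \<beta> k)) /\<^sub>R r ^ (2*m)) 0 < \<delta>"
      using Y' that unfolding expands_def by (rule tendstoD)
    then show ?thesis using eventually_pos
    proof eventually_elim
      case (elim r)
      have "norm ((r powr (1 - e) *\<^sub>R G' r) /\<^sub>R r ^ (2*m)) < \<delta>"
        using elim by (simp add: pw(1))
      then have "norm (G' r) * (r powr (1 - e) / r ^ (2*m)) < \<delta>"
        using elim(2) by (simp add: divide_inverse mult_ac)
      moreover have "r powr (1 - e) = inverse (r powr (e - 1))" using powr_minus[of r "e - 1"] by simp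
      ultimately show ?case using elim(2) by (simp add: field_simps)
    qed
  qed
  have G0: "(G \<longlongrightarrow> 0) (at_right 0)"
  proof -
    have p0: "((\<lambda>r::real. r powr a) \<longlongrightarrow> 0) (at_right 0)" if "a > 0" for a
    proof -
      have "((\<lambda>r::real. r powr a) \<longlongrightarrow> 0 powr a) (at_right 0)"
        by (rule tendsto_powr2) (use that in \<open>auto intro!: tendsto_intros eventually_mono[OF eventually_pos]\<close>)
      then show ?thesis by simp
    qed
    have "((\<lambda>r. r powr e *\<^sub>R (r powr (- e) *\<^sub>R Y r)) \<longlongrightarrow> 0 *\<^sub>R \<gamma> 0) (at_right 0)"
      using e by (intro tendsto_scaleR p0 expands_limit[OF Y]) auto
    then have "((\<lambda>r. r powr e *\<^sub>R (r powr (- e) *\<^sub>R Y r)) \<longlongrightarrow> 0) (at_right 0)" by simp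
    then have "(Y \<longlongrightarrow> 0) (at_right 0)"
      by (rule Lim_transform_eventually)
         (use eventually_pos in \<open>eventually_elim, simp add: powr_add[symmetric]\<close>)
    moreover have "((\<lambda>r. \<Sum>k\<le>m. r powr (e + 2 * real k) *\<^sub>R c k) \<longlongrightarrow> (\<Sum>k\<le>m. 0 *\<^sub>R c k)) (at_right 0)"
      using e by (intro tendsto_sum tendsto_scaleR p0 tendsto_const) auto
    ultimately show ?thesis unfolding G_def using tendsto_diff by fastforce
  qed
  have smallG: "\<forall>\<^sub>F r in at_right 0. norm (G r) \<le> \<delta> * (r powr e * r ^ (2*m))" if \<delta>: "\<delta> > 0" for \<delta>
  proof -
    obtain \<eta> where \<eta>: "\<eta> > 0" and b: "\<And>r. 0 < r \<Longrightarrow> r < \<eta> \<Longrightarrow> (G has_vector_derivative G' r) (at r)"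
      "\<And>r. 0 < r \<Longrightarrow> r < \<eta> \<Longrightarrow> norm (G' r) \<le> \<delta> * (r powr (e - 1) * r ^ (2*m))"
      using eventually_conj[OF derG small[OF \<delta>]] unfolding eventually_at_right_field by auto
    \<comment> \<open>The bound for \<open>G'\<close> is used on \<open>[\<rho>, r]\<close>, and then \<open>\<rho>\<close> tends to \<open>0\<close>. As \<open>e \<ge> 1\<close>, the bound at \<open>r\<close> is the largest.\<close>
    have main: "norm (G r) \<le> \<delta> * (r powr e * r ^ (2*m))" if r: "0 < r" "r < \<eta>" for r
    proof -
      define B where "B = \<delta> * (r powr (e - 1) * r ^ (2*m))"
      have B0: "B \<ge> 0" using \<delta> by (simp add: B_def)
      have "norm (G r - G \<rho>) \<le> B * r" if "0 < \<rho>" "\<rho> < r" for \<rho>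
      proof -
        have "norm (G r - G \<rho>) \<le> B * norm (r - \<rho>)"
        proof (rule differentiable_bound[where S="{\<rho>..r}" and f'="\<lambda>t h. h *\<^sub>R G' t"])
          show "(G has_derivative (\<lambda>h. h *\<^sub>R G' t)) (at t within {\<rho>..r})" if "t \<in> {\<rho>..r}" for t
            using b(1)[of t] that \<open>0 < \<rho>\<close> r by (simp add: has_vector_derivative_def has_derivative_at_withinI)
          show "onorm (\<lambda>h. h *\<^sub>R G' t) \<le> B" if "t \<in> {\<rho>..r}" for t
          proof -
            have "norm (G' t) \<le> \<delta> * (t powr (e - 1) * t ^ (2*m))" using b(2)[of t] that \<open>0 < \<rho>\<close> r by auto
            also have "\<dots> \<le> B" unfolding B_def
              using that \<open>0 < \<rho>\<close> e \<delta> by (intro mult_left_mono mult_mono powr_mono2 power_mono) auto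
            finally show ?thesis
              by (intro onorm_le) (simp add: mult.commute[of B] mult_left_mono)
          qed
        qed (use that in auto)
        also have "\<dots> \<le> B * r" using that B0 by (intro mult_left_mono) auto
        finally show ?thesis .
      qed
      then have "\<forall>\<^sub>F \<rho> in at_right 0. norm (G r - G \<rho>) \<le> B * r"
        using r by (auto simp: eventually_at_right_field)
      moreover have "((\<lambda>\<rho>. norm (G r - G \<rho>)) \<longlongrightarrow> norm (G r - 0)) (at_right 0)"
        by (intro tendsto_norm tendsto_diff tendsto_const G0)
      ultimately have "norm (G r - 0) \<le> B * r"
        by (intro tendsto_upperbound) auto
      also have "B * r = \<delta> * (r powr e * r ^ (2*m))"
        using r powr_add[of r "e - 1" 1] by (simp add: B_def)
      finally show ?thesis by simp
    qed
    then show ?thesis using \<eta> unfolding eventually_at_right_field by blast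
  qed
  have "expands m (\<lambda>r. r powr (- e) *\<^sub>R Y r) c"
    unfolding expands_def
  proof (rule tendstoI)
    fix \<delta> :: real assume "\<delta> > 0"
    then have "\<forall>\<^sub>F r in at_right 0. norm (G r) \<le> \<delta> / 2 * (r powr e * r ^ (2*m))" by (intro smallG) simp
    then show "\<forall>\<^sub>F r in at_right 0. dist ((r powr (- e) *\<^sub>R Y r - (\<Sum>k\<le>m. r ^ (2*k) *\<^sub>R c k)) /\<^sub>R r ^ (2*m)) 0 < \<delta>"
      using eventually_pos
    proof eventually_elim
      case (elim r)
      have "norm ((r powr (- e) *\<^sub>R G r) /\<^sub>R r ^ (2*m)) \<le> \<delta> / 2"
        using elim by (simp add: powr_minus field_simps)
      also have "\<dots> < \<delta>" using \<open>\<delta> > 0\<close> by simp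
      finally show ?case using elim(2) by (simp add: pw(2))
    qed
  qed
  from expands_unique[OF this Y k] have "c k = \<gamma> k" .
  moreover have "e + 2 * real k \<noteq> 0" using e of_nat_0_le_iff[of k, where 'a=real] by linarith
  ultimately show ?thesis by (simp flip: \<open>c k = \<gamma> k\<close> add: c_def)
qed

section \<open>Expansions that may be differentiated along the manifold\<close>

text \<open>A family whose expansion at \<open>x\<close> may be differentiated once along the manifold.\<close>

definition jet_expands :: "nat \<Rightarrow> (real \<Rightarrow> real^'m::finite \<Rightarrow> 'b::real_normed_vector) \<Rightarrow>
    (nat \<Rightarrow> real^'m \<Rightarrow> 'b) \<Rightarrow> real^'m \<Rightarrow> bool" where
  "jet_expands m F a x \<longleftrightarrow>
     expands m (\<lambda>r. F r x) (\<lambda>k. a k x) \<and>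
     (\<forall>i. expands m (\<lambda>r. pd i (F r) x) (\<lambda>k. pd i (a k) x)) \<and>
     (\<forall>\<^sub>F r in at_right 0. F r differentiable (at x)) \<and> (\<forall>k\<le>m. a k differentiable (at x))"

lemma jet_expands_add:
  assumes "jet_expands m F a x" "jet_expands m G b x"
  shows "jet_expands m (\<lambda>r x. F r x + G r x) (\<lambda>k x. a k x + b k x) x"
  unfolding jet_expands_def
proof (intro conjI allI impI)
  show "expands m (\<lambda>r. F r x + G r x) (\<lambda>k. a k x + b k x)"
    using assms by (auto simp: jet_expands_def intro: expands_add)
  have FG: "\<forall>\<^sub>F r in at_right 0. F r differentiable (at x) \<and> G r differentiable (at x)"
    using assms by (auto simp: jet_expands_def intro: eventually_conj)
  then show "\<forall>\<^sub>F r in at_right 0. (\<lambda>x. F r x + G r x) differentiable (at x)"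
    by eventually_elim auto
  show "(\<lambda>x. a k x + b k x) differentiable (at x)" if "k \<le> m" for k
    using assms that by (auto simp: jet_expands_def)
  show "expands m (\<lambda>r. pd i (\<lambda>x. F r x + G r x) x) (\<lambda>k. pd i (\<lambda>x. a k x + b k x) x)" for i
  proof (rule expands_cong[THEN iffD2])
    show "expands m (\<lambda>r. pd i (F r) x + pd i (G r) x) (\<lambda>k. pd i (a k) x + pd i (b k) x)"
      using assms by (auto simp: jet_expands_def intro: expands_add)
    show "\<forall>\<^sub>F r in at_right 0. pd i (\<lambda>x. F r x + G r x) x = pd i (F r) x + pd i (G r) x"
      using FG by eventually_elim (auto intro: pd_add)
    show "pd i (\<lambda>x. a k x + b k x) x = pd i (a k) x + pd i (b k) x" if "k \<le> m" for k
      using assms that by (auto simp: jet_expands_def intro: pd_add)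
  qed
qed

lemma jet_expands_linear:
  assumes "bounded_linear L" "jet_expands m F a x"
  shows "jet_expands m (\<lambda>r x. L (F r x)) (\<lambda>k x. L (a k x)) x"
  unfolding jet_expands_def
proof (intro conjI allI impI)
  show "expands m (\<lambda>r. L (F r x)) (\<lambda>k. L (a k x))"
    using assms by (auto simp: jet_expands_def intro: expands_linear)
  have F: "\<forall>\<^sub>F r in at_right 0. F r differentiable (at x)"
    using assms by (auto simp: jet_expands_def)
  then show "\<forall>\<^sub>F r in at_right 0. (\<lambda>x. L (F r x)) differentiable (at x)"
    by eventually_elim (rule differentiable_linear[OF assms(1)])
  show "(\<lambda>x. L (a k x)) differentiable (at x)" if "k \<le> m" for k
    using assms that by (auto simp: jet_expands_def intro: differentiable_linear)
  show "expands m (\<lambda>r. pd i (\<lambda>x. L (F r x)) x) (\<lambda>k. pd i (\<lambda>x. L (a k x)) x)" for i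
  proof (rule expands_cong[THEN iffD2])
    show "expands m (\<lambda>r. L (pd i (F r) x)) (\<lambda>k. L (pd i (a k) x))"
      using assms by (auto simp: jet_expands_def intro: expands_linear)
    show "\<forall>\<^sub>F r in at_right 0. pd i (\<lambda>x. L (F r x)) x = L (pd i (F r) x)"
      using F by eventually_elim (rule pd_linear[OF assms(1)])
    show "pd i (\<lambda>x. L (a k x)) x = L (pd i (a k) x)" if "k \<le> m" for k
      using assms that by (auto simp: jet_expands_def intro: pd_linear)
  qed
qed

lemma jet_expands_bilinear:
  assumes "bounded_bilinear bp" "jet_expands m F a x" "jet_expands m G b x"
  shows "jet_expands m (\<lambda>r x. bp (F r x) (G r x)) (\<lambda>k x. \<Sum>i\<le>k. bp (a i x) (b (k - i) x)) x"
  unfolding jet_expands_def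
proof (intro conjI allI impI)
  show "expands m (\<lambda>r. bp (F r x) (G r x)) (\<lambda>k. \<Sum>i\<le>k. bp (a i x) (b (k - i) x))"
    using assms by (auto simp: jet_expands_def intro: expands_bilinear)
  have FG: "\<forall>\<^sub>F r in at_right 0. F r differentiable (at x) \<and> G r differentiable (at x)"
    using assms by (auto simp: jet_expands_def intro: eventually_conj)
  then show "\<forall>\<^sub>F r in at_right 0. (\<lambda>x. bp (F r x) (G r x)) differentiable (at x)"
    by eventually_elim (auto intro: differentiable_bilinear[OF assms(1)])
  have ab: "(\<lambda>x. bp (a i x) (b j x)) differentiable (at x)" if "i \<le> m" "j \<le> m" for i j
    using assms that by (auto simp: jet_expands_def intro: differentiable_bilinear)
  then show "(\<lambda>x. \<Sum>i\<le>k. bp (a i x) (b (k - i) x)) differentiable (at x)" if "k \<le> m" for k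
    using that by (intro differentiable_sum) auto
  show "expands m (\<lambda>r. pd l (\<lambda>x. bp (F r x) (G r x)) x) (\<lambda>k. pd l (\<lambda>x. \<Sum>i\<le>k. bp (a i x) (b (k - i) x)) x)" for l
  proof (rule expands_cong[THEN iffD2])
    show "expands m (\<lambda>r. bp (F r x) (pd l (G r) x) + bp (pd l (F r) x) (G r x))
       (\<lambda>k. (\<Sum>i\<le>k. bp (a i x) (pd l (b (k - i)) x)) + (\<Sum>i\<le>k. bp (pd l (a i) x) (b (k - i) x)))"
      using assms unfolding jet_expands_def by (intro expands_add expands_bilinear[OF assms(1)]) auto
    show "\<forall>\<^sub>F r in at_right 0. pd l (\<lambda>x. bp (F r x) (G r x)) x = bp (F r x) (pd l (G r) x) + bp (pd l (F r) x) (G r x)"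
      using FG by eventually_elim (auto intro: pd_bilinear[OF assms(1)])
    have "pd l (\<lambda>x. bp (a i x) (b j x)) x = bp (a i x) (pd l (b j) x) + bp (pd l (a i) x) (b j x)" if "i \<le> m" "j \<le> m" for i j
      using assms that by (auto simp: jet_expands_def intro: pd_bilinear)
    then show "pd l (\<lambda>x. \<Sum>i\<le>k. bp (a i x) (b (k - i) x)) x =
      (\<Sum>i\<le>k. bp (a i x) (pd l (b (k - i)) x)) + (\<Sum>i\<le>k. bp (pd l (a i) x) (b (k - i) x))" if "k \<le> m" for k
      using that by (subst pd_sum) (auto simp: ab sum.distrib)
  qed
qed

lemma jet_expands_const:
  fixes x :: "real^'m::finite"
  shows "jet_expands m (\<lambda>r x. c) (\<lambda>k x. if k = 0 then c else 0) x"
proof -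
  have "pd i (\<lambda>x::real^'m. if k = 0 then c else 0) x = 0" for i k by (cases "k = 0") auto
  moreover have "(\<lambda>x::real^'m. if k = 0 then c else 0) differentiable (at x)" for k by (cases "k = 0") auto
  ultimately show ?thesis unfolding jet_expands_def using expands_const expands_zero by auto
qed

text \<open>The coefficients of the determinant depend only on those of the matrix, not on the function
  that is being expanded.\<close>

lemma jet_expands_prod:
  fixes a :: "'i \<Rightarrow> nat \<Rightarrow> real^'m::finite \<Rightarrow> real"
  assumes "finite I"
  shows "\<exists>d. \<forall>F x. (\<forall>i\<in>I. jet_expands m (F i) (a i) x) \<longrightarrow> jet_expands m (\<lambda>r x. \<Prod>i\<in>I. F i r x) d x"
  using assms
proof (induction I rule: finite_induct)
  case empty
  show ?case using jet_expands_const[of m "1::real"] by fastforce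
next
  case (insert j I)
  then obtain d where "\<forall>F x. (\<forall>i\<in>I. jet_expands m (F i) (a i) x) \<longrightarrow> jet_expands m (\<lambda>r x. \<Prod>i\<in>I. F i r x) d x"
    by blast
  then show ?case using insert.hyps
    by (intro exI[of _ "\<lambda>k x. \<Sum>i\<le>k. a j i x * d (k - i) x"])
       (auto intro!: jet_expands_bilinear[OF bounded_bilinear_mult])
qed

lemma jet_expands_sum:
  assumes "\<And>j. j \<in> I \<Longrightarrow> jet_expands m (F j) (a j) x"
  shows "jet_expands m (\<lambda>r x. \<Sum>j\<in>I. F j r x) (\<lambda>k x. \<Sum>j\<in>I. a j k x) x"
proof (cases "finite I")
  case True
  then show ?thesis using assms
    by (induction I rule: finite_induct)
       (auto intro!: jet_expands_add jet_expands_const[of m 0, simplified])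
qed (use jet_expands_const[of m 0] in simp)

lemma jet_expands_det:
  fixes h :: "nat \<Rightarrow> real^'m::finite \<Rightarrow> real^'n^'n"
  shows "\<exists>d. \<forall>H x. jet_expands m H h x \<longrightarrow> jet_expands m (\<lambda>r x. det (H r x)) d x"
proof -
  have "\<exists>d. \<forall>F x. (\<forall>i\<in>UNIV. jet_expands m (F i) (\<lambda>k x. h k x $ i $ p i) x) \<longrightarrow>
      jet_expands m (\<lambda>r x. \<Prod>i\<in>UNIV. F i r x) d x" for p :: "'n \<Rightarrow> 'n"
    by (rule jet_expands_prod) simp
  then obtain d where d: "\<And>p F x. (\<And>i. jet_expands m (F i) (\<lambda>k x. h k x $ i $ p i) x) \<Longrightarrow>
      jet_expands m (\<lambda>r x. \<Prod>i\<in>UNIV. F i r x) (d p) x" by metis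
  show ?thesis
  proof (intro exI allI impI)
    fix H x assume H: "jet_expands m H h x"
    have e: "jet_expands m (\<lambda>r x. H r x $ i $ j) (\<lambda>k x. h k x $ i $ j) x" for i j
      by (intro jet_expands_linear[OF bounded_linear_vec_nth] H)
    show "jet_expands m (\<lambda>r x. det (H r x))
        (\<lambda>k x. \<Sum>p\<in>{p. p permutes UNIV}. of_int (sign p) * d p k x) x"
      unfolding det_def
      by (intro jet_expands_sum jet_expands_linear[OF bounded_linear_mult_right] d e)
  qed
qed

section \<open>Expansion of the volume density and of the dual metric\<close>

text \<open>A perturbation smaller than half of the lower bound of \<open>bp h\<close> leaves a lower bound.\<close>

lemma coercive_near:
  assumes "bounded_bilinear bp" "(H \<longlongrightarrow> h) F" "\<And>X. norm X \<le> C * norm (bp h X)"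
  shows "\<exists>C'. \<forall>\<^sub>F r in F. \<forall>X. norm X \<le> C' * norm (bp (H r) X)"
proof -
  interpret bp: bounded_bilinear bp by fact
  obtain K where K: "K > 0" "\<And>a b. norm (bp a b) \<le> norm a * norm b * K" using bp.pos_bounded by blast
  define D where "D = max C 1"
  have D: "D > 0" "norm X \<le> D * norm (bp h X)" for X
    using assms(3)[of X] mult_right_mono[of C D "norm (bp h X)"] by (auto simp: D_def intro: order_trans)
  have "\<forall>\<^sub>F r in F. dist (H r) h < 1 / (2 * D * K)"
    using D K by (intro tendstoD[OF assms(2)]) auto
  then have "\<forall>\<^sub>F r in F. \<forall>X. norm X \<le> (2 * D) * norm (bp (H r) X)"
  proof eventually_elim
    case (elim r)
    show ?case
    proof
      fix X
      have "norm (bp (h - H r) X) \<le> norm (h - H r) * norm X * K" by (rule K)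
      also have "\<dots> \<le> (1 / (2 * D * K)) * norm X * K"
        using elim K by (intro mult_right_mono) (auto simp: dist_norm norm_minus_commute)
      also have "\<dots> = norm X / (2 * D)" using K by (simp add: field_simps)
      finally have 1: "norm (bp (h - H r) X) \<le> norm X / (2 * D)" .
      have "norm (bp h X) \<le> norm (bp (H r) X) + norm (bp (h - H r) X)"
        using norm_triangle_ineq[of "bp (H r) X" "bp (h - H r) X"] by (simp add: bp.diff_left)
      also have "\<dots> \<le> norm (bp (H r) X) + norm X / (2 * D)" using 1 by simp
      finally have "D * norm (bp h X) \<le> D * (norm (bp (H r) X) + norm X / (2 * D))"
        using D by (intro mult_left_mono) auto
      also have "\<dots> = D * norm (bp (H r) X) + norm X / 2" using D(1) by (simp add: field_simps)
      finally show "norm X \<le> (2 * D) * norm (bp (H r) X)" using D(2)[of X] by simp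
    qed
  qed
  then show ?thesis by blast
qed

text \<open>The expansion of the density is given at every point, that of its square also to first order. Comparing
  coefficients in \<open>V\<^sub>r\<^sup>2 = det h\<^sub>r\<close> on the whole of \<open>S\<close> expresses the coefficients of the determinant by those of \<open>V\<^sub>r\<close> as
  functions; differentiating this relation shows that the formal derivative of the expansion of \<open>V\<^sub>r\<close> solves the equation
  \<open>2 V\<^sub>r \<partial> V\<^sub>r = \<partial> det h\<^sub>r\<close>, and division by \<open>2 V\<^sub>r\<close> finishes the proof. The family \<open>H\<close> may depend on the point, because in
  odd dimensions the number of terms after which the expansion is accurate does.\<close>

lemma jet_expands_volume:
  fixes h :: "nat \<Rightarrow> real^'n::finite \<Rightarrow> real^'n^'n"
  assumes S: "open S" "x \<in> S"
    and V: "\<And>x. x \<in> S \<Longrightarrow> V 0 x > 0" "\<And>k. k \<le> m \<Longrightarrow> V k differentiable (at x)"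
    and ex: "\<And>x. x \<in> S \<Longrightarrow> \<exists>H. jet_expands m H h x \<and> expands m (\<lambda>r. sqrt (det (H r x))) (\<lambda>k. V k x)"
    and H: "jet_expands m H h x" "expands m (\<lambda>r. sqrt (det (H r x))) (\<lambda>k. V k x)"
  shows "\<forall>\<^sub>F r in at_right 0. det (H r x) > 0"
    and "expands m (\<lambda>r. pd i (\<lambda>x. sqrt (det (H r x))) x) (\<lambda>k. pd i (V k) x)"
    and "\<forall>\<^sub>F r in at_right 0. (\<lambda>x. sqrt (det (H r x))) differentiable (at x)"
proof -
  obtain d where d: "\<And>H x. jet_expands m H h x \<Longrightarrow> jet_expands m (\<lambda>r x. det (H r x)) d x"
    using jet_expands_det[of m h] by blast
  have pos: "\<forall>\<^sub>F r in at_right 0. det (H r x) > 0"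
    if "x \<in> S" "expands m (\<lambda>r. sqrt (det (H r x))) (\<lambda>k. V k x)" for H x
    using order_tendstoD(1)[OF expands_limit[OF that(2)] V(1)[OF that(1)]] by simp
  show pos': "\<forall>\<^sub>F r in at_right 0. det (H r x) > 0" by (rule pos) (rule S(2), rule H(2))
  have dV: "d k x = (\<Sum>i\<le>k. V i x * V (k - i) x)" if x: "x \<in> S" and k: "k \<le> m" for x k
  proof -
    obtain H where H: "jet_expands m H h x" "expands m (\<lambda>r. sqrt (det (H r x))) (\<lambda>k. V k x)"
      using ex[OF x] by blast
    have "expands m (\<lambda>r. det (H r x)) (\<lambda>k. d k x)" using d[OF H(1)] by (simp add: jet_expands_def)
    moreover have "expands m (\<lambda>r. det (H r x)) (\<lambda>k. \<Sum>i\<le>k. V i x * V (k - i) x)"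
      by (rule expands_cong[THEN iffD1, OF _ _ expands_bilinear[OF bounded_bilinear_mult H(2) H(2)]])
         (use pos[of x H, OF x H(2)] in \<open>eventually_elim, simp\<close>, simp)
    ultimately show ?thesis using expands_unique k by blast
  qed
  have D: "jet_expands m (\<lambda>r x. det (H r x)) d x" by (rule d[OF H(1)])
  have sq: "pd i (\<lambda>x. sqrt (det (H r x))) x * (2 * sqrt (det (H r x))) = pd i (\<lambda>x. det (H r x)) x"
    "(\<lambda>x. sqrt (det (H r x))) differentiable (at x)"
    if "det (H r x) > 0" and dif: "(\<lambda>x. det (H r x)) differentiable (at x)" for r i
  proof -
    obtain D' where D': "((\<lambda>x. det (H r x)) has_derivative D') (at x)"
      using dif by (auto simp: differentiable_def)
    from has_derivative_real_sqrt[OF that(1) D']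
    have *: "((\<lambda>x. sqrt (det (H r x))) has_derivative (\<lambda>v. D' v * (inverse (sqrt (det (H r x))) / 2))) (at x)" .
    show "pd i (\<lambda>x. sqrt (det (H r x))) x * (2 * sqrt (det (H r x))) = pd i (\<lambda>x. det (H r x)) x"
      using pd_at[OF *] pd_at[OF D'] that(1) by (simp add: field_simps)
    show "(\<lambda>x. sqrt (det (H r x))) differentiable (at x)" using * by (auto simp: differentiable_def)
  qed
  have dD: "\<forall>\<^sub>F r in at_right 0. (\<lambda>x. det (H r x)) differentiable (at x)"
    using D by (simp add: jet_expands_def)
  show "\<forall>\<^sub>F r in at_right 0. (\<lambda>x. sqrt (det (H r x))) differentiable (at x)"
    using pos' dD by eventually_elim (rule sq(2))
  have V2: "expands m (\<lambda>r. 2 * sqrt (det (H r x))) (\<lambda>k. 2 * V k x)"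
    by (rule expands_linear[OF bounded_linear_mult_right H(2)])
  have "\<exists>C'. \<forall>\<^sub>F r in at_right 0. \<forall>X. norm X \<le> C' * norm (2 * sqrt (det (H r x)) * X)"
    by (rule coercive_near[OF bounded_bilinear_mult expands_limit[OF V2], of "1 / (2 * V 0 x)"])
       (use V(1)[OF S(2)] in \<open>simp add: abs_mult\<close>)
  then obtain C' where C': "\<forall>\<^sub>F r in at_right 0. \<forall>X. norm X \<le> C' * norm (2 * sqrt (det (H r x)) * X)" by blast
  show "expands m (\<lambda>r. pd i (\<lambda>x. sqrt (det (H r x))) x) (\<lambda>k. pd i (V k) x)"
  proof (rule expands_divide[OF bounded_bilinear_mult V2 _ _ C'])
    show "expands m (\<lambda>r. 2 * sqrt (det (H r x)) * pd i (\<lambda>x. sqrt (det (H r x))) x) (\<lambda>k. pd i (d k) x)"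
    proof (rule expands_cong[THEN iffD1])
      show "expands m (\<lambda>r. pd i (\<lambda>x. det (H r x)) x) (\<lambda>k. pd i (d k) x)" using D by (simp add: jet_expands_def)
      show "\<forall>\<^sub>F r in at_right 0. pd i (\<lambda>x. det (H r x)) x = 2 * sqrt (det (H r x)) * pd i (\<lambda>x. sqrt (det (H r x))) x"
        using pos' dD by eventually_elim (simp add: sq(1)[symmetric])
    qed simp
    fix k assume k: "k \<le> m"
    have "pd i (d k) x = pd i (\<lambda>x. \<Sum>j\<le>k. V j x * V (k - j) x) x"
      by (rule pd_cong[OF S]) (rule dV[OF _ k])
    also have "\<dots> = (\<Sum>j\<le>k. V j x * pd i (V (k - j)) x + pd i (V j) x * V (k - j) x)"
      using k by (subst pd_sum) (auto intro!: differentiable_mult V(2) pd_bilinear[OF bounded_bilinear_mult] sum.cong)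
    also have "\<dots> = (\<Sum>j\<le>k. V j x * pd i (V (k - j)) x) + (\<Sum>j\<le>k. pd i (V (k - j)) x * V j x)"
      unfolding sum.distrib using sum.nat_diff_reindex[of "\<lambda>j. pd i (V j) x * V (k - j) x" "Suc k"]
      by (simp add: lessThan_Suc_atMost)
    also have "\<dots> = (\<Sum>j\<le>k. 2 * V j x * pd i (V (k - j)) x)"
      by (simp add: sum.distrib[symmetric] algebra_simps)
    finally show "(\<Sum>j\<le>k. 2 * V j x * pd i (V (k - j)) x) = pd i (d k) x" by simp
  qed
qed

text \<open>The coefficients of the dual metric times the volume density, from comparing coefficients in
  \<open>h\<^sub>r W\<^sub>r = V\<^sub>r\<close>.\<close>

fun dual_coeff :: "(nat \<Rightarrow> real^'n^'n) \<Rightarrow> (nat \<Rightarrow> real) \<Rightarrow> nat \<Rightarrow> real^'n::finite^'n" where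
  "dual_coeff h V k = matrix_inv (h 0) ** (V k *\<^sub>R mat 1 - (\<Sum>i<k. h (k - i) ** dual_coeff h V i))"

declare dual_coeff.simps [simp del]

lemma dual_coeff_rec:
  assumes "det (h 0) \<noteq> 0"
  shows "(\<Sum>i\<le>k. h i ** dual_coeff h V (k - i)) = V k *\<^sub>R mat 1"
proof -
  have "(\<Sum>i\<le>k. h i ** dual_coeff h V (k - i)) = (\<Sum>i\<le>k. h (k - i) ** dual_coeff h V i)"
    using sum.nat_diff_reindex[of "\<lambda>i. h i ** dual_coeff h V (k - i)" "Suc k"] by (simp add: lessThan_Suc_atMost)
  also have "\<dots> = (\<Sum>i<k. h (k - i) ** dual_coeff h V i) + h 0 ** dual_coeff h V k"
    by (simp flip: lessThan_Suc_atMost)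
  also have "h 0 ** dual_coeff h V k = V k *\<^sub>R mat 1 - (\<Sum>i<k. h (k - i) ** dual_coeff h V i)"
    by (subst dual_coeff.simps) (simp add: matrix_mul_assoc matrix_inv_right[OF assms])
  finally show ?thesis by simp
qed

lemma smooth_dual_coeff:
  fixes h :: "nat \<Rightarrow> real^'n::finite \<Rightarrow> real^'n^'n"
  assumes "open S" "\<And>x. x \<in> S \<Longrightarrow> det (h 0 x) > 0"
    and "\<And>j. j \<le> k \<Longrightarrow> smooth_on S (h j)" "\<And>j. j \<le> k \<Longrightarrow> smooth_on S (V j)"
  shows "smooth_on S (\<lambda>x. dual_coeff (\<lambda>j. h j x) (\<lambda>j. V j x) k)"
  using assms(3,4)
proof (induction k rule: less_induct)
  case (less k)
  have "smooth_on S (\<lambda>x. matrix_inv (h 0 x) ** (V k x *\<^sub>R mat 1 -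
      (\<Sum>i<k. h (k - i) x ** dual_coeff (\<lambda>j. h j x) (\<lambda>j. V j x) i)))"
    by (intro smooth_on_bilinear[OF _ bounded_bilinear_matrix_mult] smooth_on_matrix_inv smooth_on_diff
        smooth_on_scaleR smooth_on_const smooth_on_sum assms less) (use less.prems in auto)
  then show ?case by (subst dual_coeff.simps)
qed

definition dual_density :: "(real \<Rightarrow> real^'n \<Rightarrow> real^'n^'n) \<Rightarrow> real \<Rightarrow> real^'n::finite \<Rightarrow> real^'n^'n" where
  "dual_density H r x = sqrt (det (H r x)) *\<^sub>R matrix_inv (H r x)"

text \<open>Both the expansion of \<open>W\<^sub>r\<close> and that of its derivatives are found by cancelling \<open>h\<^sub>r\<close>, in \<open>h\<^sub>r W\<^sub>r = V\<^sub>r\<close>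
  and in the derivative \<open>h\<^sub>r \<partial> W\<^sub>r = \<partial> V\<^sub>r - (\<partial> h\<^sub>r) W\<^sub>r\<close> of this equation.\<close>

lemma jet_expands_dual_density:
  fixes h :: "nat \<Rightarrow> real^'n::finite \<Rightarrow> real^'n^'n"
  assumes S: "open S" "x \<in> S"
    and h0: "\<And>x. x \<in> S \<Longrightarrow> det (h 0 x) > 0"
    and sm: "\<And>k. k \<le> m \<Longrightarrow> smooth_on S (h k)" "\<And>k. k \<le> m \<Longrightarrow> smooth_on S (V k)" "\<forall>\<^sub>F r in at_right 0. smooth_on S (H r)"
    and V0: "\<And>x. x \<in> S \<Longrightarrow> V 0 x > 0"
    and ex: "\<And>x. x \<in> S \<Longrightarrow> \<exists>H. jet_expands m H h x \<and> expands m (\<lambda>r. sqrt (det (H r x))) (\<lambda>k. V k x)"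
    and H: "jet_expands m H h x" "expands m (\<lambda>r. sqrt (det (H r x))) (\<lambda>k. V k x)"
  shows "jet_expands m (dual_density H) (\<lambda>k x. dual_coeff (\<lambda>j. h j x) (\<lambda>j. V j x) k) x"
proof -
  let ?w = "\<lambda>k x. dual_coeff (\<lambda>j. h j x) (\<lambda>j. V j x) k"
  have dV: "V k differentiable (at x)" if "k \<le> m" for k by (rule smooth_on_differentiable[OF sm(2)[OF that] S(2)])
  have vol: "\<forall>\<^sub>F r in at_right 0. det (H r x) > 0"
    "\<And>i. expands m (\<lambda>r. pd i (\<lambda>x. sqrt (det (H r x))) x) (\<lambda>k. pd i (V k) x)"
    "\<forall>\<^sub>F r in at_right 0. (\<lambda>x. sqrt (det (H r x))) differentiable (at x)"
    by (rule jet_expands_volume[where h=h and S=S and V=V and m=m]; fact S V0 dV ex H)+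
  have sw: "smooth_on S (?w k)" if "k \<le> m" for k by (rule smooth_dual_coeff) (use that S h0 sm in auto)
  have dw: "?w k differentiable (at x)" if "k \<le> m" for k by (rule smooth_on_differentiable[OF sw[OF that] S(2)])
  have ev: "\<forall>\<^sub>F r in at_right 0. dual_density H r differentiable (at x) \<and>
      H r x ** dual_density H r x = sqrt (det (H r x)) *\<^sub>R mat 1 \<and> (\<forall>i.
      H r x ** pd i (dual_density H r) x = pd i (\<lambda>x. sqrt (det (H r x))) x *\<^sub>R mat 1 - pd i (H r) x ** dual_density H r x)"
    using vol(1) vol(3) sm(3)
  proof eventually_elim
    case (elim r)
    define T where "T = {x\<in>S. det (H r x) > 0}"
    have "open T" unfolding T_def
      using continuous_open_preimage[OF smooth_on_continuous_on[OF smooth_on_det[OF S(1) elim(3)]] S(1), of "{0<..}"]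
      by (simp add: vimage_def Int_def conj_commute)
    moreover have x: "x \<in> T" using elim S by (simp add: T_def)
    moreover have HT: "smooth_on T (H r)" using smooth_on_subset[OF elim(3), of T] by (auto simp: T_def)
    ultimately have "smooth_on T (dual_density H r)"
      unfolding dual_density_def
      by (intro smooth_on_scaleR smooth_on_sqrt smooth_on_det smooth_on_matrix_inv) (auto simp: T_def)
    then have dd: "dual_density H r differentiable (at x)" by (rule smooth_on_differentiable[OF _ x])
    have prod: "H r z ** dual_density H r z = sqrt (det (H r z)) *\<^sub>R mat 1" if "z \<in> T" for z
    proof -
      have "H r z ** matrix_inv (H r z) = mat 1" using that by (intro matrix_inv_right) (auto simp: T_def)
      then show ?thesis
        by (simp add: dual_density_def bounded_bilinear.scaleR_right[OF bounded_bilinear_matrix_mult])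
    qed
    have "pd i (\<lambda>z. H r z ** dual_density H r z) x = pd i (\<lambda>z. sqrt (det (H r z)) *\<^sub>R mat 1) x" for i
      by (rule pd_cong[OF \<open>open T\<close> x]) (rule prod)
    moreover have "pd i (\<lambda>z. H r z ** dual_density H r z) x =
        H r x ** pd i (dual_density H r) x + pd i (H r) x ** dual_density H r x" for i
      by (rule pd_bilinear[OF bounded_bilinear_matrix_mult smooth_on_differentiable[OF HT x] dd])
    moreover have "pd i (\<lambda>z. sqrt (det (H r z)) *\<^sub>R (mat 1 :: real^'n^'n)) x = pd i (\<lambda>z. sqrt (det (H r z))) x *\<^sub>R mat 1" for i
      by (rule pd_linear[OF bounded_linear_scaleR_left elim(2)])
    ultimately have "H r x ** pd i (dual_density H r) x =
        pd i (\<lambda>z. sqrt (det (H r z))) x *\<^sub>R mat 1 - pd i (H r) x ** dual_density H r x" for i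
      by (simp add: eq_diff_eq)
    then show ?case using dd prod[OF x] by blast
  qed
  have He: "expands m (\<lambda>r. H r x) (\<lambda>k. h k x)" and Hd: "expands m (\<lambda>r. pd i (H r) x) (\<lambda>k. pd i (h k) x)" for i
    using H(1) by (auto simp: jet_expands_def)
  have h0x: "det (h 0 x) \<noteq> 0" using h0[OF S(2)] by simp
  obtain K where K: "K > 0" "\<And>(a::real^'n^'n) (b::real^'n^'n). norm (a ** b) \<le> norm a * norm b * K"
    using bounded_bilinear.pos_bounded[OF bounded_bilinear_matrix_mult] by blast
  have "norm X \<le> (norm (matrix_inv (h 0 x)) * K) * norm (h 0 x ** X)" for X :: "real^'n^'n"
    using K(2)[of "matrix_inv (h 0 x)" "h 0 x ** X"]
    by (simp add: matrix_mul_assoc matrix_inv_left[OF h0x] mult_ac)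
  then obtain C where C: "\<forall>\<^sub>F r in at_right 0. \<forall>X::real^'n^'n. norm X \<le> C * norm (H r x ** X)"
    using coercive_near[OF bounded_bilinear_matrix_mult expands_limit[OF He]] by blast
  have rec: "(\<Sum>i\<le>k. h i z ** ?w (k - i) z) = V k z *\<^sub>R mat 1" if "z \<in> S" for k z
    using dual_coeff_rec[of "\<lambda>j. h j z" "\<lambda>j. V j z" k] h0[OF that] by simp
  have W: "expands m (\<lambda>r. dual_density H r x) (\<lambda>k. ?w k x)"
  proof (rule expands_divide[OF bounded_bilinear_matrix_mult He _ _ C])
    show "expands m (\<lambda>r. H r x ** dual_density H r x) (\<lambda>k. V k x *\<^sub>R mat 1)"
      by (rule expands_cong[THEN iffD2, OF _ _ expands_linear[OF bounded_linear_scaleR_left H(2)]])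
         (use ev in \<open>eventually_elim, blast\<close>, simp)
  qed (rule rec[OF S(2)])
  have "expands m (\<lambda>r. pd i (dual_density H r) x) (\<lambda>k. pd i (?w k) x)" for i
  proof (rule expands_divide[OF bounded_bilinear_matrix_mult He _ _ C])
    show "expands m (\<lambda>r. H r x ** pd i (dual_density H r) x)
       (\<lambda>k. pd i (V k) x *\<^sub>R mat 1 - (\<Sum>j\<le>k. pd i (h j) x ** ?w (k - j) x))"
    proof (rule expands_cong[THEN iffD2])
      show "expands m (\<lambda>r. pd i (\<lambda>x. sqrt (det (H r x))) x *\<^sub>R mat 1 - pd i (H r) x ** dual_density H r x)
       (\<lambda>k. pd i (V k) x *\<^sub>R mat 1 - (\<Sum>j\<le>k. pd i (h j) x ** ?w (k - j) x))"
        by (intro expands_diff expands_linear[OF bounded_linear_scaleR_left vol(2)]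
            expands_bilinear[OF bounded_bilinear_matrix_mult] Hd W)
    qed (use ev in \<open>eventually_elim, blast\<close>, simp)
    fix k assume k: "k \<le> m"
    have dh: "h j differentiable (at x)" if "j \<le> k" for j
      by (rule smooth_on_differentiable[OF sm(1) S(2)]) (use that k in simp)
    have "pd i (\<lambda>z. \<Sum>j\<le>k. h j z ** ?w (k - j) z) x = pd i (\<lambda>z. V k z *\<^sub>R mat 1) x"
      by (rule pd_cong[OF S]) (rule rec)
    moreover have "pd i (\<lambda>z. V k z *\<^sub>R (mat 1 :: real^'n^'n)) x = pd i (V k) x *\<^sub>R mat 1"
      by (rule pd_linear[OF bounded_linear_scaleR_left dV[OF k]])
    moreover have "pd i (\<lambda>z. \<Sum>j\<le>k. h j z ** ?w (k - j) z) x =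
        (\<Sum>j\<le>k. h j x ** pd i (?w (k - j)) x + pd i (h j) x ** ?w (k - j) x)"
      using k by (subst pd_sum) (auto intro!: differentiable_bilinear[OF bounded_bilinear_matrix_mult]
           pd_bilinear[OF bounded_bilinear_matrix_mult] dh dw sum.cong)
    ultimately show "(\<Sum>j\<le>k. h j x ** pd i (?w (k - j)) x) =
        pd i (V k) x *\<^sub>R mat 1 - (\<Sum>j\<le>k. pd i (h j) x ** ?w (k - j) x)"
      by (simp add: sum.distrib eq_diff_eq)
  qed
  moreover have "\<forall>\<^sub>F r in at_right 0. dual_density H r differentiable (at x)"
    using ev by eventually_elim blast
  ultimately show ?thesis using W dw by (simp add: jet_expands_def)
qed

lemma transpose_matrix_inv:
  fixes A :: "real^'n^'n"
  assumes "transpose A = A" "det A \<noteq> 0"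
  shows "transpose (matrix_inv A) = matrix_inv A"
proof -
  have "A ** transpose (matrix_inv A) = transpose (matrix_inv A ** A)"
    by (simp add: matrix_transpose_mul assms(1))
  then have "A ** transpose (matrix_inv A) = mat 1"
    by (simp add: matrix_inv_left[OF assms(2)] transpose_mat)
  then show ?thesis by (metis matrix_inv_unique)
qed

lemma bounded_linear_transpose: "bounded_linear (transpose :: real^'n^'m \<Rightarrow> real^'m^'n)"
  by (rule linear_conv_bounded_linear[THEN iffD1], rule linearI) (auto simp: transpose_def vec_eq_iff)

section \<open>The recursion for radial expansions of eigenfunctions\<close>

definition div_form :: "(real^'n::finite \<Rightarrow> real^'n^'n) \<Rightarrow> (real^'n \<Rightarrow> complex) \<Rightarrow> real^'n \<Rightarrow> complex" where
  "div_form w \<phi> x = (\<Sum>i\<in>UNIV. \<Sum>j\<in>UNIV. pd i (\<lambda>z. (w z $ i $ j) *\<^sub>R pd j \<phi> z) x)"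

lemma differentiable_entry:
  fixes w :: "real^'m::finite \<Rightarrow> real^'n^'k"
  assumes "w differentiable (at x)"
  shows "(\<lambda>z. w z $ i $ j) differentiable (at x)" "pd l (\<lambda>z. w z $ i $ j) x = pd l w x $ i $ j"
proof -
  have "bounded_linear (\<lambda>v::real^'n^'k. v $ i $ j)"
    by (intro bounded_linear_compose[OF bounded_linear_vec_nth] bounded_linear_vec_nth)
  then show "(\<lambda>z. w z $ i $ j) differentiable (at x)" "pd l (\<lambda>z. w z $ i $ j) x = pd l w x $ i $ j"
    using differentiable_linear pd_linear assms by blast+
qed

lemma div_form_expand:
  assumes "open S" "x \<in> S" "smooth_on S \<phi>" "w differentiable (at x)"
  shows "div_form w \<phi> x =
    (\<Sum>i\<in>UNIV. \<Sum>j\<in>UNIV. w x $ i $ j *\<^sub>R pd i (pd j \<phi>) x + pd i w x $ i $ j *\<^sub>R pd j \<phi> x)"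
  unfolding div_form_def
proof (intro sum.cong refl)
  fix i j
  have "pd j \<phi> differentiable (at x)"
    by (rule smooth_on_differentiable[OF smooth_on_pd[OF assms(3)] assms(2)])
  then show "pd i (\<lambda>z. (w z $ i $ j) *\<^sub>R pd j \<phi> z) x =
      w x $ i $ j *\<^sub>R pd i (pd j \<phi>) x + pd i w x $ i $ j *\<^sub>R pd j \<phi> x"
    using differentiable_entry[OF assms(4)] by (subst pd_bilinear[OF bounded_bilinear_scaleR]) auto
qed

lemma div_form_cong:
  assumes "open S" "x \<in> S" "\<And>z. z \<in> S \<Longrightarrow> \<phi> z = \<psi> z"
  shows "div_form w \<phi> x = div_form w \<psi> x"
  unfolding div_form_def
proof (intro sum.cong refl)
  fix i j
  have "pd j \<phi> z = pd j \<psi> z" if "z \<in> S" for z by (rule pd_cong[OF assms(1) that assms(3)])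
  then show "pd i (\<lambda>z. (w z $ i $ j) *\<^sub>R pd j \<phi> z) x = pd i (\<lambda>z. (w z $ i $ j) *\<^sub>R pd j \<psi> z) x"
    by (intro pd_cong[OF assms(1,2)]) simp
qed

lemma div_form_linear:
  fixes L :: "'j \<Rightarrow> complex \<Rightarrow> complex"
  assumes "open S" "x \<in> S" "\<And>j. j \<in> I \<Longrightarrow> smooth_on S (\<phi> j)" "w differentiable (at x)"
    "\<And>j. bounded_linear (L j)"
  shows "div_form w (\<lambda>z. \<Sum>j\<in>I. L j (\<phi> j z)) x = (\<Sum>j\<in>I. L j (div_form w (\<phi> j) x))"
proof -
  have sm: "smooth_on S (\<lambda>z. L j (\<phi> j z))" if "j \<in> I" for j
    by (rule smooth_on_linear[OF assms(1,5) assms(3)[OF that]])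
  have L: "linear (L j)" for j using assms(5) by (rule bounded_linear.linear)
  have p1: "pd k (\<lambda>z. \<Sum>j\<in>I. L j (\<phi> j z)) z = (\<Sum>j\<in>I. L j (pd k (\<phi> j) z))" if "z \<in> S" for k z
    using smooth_on_differentiable[OF sm that] smooth_on_differentiable[OF assms(3) that] assms(5)
    by (subst pd_sum) (auto intro!: sum.cong pd_linear)
  have d1: "pd k (\<phi> j) differentiable (at x)" if "j \<in> I" for j k
    by (rule smooth_on_differentiable[OF smooth_on_pd[OF assms(3)[OF that]] assms(2)])
  have p2: "pd i (pd k (\<lambda>z. \<Sum>j\<in>I. L j (\<phi> j z))) x = (\<Sum>j\<in>I. L j (pd i (pd k (\<phi> j)) x))" for i k
  proof -
    have "pd i (pd k (\<lambda>z. \<Sum>j\<in>I. L j (\<phi> j z))) x = pd i (\<lambda>z. \<Sum>j\<in>I. L j (pd k (\<phi> j) z)) x"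
      by (rule pd_cong[OF assms(1,2)]) (rule p1)
    also have "\<dots> = (\<Sum>j\<in>I. L j (pd i (pd k (\<phi> j)) x))"
      by (subst pd_sum) (auto intro!: sum.cong simp: pd_linear[OF assms(5) d1] differentiable_linear[OF assms(5) d1])
    finally show ?thesis .
  qed
  have "div_form w (\<lambda>z. \<Sum>j\<in>I. L j (\<phi> j z)) x = (\<Sum>i\<in>UNIV. \<Sum>k\<in>UNIV. \<Sum>j\<in>I.
      L j (w x $ i $ k *\<^sub>R pd i (pd k (\<phi> j)) x + pd i w x $ i $ k *\<^sub>R pd k (\<phi> j) x))"
    by (subst div_form_expand[OF assms(1,2) smooth_on_sum[OF assms(1) sm] assms(4)])
       (simp_all only: p1[OF assms(2)] p2 scaleR_sum_right sum.distrib linear_add[OF L] linear_scale[OF L])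
  also have "\<dots> = (\<Sum>j\<in>I. \<Sum>i\<in>UNIV. \<Sum>k\<in>UNIV.
      L j (w x $ i $ k *\<^sub>R pd i (pd k (\<phi> j)) x + pd i w x $ i $ k *\<^sub>R pd k (\<phi> j) x))"
    by (subst sum.swap[of _ I]) (auto intro!: sum.cong sum.swap)
  also have "\<dots> = (\<Sum>j\<in>I. L j (div_form w (\<phi> j) x))"
    by (intro sum.cong refl) (simp add: div_form_expand[OF assms(1,2) assms(3) assms(4)] linear_sum[OF L])
  finally show ?thesis .
qed

lemma expands_div_form:
  assumes "open S" "x \<in> S" "smooth_on S \<phi>" "jet_expands m W w x"
  shows "expands m (\<lambda>r. div_form (W r) \<phi> x) (\<lambda>k. div_form (w k) \<phi> x)"
proof (rule expands_cong[THEN iffD2])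
  have e: "expands m (\<lambda>r. F r $ i $ j *\<^sub>R c) (\<lambda>k. f k $ i $ j *\<^sub>R c)"
    if "expands m F f" for F :: "real \<Rightarrow> real^'a^'a" and f i j and c :: complex
    by (rule expands_linear[OF bounded_linear_compose[OF bounded_linear_scaleR_left
          bounded_linear_compose[OF bounded_linear_vec_nth bounded_linear_vec_nth]] that])
  show "expands m (\<lambda>r. \<Sum>i\<in>UNIV. \<Sum>j\<in>UNIV. W r x $ i $ j *\<^sub>R pd i (pd j \<phi>) x + pd i (W r) x $ i $ j *\<^sub>R pd j \<phi> x)
     (\<lambda>k. \<Sum>i\<in>UNIV. \<Sum>j\<in>UNIV. w k x $ i $ j *\<^sub>R pd i (pd j \<phi>) x + pd i (w k) x $ i $ j *\<^sub>R pd j \<phi> x)"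
    using assms(4) unfolding jet_expands_def by (intro expands_sum expands_add e) auto
  have "\<forall>\<^sub>F r in at_right 0. W r differentiable (at x)" using assms(4) by (simp add: jet_expands_def)
  then show "\<forall>\<^sub>F r in at_right 0. div_form (W r) \<phi> x =
      (\<Sum>i\<in>UNIV. \<Sum>j\<in>UNIV. W r x $ i $ j *\<^sub>R pd i (pd j \<phi>) x + pd i (W r) x $ i $ j *\<^sub>R pd j \<phi> x)"
    by eventually_elim (rule div_form_expand[OF assms(1-3)])
  show "div_form (w k) \<phi> x =
      (\<Sum>i\<in>UNIV. \<Sum>j\<in>UNIV. w k x $ i $ j *\<^sub>R pd i (pd j \<phi>) x + pd i (w k) x $ i $ j *\<^sub>R pd j \<phi> x)"
    if "k \<le> m" for k
    by (rule div_form_expand[OF assms(1-3)]) (use assms(4) that in \<open>simp add: jet_expands_def\<close>)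
qed

lemma expands_shift:
  assumes "expands m F a"
  shows "expands (Suc m) (\<lambda>r. r\<^sup>2 *\<^sub>R F r) (\<lambda>k. case k of 0 \<Rightarrow> 0 | Suc k \<Rightarrow> a k)"
proof -
  have "(r\<^sup>2 *\<^sub>R F r - (\<Sum>k\<le>Suc m. r ^ (2*k) *\<^sub>R (case k of 0 \<Rightarrow> 0 | Suc k \<Rightarrow> a k))) /\<^sub>R r ^ (2 * Suc m)
     = (F r - (\<Sum>k\<le>m. r ^ (2*k) *\<^sub>R a k)) /\<^sub>R r ^ (2*m)" if "r > 0" for r
  proof -
    have "(\<Sum>k\<le>Suc m. r ^ (2*k) *\<^sub>R (case k of 0 \<Rightarrow> 0 | Suc k \<Rightarrow> a k)) = r\<^sup>2 *\<^sub>R (\<Sum>k\<le>m. r ^ (2*k) *\<^sub>R a k)"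
      by (subst sum.atMost_Suc_shift) (simp add: scaleR_sum_right power2_eq_square mult.assoc)
    then have "(r\<^sup>2 *\<^sub>R F r - (\<Sum>k\<le>Suc m. r ^ (2*k) *\<^sub>R (case k of 0 \<Rightarrow> 0 | Suc k \<Rightarrow> a k))) /\<^sub>R r ^ (2 * Suc m)
       = (inverse (r ^ (2 * Suc m)) * r\<^sup>2) *\<^sub>R (F r - (\<Sum>k\<le>m. r ^ (2*k) *\<^sub>R a k))"
      by (simp only: scaleR_diff_right scaleR_scaleR)
    also have "inverse (r ^ (2 * Suc m)) * r\<^sup>2 = inverse (r ^ (2*m))"
      using that by (simp add: power2_eq_square field_simps)
    finally show ?thesis .
  qed
  then have "\<forall>\<^sub>F r in at_right 0. (r\<^sup>2 *\<^sub>R F r - (\<Sum>k\<le>Suc m. r ^ (2*k) *\<^sub>R (case k of 0 \<Rightarrow> 0 | Suc k \<Rightarrow> a k))) /\<^sub>R r ^ (2 * Suc m)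
     = (F r - (\<Sum>k\<le>m. r ^ (2*k) *\<^sub>R a k)) /\<^sub>R r ^ (2*m)"
    using eventually_pos by (rule eventually_mono[rotated])
  then show ?thesis using assms unfolding expands_def by (subst tendsto_cong)
qed

lemma has_vector_derivative_radial:
  fixes b :: "nat \<Rightarrow> complex"
  assumes "r > 0"
  shows "((\<lambda>r. \<Sum>j\<le>K. r powr (s + 2 * real j) *\<^sub>R b j) has_vector_derivative
     (\<Sum>j\<le>K. r powr (s + 2 * real j - 1) *\<^sub>R ((s + 2 * real j) *\<^sub>R b j))) (at r)"
proof (rule has_vector_derivative_sum)
  fix j
  have "((\<lambda>r. r powr (s + 2 * real j)) has_real_derivative (s + 2 * real j) * r powr (s + 2 * real j - 1)) (at r)"
    using has_real_derivative_powr[OF assms] .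
  from has_vector_derivative_scaleR[OF this has_vector_derivative_const, of "b j"]
  show "((\<lambda>r. r powr (s + 2 * real j) *\<^sub>R b j) has_vector_derivative
      r powr (s + 2 * real j - 1) *\<^sub>R ((s + 2 * real j) *\<^sub>R b j)) (at r)"
    by (simp add: mult.commute)
qed

text \<open>At a fixed point of the manifold the eigenvalue equation is an ordinary differential equation for
  \<open>Y = r\<^sup>1\<^sup>-\<^sup>n V\<^sub>r \<partial>\<^sub>r u\<close>. The expansions of \<open>V\<^sub>r\<close> and of the tangential part determine those of \<open>Y\<close> and \<open>Y'\<close>, up to the
  common factors \<open>r\<^sup>s\<^sup>-\<^sup>n\<close> and \<open>r\<^sup>s\<^sup>-\<^sup>n\<^sup>-\<^sup>1\<close>, and the recursion is the relation between their coefficients of order \<open>m\<close>. The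
  tangential part enters with a factor \<open>r\<^sup>2\<close>, so that \<open>W\<close> is needed to one order less than \<open>V\<close>; this is why the
  term \<open>r\<^sup>n log r\<close> of the metric does no harm.\<close>

lemma radial_recursion:
  fixes H :: "real \<Rightarrow> real^'n::finite \<Rightarrow> real^'n^'n" and \<phi> :: "nat \<Rightarrow> real^'n \<Rightarrow> complex"
    and u :: "real^('n option) \<Rightarrow> complex" and m' K :: nat
  defines "n \<equiv> real CARD('n)" and "m \<equiv> Suc m'"
  assumes S: "open S" "x \<in> S" and s: "s \<ge> n + 1"
    and H: "smooth_on {y. y $ None > 0 \<and> base_part y \<in> S} (\<lambda>y. H (y $ None) (base_part y))"
    and \<phi>: "\<And>j. j \<le> K \<Longrightarrow> smooth_on S (\<phi> j)"
    and W: "jet_expands m' (dual_density H) w x"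
    and V: "expands m (\<lambda>r. sqrt (det (H r x))) V"
    and pos: "\<forall>\<^sub>F r in at_right 0. det (H r x) > 0"
    and K: "m \<le> K"
    and u: "\<And>y. y $ None > 0 \<Longrightarrow> base_part y \<in> S \<Longrightarrow>
       u y = (\<Sum>j\<le>K. (y $ None) powr (s + 2 * real j) *\<^sub>R \<phi> j (base_part y))"
    and E: "((\<lambda>r. (laplacian (g_plus H) u (join x r) + (s * (n - s)) *\<^sub>R u (join x r)) /\<^sub>R r powr (s + 2 * real m)) \<longlongrightarrow> 0) (at_right 0)"
  shows "(\<Sum>j\<le>m. ((s + 2 * real j) * (s + 2 * real m - n) + s * (n - s)) *\<^sub>R (V (m - j) *\<^sub>R \<phi> j x))
       + (\<Sum>j\<le>m'. div_form (w (m' - j)) (\<phi> j) x) = 0"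
proof -
  define e where "e = s - n"
  define Vr where "Vr r = sqrt (det (H r x))" for r
  define Cyl where "Cyl = {y :: real^('n option). y $ None > 0 \<and> base_part y \<in> S}"
  define \<Omega> where "\<Omega> = {y\<in>Cyl. det (H (y $ None) (base_part y)) > 0}"
  have opC: "open Cyl" unfolding Cyl_def by (rule open_cylinder[OF S(1)])
  have "open \<Omega>" unfolding \<Omega>_def
    using continuous_open_preimage[OF smooth_on_continuous_on[OF smooth_on_det[OF opC H[folded Cyl_def]]] opC, of "{0<..}"]
    by (simp add: vimage_def Int_def conj_commute)
  have \<rho>: "smooth_on Cyl (\<lambda>y. y $ None)"
    by (rule smooth_on_linear[OF opC bounded_linear_vec_nth smooth_on_ident[OF opC]])
  have bp: "smooth_on Cyl base_part"
    by (rule smooth_on_linear[OF opC bounded_linear_base_part smooth_on_ident[OF opC]])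
  have uC: "smooth_on Cyl u"
  proof (rule smooth_on_cong[OF opC])
    show "smooth_on Cyl (\<lambda>y. \<Sum>j\<le>K. (y $ None) powr (s + 2 * real j) *\<^sub>R \<phi> j (base_part y))"
      by (intro smooth_on_sum smooth_on_scaleR smooth_on_powr opC \<rho> smooth_on_compose[OF opC bp _ \<phi>])
         (auto simp: Cyl_def)
  qed (use u in \<open>auto simp: Cyl_def\<close>)
  have sub: "\<Omega> \<subseteq> Cyl" by (auto simp: \<Omega>_def)
  define Lap where "Lap r = laplacian (g_plus H) u (join x r)" for r
  define b where "b j = \<phi> j x" for j
  have uj: "u (join z r) = (\<Sum>j\<le>K. r powr (s + 2 * real j) *\<^sub>R \<phi> j z)" if "r > 0" "z \<in> S" for r z
    using u[of "join z r"] that by simp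
  define Y where "Y r = (r powr (1 - n) * Vr r) *\<^sub>R (\<Sum>j\<le>K. r powr (s + 2 * real j - 1) *\<^sub>R ((s + 2 * real j) *\<^sub>R b j))" for r
  define Z where "Z r = (\<Sum>j\<le>K. r powr (s + 2 * real j) *\<^sub>R div_form (dual_density H r) (\<phi> j) x)" for r
  define Y' where "Y' r = (r powr (- n - 1) * Vr r) *\<^sub>R Lap r - r powr (1 - n) *\<^sub>R Z r" for r
  have dW: "\<forall>\<^sub>F r in at_right 0. dual_density H r differentiable (at x)"
    using W by (simp add: jet_expands_def)
  have der: "\<forall>\<^sub>F r in at_right 0. (Y has_vector_derivative Y' r) (at r)"
    using eventually_pos pos dW
  proof eventually_elim
    case (elim r)
    have xr: "join x r \<in> \<Omega>" using elim S by (simp add: \<Omega>_def Cyl_def)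
    have vd: "vector_derivative (\<lambda>r. u (join x r)) (at r) =
        (\<Sum>j\<le>K. r powr (s + 2 * real j - 1) *\<^sub>R ((s + 2 * real j) *\<^sub>R b j))" if "r > 0" for r
    proof (rule vector_derivative_at, rule has_vector_derivative_transform_within_open)
      show "((\<lambda>r. \<Sum>j\<le>K. r powr (s + 2 * real j) *\<^sub>R b j) has_vector_derivative
         (\<Sum>j\<le>K. r powr (s + 2 * real j - 1) *\<^sub>R ((s + 2 * real j) *\<^sub>R b j))) (at r)"
        by (rule has_vector_derivative_radial[OF that])
      show "open {0::real<..}" "r \<in> {0<..}" using that by auto
      show "(\<Sum>j\<le>K. r powr (s + 2 * real j) *\<^sub>R b j) = u (join x r)" if "r \<in> {0<..}" for r
        using uj[of r x] that S by (simp add: b_def)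
    qed
    have Zr: "(\<Sum>i\<in>UNIV. \<Sum>j\<in>UNIV. pd i (\<lambda>z. (sqrt (det (H r z)) * matrix_inv (H r z) $ i $ j) *\<^sub>R pd j (\<lambda>z. u (join z r)) z) x) = Z r"
    proof -
      have "(\<Sum>i\<in>UNIV. \<Sum>j\<in>UNIV. pd i (\<lambda>z. (sqrt (det (H r z)) * matrix_inv (H r z) $ i $ j) *\<^sub>R pd j (\<lambda>z. u (join z r)) z) x)
         = div_form (dual_density H r) (\<lambda>z. u (join z r)) x"
        by (simp add: div_form_def dual_density_def)
      also have "\<dots> = div_form (dual_density H r) (\<lambda>z. \<Sum>j\<le>K. r powr (s + 2 * real j) *\<^sub>R \<phi> j z) x"
        by (rule div_form_cong[OF S]) (rule uj[OF elim(1)])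
      also have "\<dots> = Z r" unfolding Z_def
        by (rule div_form_linear[OF S _ elim(3)]) (auto intro: \<phi> bounded_linear_scaleR_right)
      finally show ?thesis .
    qed
    have "((\<lambda>r. (r powr (1 - real CARD('n)) * sqrt (det (H r x))) *\<^sub>R vector_derivative (\<lambda>r. u (join x r)) (at r))
       has_vector_derivative Y' r) (at r)"
      unfolding Y'_def Lap_def n_def Vr_def Zr[symmetric]
    proof (rule laplacian_g_plus[OF \<open>open \<Omega>\<close> _ _ _ _ xr])
      show "smooth_on \<Omega> (\<lambda>y. H (y $ None) (base_part y))"
        using smooth_on_subset[OF H sub[unfolded Cyl_def]] .
      show "smooth_on \<Omega> u" by (rule smooth_on_subset[OF uC sub])
    qed (auto simp: \<Omega>_def Cyl_def)
    then show "(Y has_vector_derivative Y' r) (at r)"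
      by (rule has_vector_derivative_transform_within_open[of _ _ _ "{0<..}"])
         (use elim(1) in \<open>auto simp: Y_def vd n_def Vr_def\<close>)
  qed
  have Vx: "expands m Vr V" using V by (simp add: Vr_def[abs_def])
  have Yx: "expands m (\<lambda>r. r powr (- e) *\<^sub>R Y r) (\<lambda>k. \<Sum>i\<le>k. V i *\<^sub>R ((s + 2 * real (k - i)) *\<^sub>R b (k - i)))"
  proof (rule expands_cong[THEN iffD1, OF _ _ expands_bilinear[OF bounded_bilinear_scaleR Vx expands_finite_sum[OF K]]])
    show "\<forall>\<^sub>F r in at_right 0. Vr r *\<^sub>R (\<Sum>k\<le>K. r ^ (2 * k) *\<^sub>R ((s + 2 * real k) *\<^sub>R b k)) = r powr (- e) *\<^sub>R Y r"
      using eventually_pos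
    proof eventually_elim
      case (elim r)
      have "r powr (- e) * (r powr (1 - n) * r powr (s + 2 * real k - 1)) = r ^ (2 * k)" for k
        using elim powr_realpow[OF elim, of "2 * k"] by (simp add: e_def powr_add[symmetric])
      then have *: "r powr (- e) * (r powr (1 - n) * (Vr r * (r powr (s + 2 * real k - 1) * t))) = Vr r * (r ^ (2 * k) * t)" for k t
        by (metis mult.assoc mult.commute)
      show ?case by (simp add: Y_def scaleR_sum_right mult.assoc *)
    qed
  qed simp
  have D: "expands m' (\<lambda>r. \<Sum>j\<le>K. r ^ (2 * j) *\<^sub>R div_form (dual_density H r) (\<phi> j) x)
     (\<lambda>k. \<Sum>j\<le>K. \<Sum>i\<le>k. (if i = j then 1 else 0) *\<^sub>R div_form (w (k - i)) (\<phi> j) x)"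
    by (intro expands_sum expands_bilinear[OF bounded_bilinear_scaleR] expands_monom
        expands_div_form[OF S _ W] \<phi>) simp
  have small: "expands m (\<lambda>r. Vr r *\<^sub>R ((Lap r + (s * (n - s)) *\<^sub>R u (join x r)) /\<^sub>R r powr s)) (\<lambda>k. 0)"
  proof -
    have "((\<lambda>r. Vr r *\<^sub>R ((Lap r + (s * (n - s)) *\<^sub>R u (join x r)) /\<^sub>R r powr (s + 2 * real m))) \<longlongrightarrow> V 0 *\<^sub>R 0) (at_right 0)"
      by (intro tendsto_scaleR expands_limit[OF Vx] E[folded Lap_def])
    then have "((\<lambda>r. Vr r *\<^sub>R ((Lap r + (s * (n - s)) *\<^sub>R u (join x r)) /\<^sub>R r powr (s + 2 * real m))) \<longlongrightarrow> 0) (at_right 0)" by simp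
    then show ?thesis unfolding expands_def
    proof (rule Lim_transform_eventually)
      show "\<forall>\<^sub>F r in at_right 0. Vr r *\<^sub>R ((Lap r + (s * (n - s)) *\<^sub>R u (join x r)) /\<^sub>R r powr (s + 2 * real m)) =
         (Vr r *\<^sub>R ((Lap r + (s * (n - s)) *\<^sub>R u (join x r)) /\<^sub>R r powr s) - (\<Sum>k\<le>m. r ^ (2*k) *\<^sub>R 0)) /\<^sub>R r ^ (2*m)"
        using eventually_pos
      proof eventually_elim
        case (elim r)
        have "r powr (s + 2 * real m) = r powr s * r ^ (2*m)"
          using powr_realpow[OF elim, of "2*m"] by (simp add: powr_add)
        then show ?case by (simp add: mult_ac)
      qed
    qed
  qed
  have Y'x: "expands m (\<lambda>r. r powr (1 - e) *\<^sub>R Y' r) (\<lambda>k. 0 - (s * (n - s)) *\<^sub>R (\<Sum>i\<le>k. V i *\<^sub>R b (k - i))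
     - (case k of 0 \<Rightarrow> 0 | Suc k \<Rightarrow> \<Sum>j\<le>K. \<Sum>i\<le>k. (if i = j then 1 else 0) *\<^sub>R div_form (w (k - i)) (\<phi> j) x))"
  proof (rule expands_cong[THEN iffD1])
    show "expands m (\<lambda>r. Vr r *\<^sub>R ((Lap r + (s * (n - s)) *\<^sub>R u (join x r)) /\<^sub>R r powr s)
        - (s * (n - s)) *\<^sub>R (Vr r *\<^sub>R (\<Sum>k\<le>K. r ^ (2 * k) *\<^sub>R b k))
        - r\<^sup>2 *\<^sub>R (\<Sum>j\<le>K. r ^ (2 * j) *\<^sub>R div_form (dual_density H r) (\<phi> j) x))
       (\<lambda>k. 0 - (s * (n - s)) *\<^sub>R (\<Sum>i\<le>k. V i *\<^sub>R b (k - i))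
     - (case k of 0 \<Rightarrow> 0 | Suc k \<Rightarrow> \<Sum>j\<le>K. \<Sum>i\<le>k. (if i = j then 1 else 0) *\<^sub>R div_form (w (k - i)) (\<phi> j) x))"
      by (intro expands_diff small expands_linear[OF bounded_linear_scaleR_right]
          expands_bilinear[OF bounded_bilinear_scaleR Vx expands_finite_sum[OF K]]
          expands_shift[OF D, folded m_def])
    show "\<forall>\<^sub>F r in at_right 0. Vr r *\<^sub>R ((Lap r + (s * (n - s)) *\<^sub>R u (join x r)) /\<^sub>R r powr s)
        - (s * (n - s)) *\<^sub>R (Vr r *\<^sub>R (\<Sum>k\<le>K. r ^ (2 * k) *\<^sub>R b k))
        - r\<^sup>2 *\<^sub>R (\<Sum>j\<le>K. r ^ (2 * j) *\<^sub>R div_form (dual_density H r) (\<phi> j) x) = r powr (1 - e) *\<^sub>R Y' r"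
      using eventually_pos
    proof eventually_elim
      case (elim r)
      have p: "r powr (s + 2 * real k) = r powr s * r ^ (2 * k)" for k
        using powr_realpow[OF elim, of "2*k"] by (simp add: powr_add)
      have ur: "u (join x r) = r powr s *\<^sub>R (\<Sum>k\<le>K. r ^ (2 * k) *\<^sub>R b k)"
        using uj[OF elim S(2)] by (simp add: p b_def scaleR_sum_right)
      have Zr: "Z r = r powr s *\<^sub>R (\<Sum>j\<le>K. r ^ (2 * j) *\<^sub>R div_form (dual_density H r) (\<phi> j) x)"
        by (simp add: Z_def p scaleR_sum_right)
      have p1: "r powr (1 - e) * r powr (- n - 1) = inverse (r powr s)"
        by (simp add: powr_add[symmetric] e_def powr_minus[symmetric])
      have p2: "r powr (1 - e) * r powr (1 - n) * r powr s = r\<^sup>2"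
        using elim powr_realpow[OF elim, of 2] by (simp add: powr_add[symmetric] e_def)
      have ps: "r powr s \<noteq> 0" using elim by simp
      have "r powr (1 - e) *\<^sub>R Y' r = (r powr (1 - e) * r powr (- n - 1)) *\<^sub>R (Vr r *\<^sub>R Lap r)
          - (r powr (1 - e) * r powr (1 - n) * r powr s) *\<^sub>R (\<Sum>j\<le>K. r ^ (2 * j) *\<^sub>R div_form (dual_density H r) (\<phi> j) x)"
        by (simp add: Y'_def Zr scaleR_diff_right mult_ac)
      also have "\<dots> = Vr r *\<^sub>R (Lap r /\<^sub>R r powr s) - r\<^sup>2 *\<^sub>R (\<Sum>j\<le>K. r ^ (2 * j) *\<^sub>R div_form (dual_density H r) (\<phi> j) x)"
        unfolding p1 p2 by (simp add: mult.commute)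
      finally show ?case
        using ps by (simp add: ur scaleR_add_right mult_ac)
    qed
  qed simp
  have "e \<ge> 1" using s by (simp add: e_def)
  from expands_ode[OF this der Yx Y'x, of m]
  have eq: "0 - (s * (n - s)) *\<^sub>R (\<Sum>i\<le>m. V i *\<^sub>R b (m - i))
     - (\<Sum>j\<le>K. \<Sum>i\<le>m'. (if i = j then 1 else 0) *\<^sub>R div_form (w (m' - i)) (\<phi> j) x)
     = (e + 2 * real m) *\<^sub>R (\<Sum>i\<le>m. V i *\<^sub>R ((s + 2 * real (m - i)) *\<^sub>R b (m - i)))"
    by (simp add: m_def)
  have "(\<Sum>j\<le>K. \<Sum>i\<le>m'. (if i = j then 1 else 0) *\<^sub>R div_form (w (m' - i)) (\<phi> j) x)
      = (\<Sum>i\<le>m'. \<Sum>j\<le>K. (if j = i then div_form (w (m' - i)) (\<phi> j) x else 0))"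
    by (subst sum.swap) (intro sum.cong refl, auto)
  also have "\<dots> = (\<Sum>i\<le>m'. div_form (w (m' - i)) (\<phi> i) x)"
    using K by (intro sum.cong refl) (auto simp: sum.delta m_def)
  finally have 1: "(\<Sum>j\<le>K. \<Sum>i\<le>m'. (if i = j then 1 else 0) *\<^sub>R div_form (w (m' - i)) (\<phi> j) x)
      = (\<Sum>i\<le>m'. div_form (w (m' - i)) (\<phi> i) x)" .
  have rev: "(\<Sum>i\<le>m. g i (m - i)) = (\<Sum>j\<le>m. g (m - j) j)" for g :: "nat \<Rightarrow> nat \<Rightarrow> complex"
    using sum.nat_diff_reindex[of "\<lambda>i. g (m - i) i" "Suc m"] by (simp add: lessThan_Suc_atMost)
  have "(\<Sum>j\<le>m. ((s + 2 * real j) * (s + 2 * real m - n) + s * (n - s)) *\<^sub>R (V (m - j) *\<^sub>R \<phi> j x))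
    = (e + 2 * real m) *\<^sub>R (\<Sum>j\<le>m. V (m - j) *\<^sub>R ((s + 2 * real j) *\<^sub>R b j)) + (s * (n - s)) *\<^sub>R (\<Sum>j\<le>m. V (m - j) *\<^sub>R b j)"
    unfolding scaleR_sum_right sum.distrib[symmetric]
  proof (intro sum.cong refl)
    fix j
    have "((s + 2 * real j) * (s + 2 * real m - n) + s * (n - s)) * V (m - j)
      = (e + 2 * real m) * (V (m - j) * (s + 2 * real j)) + (s * (n - s)) * V (m - j)"
      by (simp add: e_def algebra_simps)
    then show "((s + 2 * real j) * (s + 2 * real m - n) + s * (n - s)) *\<^sub>R (V (m - j) *\<^sub>R \<phi> j x) =
      (e + 2 * real m) *\<^sub>R (V (m - j) *\<^sub>R ((s + 2 * real j) *\<^sub>R b j)) + (s * (n - s)) *\<^sub>R (V (m - j) *\<^sub>R b j)"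
      unfolding scaleR_scaleR scaleR_add_left[symmetric] b_def by simp
  qed
  moreover have "- y = x + z \<Longrightarrow> x + y + z = 0" for x y z :: complex by algebra
  ultimately show ?thesis
    using eq unfolding 1 rev[of "\<lambda>i j. V i *\<^sub>R b j"] rev[of "\<lambda>i j. V i *\<^sub>R ((s + 2 * real j) *\<^sub>R b j)"]
    by (simp add: diff_eq_eq)
qed

section \<open>The recursion on the manifold\<close>

lemma smooth_on_power: 
  fixes F :: "real^'m::finite \<Rightarrow> real"
  assumes "open S" "smooth_on S F"
  shows "smooth_on S (\<lambda>x. F x ^ k)"
  by (induction k) (auto intro!: smooth_on_const smooth_on_mult assms)

lemma smooth_on_ln:
  fixes F :: "real^'m::finite \<Rightarrow> real"
  assumes "open S" "smooth_on S F" "\<And>x. x \<in> S \<Longrightarrow> F x > 0"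
  shows "smooth_on S (\<lambda>x. ln (F x))"
proof (rule smooth_on_real_compose[OF assms(1,2), where \<G>="insert ln {g. \<exists>c a. g = (\<lambda>t. c * t powr a)}"])
  fix g :: "real \<Rightarrow> real" assume g: "g \<in> insert ln {g. \<exists>c a. g = (\<lambda>t. c * t powr a)}"
  show "\<exists>g'\<in>insert ln {g. \<exists>c a. g = (\<lambda>t. c * t powr a)}. \<forall>x\<in>S. (g has_real_derivative g' (F x)) (at (F x))"
  proof (cases "g = ln")
    case True
    have "(g has_real_derivative 1 * F x powr (- 1)) (at (F x))" if "x \<in> S" for x
      unfolding True using assms(3)[OF that] by (auto intro!: derivative_eq_intros simp: powr_minus inverse_eq_divide)
    then show ?thesis by (intro bexI[of _ "\<lambda>t. 1 * t powr (- 1)"]) blast+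
  next
    case False
    then obtain c a where g: "g = (\<lambda>t. c * t powr a)" using g by blast
    have "(g has_real_derivative (c * a) * F x powr (a - 1)) (at (F x))" if "x \<in> S" for x
      unfolding g using assms(3)[OF that] by (auto intro!: derivative_eq_intros)
    then show ?thesis by (intro bexI[of _ "\<lambda>t. (c * a) * t powr (a - 1)"]) blast+
  qed
qed simp

text \<open>With \<open>ln r = - 2 ln (1 / sqrt r)\<close> and \<open>ln t \<le> t\<close>, the product is bounded by \<open>2 sqrt r\<close>.\<close>

lemma tendsto_mult_ln_zero: "((\<lambda>r::real. r * ln r) \<longlongrightarrow> 0) (at_right 0)"
proof (rule Lim_null_comparison)
  show "\<forall>\<^sub>F r in at_right 0. norm (r * ln r) \<le> 2 * sqrt r"
  proof -
    have "\<forall>\<^sub>F r in at_right 0. r < (1::real)"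
      unfolding eventually_at_right_field by (intro exI[of _ 1]) auto
    then show ?thesis using eventually_pos
    proof eventually_elim
      case (elim r)
      have s: "sqrt r > 0" "r = sqrt r * sqrt r" using elim by auto
      have "ln (inverse (sqrt r)) \<le> inverse (sqrt r)" using ln_le_minus_one[of "inverse (sqrt r)"] s by simp
      then have "- ln (sqrt r) \<le> inverse (sqrt r)" using s by (simp add: ln_inverse)
      then have "- ln r \<le> 2 * inverse (sqrt r)" using elim by (simp add: ln_sqrt)
      then have "r * (- ln r) \<le> r * (2 * inverse (sqrt r))" using elim by (intro mult_left_mono) auto
      also have "\<dots> = 2 * sqrt r" using s by (metis (no_types, lifting) inverse_eq_divide mult.assoc mult.commute nonzero_mult_div_cancel_left order_less_irrefl times_divide_eq_right mult.right_neutral)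
      finally show ?case using elim by (simp add: abs_mult)
    qed
  qed
  have "((\<lambda>r. 2 * sqrt r) \<longlongrightarrow> 2 * sqrt 0) (at_right 0)" by (intro tendsto_intros)
  then show "((\<lambda>r. 2 * sqrt r) \<longlongrightarrow> 0) (at_right 0)" by simp
qed

lemma expands_log_term:
  assumes "2 * m < n"
  shows "expands m (\<lambda>r. r ^ n * ln r) (\<lambda>k. 0)"
proof -
  have "((\<lambda>r::real. r ^ (n - 2*m - 1) * (r * ln r)) \<longlongrightarrow> 0 ^ (n - 2*m - 1) * 0) (at_right 0)"
    by (intro tendsto_mult tendsto_mult_ln_zero tendsto_power tendsto_ident_at)
  then have *: "((\<lambda>r::real. r ^ (n - 2*m - 1) * (r * ln r)) \<longlongrightarrow> 0) (at_right 0)" by simp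
  show ?thesis unfolding expands_def
  proof (rule Lim_transform_eventually[OF *])
    show "\<forall>\<^sub>F r in at_right 0. r ^ (n - 2*m - 1) * (r * ln r) = (r ^ n * ln r - (\<Sum>k\<le>m. r ^ (2*k) *\<^sub>R 0)) /\<^sub>R r ^ (2*m)"
      using eventually_pos
    proof eventually_elim
      case (elim r)
      have "n = 2*m + Suc (n - 2*m - 1)" using assms by simp
      then have "r ^ n = r ^ (2*m) * (r ^ (n - 2*m - 1) * r)"
        by (metis power_add power_Suc2)
      then show ?case using elim by simp
    qed
  qed
qed

lemma bigo_radial_limit:
  fixes F :: "real \<Rightarrow> complex"
  assumes "F \<in> O[at_right 0](\<lambda>r. complex_of_real r powr (of_real \<sigma> + of_nat L))" "2 * m < L"
  shows "((\<lambda>r. F r /\<^sub>R r powr (\<sigma> + 2 * real m)) \<longlongrightarrow> 0) (at_right 0)"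
proof -
  obtain C where C: "\<forall>\<^sub>F r in at_right 0. norm (F r) \<le> C * norm (complex_of_real r powr (of_real \<sigma> + of_nat L))"
    using assms(1) unfolding bigo_def by auto
  have "((\<lambda>r::real. C * r ^ Suc (L - 2*m - 1)) \<longlongrightarrow> C * 0) (at_right 0)"
    by (intro tendsto_mult tendsto_const tendsto_power_zero)
  then have lim: "((\<lambda>r::real. C * r ^ Suc (L - 2*m - 1)) \<longlongrightarrow> 0) (at_right 0)" by simp
  show ?thesis
  proof (rule Lim_null_comparison[OF _ lim])
    show "\<forall>\<^sub>F r in at_right 0. norm (F r /\<^sub>R r powr (\<sigma> + 2 * real m)) \<le> C * r ^ Suc (L - 2*m - 1)"
      using C eventually_pos
    proof eventually_elim
      case (elim r)
      have "of_real \<sigma> + of_nat L = (of_real (\<sigma> + real L) :: complex)" by simp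
      then have n: "norm (complex_of_real r powr (of_real \<sigma> + of_nat L)) = r powr (\<sigma> + real L)"
        using elim by (simp only: powr_of_real less_imp_le norm_of_real abs_of_nonneg powr_ge_zero)
      have "real L = 2 * real m + real (Suc (L - 2*m - 1))" using assms(2) by simp
      then have "r powr (\<sigma> + real L) = r powr (\<sigma> + 2 * real m) * r ^ Suc (L - 2*m - 1)"
        using powr_realpow[OF elim(2), of "Suc (L - 2*m - 1)"] by (simp only: powr_add mult.assoc)
      then have "norm (F r) \<le> C * (r powr (\<sigma> + 2 * real m) * r ^ Suc (L - 2*m - 1))"
        using elim(1) n by simp
      then show ?case using elim(2) by (simp add: field_simps)
    qed
  qed
qed

locale holographic =
  fixes X :: "'a topology" and A :: "('a, 'n::finite) chart set"
    and h hbar :: "('a, 'n) tensor2" and hs :: "nat \<Rightarrow> ('a, 'n) tensor2"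
    and v :: "nat \<Rightarrow> 'a \<Rightarrow> real"
    and P :: "nat \<Rightarrow> complex \<Rightarrow> ('a \<Rightarrow> complex) \<Rightarrow> 'a \<Rightarrow> complex"
  assumes atlas: "smooth_atlas X A"
    and metric: "riemannian_metric A h"
    and PE: "poincare_einstein A h hs hbar"
    and coeffs: "holographic_coeffs A h hs hbar v"
    and ops: "poisson_operators A hs hbar P"
begin

text \<open>The orders \<open>2k\<close> that are determined by \<open>h\<close>.\<close>

definition admissible :: "nat \<Rightarrow> bool" where
  "admissible k \<longleftrightarrow> (even CARD('n) \<longrightarrow> 2 * k \<le> CARD('n))"

text \<open>The upper indices of the partial sums for which something is known: only \<open>n div 2\<close> in even dimensions, all
  large ones in odd dimensions. Statements that hold eventually along this filter treat both parities at once.\<close>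

definition levels :: "nat filter" where
  "levels = (if even CARD('n) then principal {CARD('n) div 2} else sequentially)"

text \<open>The coefficients of \<open>sqrt (det h\<^sub>r)\<close> and of \<open>sqrt (det h\<^sub>r) h\<^sub>r\<^sup>-\<^sup>1\<close> in a chart.\<close>

definition Vc :: "('a, 'n) chart \<Rightarrow> nat \<Rightarrow> real^'n \<Rightarrow> real" where
  "Vc c k x = sqrt (det (h c x)) * v k (chart_point c x)"

definition wc :: "('a, 'n) chart \<Rightarrow> nat \<Rightarrow> real^'n \<Rightarrow> real^'n^'n" where
  "wc c k x = dual_coeff (\<lambda>j. hs j c x) (\<lambda>j. Vc c j x) k"

lemma admissible_mono: "admissible k \<Longrightarrow> j \<le> k \<Longrightarrow> admissible j"
  by (auto simp: admissible_def)

lemma admissible_1: "admissible (Suc 0)"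
proof -
  have "CARD('n) > 0" by simp
  then have "even CARD('n) \<Longrightarrow> CARD('n) \<ge> 2" by (metis One_nat_def Suc_leI even_plus_one_iff le_neq_implies_less numeral_2_eq_2 odd_one)
  then show ?thesis by (simp add: admissible_def)
qed

lemma levels_nontrivial: "levels \<noteq> bot"
  by (auto simp: levels_def principal_eq_bot_iff)

lemma eventually_levels:
  assumes "admissible m"
  shows "\<forall>\<^sub>F K in levels. m \<le> K \<and> (\<forall>j\<le>K. admissible j)"
proof (cases "even CARD('n)")
  case True
  then show ?thesis using assms by (auto simp: levels_def eventually_principal admissible_def)
next
  case False
  then show ?thesis
    using eventually_ge_at_top[of m] by (auto simp: levels_def admissible_def elim: eventually_mono)
qed

lemma chart_facts:
  assumes "c \<in> A"
  shows "open (chart_image c)" "openin X (fst c)"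
    "\<And>p. p \<in> fst c \<Longrightarrow> snd c p \<in> chart_image c" "\<And>p. p \<in> fst c \<Longrightarrow> chart_point c (snd c p) = p"
    "\<And>x. x \<in> chart_image c \<Longrightarrow> chart_point c x \<in> fst c" "\<And>x. x \<in> chart_image c \<Longrightarrow> snd c (chart_point c x) = x"
    "homeomorphic_map (subtopology X (fst c)) (top_of_set (chart_image c)) (snd c)"
    "fst c \<subseteq> topspace X"
proof -
  show "open (chart_image c)" and op: "openin X (fst c)"
    and hom: "homeomorphic_map (subtopology X (fst c)) (top_of_set (chart_image c)) (snd c)"
    using atlas assms by (auto simp: smooth_atlas_def)
  show sub: "fst c \<subseteq> topspace X" using op by (rule openin_subset)
  have inj: "inj_on (snd c) (fst c)"
    using homeomorphic_imp_injective_map[OF hom] sub by (simp add: inf_absorb2)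
  show "snd c p \<in> chart_image c" if "p \<in> fst c" for p using that by (simp add: chart_image_def)
  show "chart_point c (snd c p) = p" if "p \<in> fst c" for p
    unfolding chart_point_def by (rule inv_into_f_f[OF inj that])
  show "chart_point c x \<in> fst c" if "x \<in> chart_image c" for x
    using that unfolding chart_point_def chart_image_def by (rule inv_into_into)
  show "snd c (chart_point c x) = x" if "x \<in> chart_image c" for x
    using that unfolding chart_point_def chart_image_def by (rule f_inv_into_f)
qed

lemma hs_0: "hs 0 = h"
  using PE by (simp add: poincare_einstein_def Let_def)

lemma smooth_hs: "c \<in> A \<Longrightarrow> admissible j \<Longrightarrow> smooth_on (chart_image c) (hs j c)"
  using PE by (auto simp: poincare_einstein_def Let_def admissible_def sym_tensor_def split: if_splits)

lemma transpose_hs: "c \<in> A \<Longrightarrow> admissible j \<Longrightarrow> x \<in> chart_image c \<Longrightarrow> transpose (hs j c x) = hs j c x"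
  using PE by (auto simp: poincare_einstein_def Let_def admissible_def sym_tensor_def split: if_splits)

lemma smooth_hbar: "c \<in> A \<Longrightarrow> even CARD('n) \<Longrightarrow> smooth_on (chart_image c) (hbar c)"
  using PE by (auto simp: poincare_einstein_def Let_def sym_tensor_def)

lemma transpose_hbar: "c \<in> A \<Longrightarrow> even CARD('n) \<Longrightarrow> x \<in> chart_image c \<Longrightarrow> transpose (hbar c x) = hbar c x"
  using PE by (auto simp: poincare_einstein_def Let_def sym_tensor_def)

lemma det_h_pos: "c \<in> A \<Longrightarrow> x \<in> chart_image c \<Longrightarrow> det (h c x) > 0"
  using metric by (intro pos_def_det_pos) (auto simp: riemannian_metric_def)

lemma smooth_h: "c \<in> A \<Longrightarrow> smooth_on (chart_image c) (h c)"
  using metric by (simp add: riemannian_metric_def sym_tensor_def)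

lemma smooth_v: "admissible k \<Longrightarrow> smooth_fun A (v k)"
  using coeffs by (auto simp: holographic_coeffs_def Let_def admissible_def split: if_splits)

lemma smooth_Vc:
  assumes "c \<in> A" "admissible k"
  shows "smooth_on (chart_image c) (Vc c k)"
proof -
  have "smooth_on (chart_image c) (\<lambda>x. v k (chart_point c x))"
    using smooth_v[OF assms(2)] assms(1) by (simp add: smooth_fun_def comp_def)
  then show ?thesis
    unfolding Vc_def[abs_def] using chart_facts(1)[OF assms(1)] det_h_pos[OF assms(1)] smooth_h[OF assms(1)]
    by (intro smooth_on_mult smooth_on_sqrt smooth_on_det) auto
qed

lemma smooth_wc:
  assumes "c \<in> A" "admissible k"
  shows "smooth_on (chart_image c) (wc c k)"
  unfolding wc_def[abs_def]
  by (rule smooth_dual_coeff)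
     (use assms chart_facts(1) det_h_pos hs_0 smooth_hs smooth_Vc admissible_mono in auto)

lemma smooth_fg_family_joint:
  assumes c: "c \<in> A" and K: "\<forall>j\<le>K. admissible j"
  shows "smooth_on {y. y $ None > 0 \<and> base_part y \<in> chart_image c} (\<lambda>y. fg_family hs hbar K c (y $ None) (base_part y))"
    (is "smooth_on ?C _")
proof -
  have op: "open ?C" by (rule open_cylinder[OF chart_facts(1)[OF c]])
  have \<rho>: "smooth_on ?C (\<lambda>y. y $ None)"
    by (rule smooth_on_linear[OF op bounded_linear_vec_nth smooth_on_ident[OF op]])
  have bp: "smooth_on ?C base_part"
    by (rule smooth_on_linear[OF op bounded_linear_base_part smooth_on_ident[OF op]])
  have 1: "smooth_on ?C (\<lambda>y. hs j c (base_part y))" if "j \<le> K" for j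
    by (rule smooth_on_compose[OF op bp _ smooth_hs[OF c]]) (use K that in auto)
  have 2: "smooth_on ?C (\<lambda>y. hbar c (base_part y))" if "even CARD('n)"
    by (rule smooth_on_compose[OF op bp _ smooth_hbar[OF c that]]) auto
  have s: "smooth_on ?C (\<lambda>y. \<Sum>j\<le>K. (y $ None) ^ (2*j) *\<^sub>R hs j c (base_part y))"
    by (intro smooth_on_sum smooth_on_scaleR smooth_on_power op \<rho> 1) simp
  show ?thesis
  proof (cases "even CARD('n)")
    case True
    have "smooth_on ?C (\<lambda>y. (\<Sum>j\<le>K. (y $ None) ^ (2*j) *\<^sub>R hs j c (base_part y))
       + ((y $ None) ^ CARD('n) * ln (y $ None)) *\<^sub>R hbar c (base_part y))"
      by (intro smooth_on_add s smooth_on_scaleR smooth_on_mult smooth_on_power smooth_on_ln op \<rho> 2 True) auto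
    then show ?thesis using True by (simp add: fg_family_def)
  next
    case False
    then show ?thesis using s by (simp add: fg_family_def)
  qed
qed

lemma smooth_fg_family:
  assumes "c \<in> A" "\<forall>j\<le>K. admissible j"
  shows "smooth_on (chart_image c) (fg_family hs hbar K c r)"
proof -
  have s: "smooth_on (chart_image c) (\<lambda>x. \<Sum>j\<le>K. r ^ (2*j) *\<^sub>R hs j c x)"
    using assms chart_facts(1)[OF assms(1)] by (intro smooth_on_sum smooth_on_scaleR smooth_on_const smooth_hs) auto
  moreover have "smooth_on (chart_image c) (\<lambda>x. if even CARD('n) then (r ^ CARD('n) * ln r) *\<^sub>R hbar c x else 0)"
    using chart_facts(1)[OF assms(1)] smooth_hbar[OF assms(1)]
    by (cases "even CARD('n)") (auto intro!: smooth_on_scaleR smooth_on_const)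
  ultimately show ?thesis
    unfolding fg_family_def[abs_def] by (intro smooth_on_add chart_facts(1)[OF assms(1)])
qed

lemma transpose_fg_family:
  assumes "c \<in> A" "\<forall>j\<le>K. admissible j" "x \<in> chart_image c"
  shows "transpose (fg_family hs hbar K c r x) = fg_family hs hbar K c r x"
proof -
  have L: "linear (transpose :: real^'n^'n \<Rightarrow> real^'n^'n)" by (rule bounded_linear.linear[OF bounded_linear_transpose])
  show ?thesis using assms
    by (simp add: fg_family_def linear_add[OF L] linear_sum[OF L] linear_scale[OF L] transpose_hs transpose_hbar linear_0[OF L])
qed

lemma jet_expands_fg_family:
  assumes c: "c \<in> A" "x \<in> chart_image c" and K: "m \<le> K" "\<forall>j\<le>K. admissible j" and m: "admissible (Suc m)"
  shows "jet_expands m (fg_family hs hbar K c) (\<lambda>k. hs k c) x"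
  unfolding jet_expands_def
proof (intro conjI allI impI)
  have dh: "hs j c differentiable (at x)" if "j \<le> K" for j
    using smooth_on_differentiable[OF smooth_hs c(2)] c(1) K(2) that by blast
  have db: "hbar c differentiable (at x)" if "even CARD('n)"
    using smooth_on_differentiable[OF smooth_hbar c(2)] c(1) that by blast
  show "hs k c differentiable (at x)" if "k \<le> m" for k using dh that K by auto
  show "\<forall>\<^sub>F r in at_right 0. fg_family hs hbar K c r differentiable (at x)"
    using smooth_on_differentiable[OF smooth_fg_family[OF c(1) K(2)] c(2)] by simp
  have e: "expands m (\<lambda>r. (\<Sum>j\<le>K. r ^ (2*j) *\<^sub>R a j) + (if even CARD('n) then (r ^ CARD('n) * ln r) *\<^sub>R b else 0)) a"
    for a :: "nat \<Rightarrow> real^'n^'n" and b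
  proof -
    have "expands m (\<lambda>r. if even CARD('n) then (r ^ CARD('n) * ln r) *\<^sub>R b else 0) (\<lambda>k. 0)"
    proof (cases "even CARD('n)")
      case True
      then have "2 * m < CARD('n)" using m by (simp add: admissible_def)
      from expands_linear[OF bounded_linear_scaleR_left expands_log_term[OF this], of b] True
      show ?thesis by simp
    qed (simp add: expands_zero)
    from expands_add[OF expands_finite_sum[OF K(1)] this] show ?thesis by simp
  qed
  show "expands m (\<lambda>r. fg_family hs hbar K c r x) (\<lambda>k. hs k c x)"
    unfolding fg_family_def by (rule e)
  have pd: "pd i (fg_family hs hbar K c r) x =
      (\<Sum>j\<le>K. r ^ (2*j) *\<^sub>R pd i (hs j c) x) + (if even CARD('n) then (r ^ CARD('n) * ln r) *\<^sub>R pd i (hbar c) x else 0)" for i r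
  proof -
    have "pd i (fg_family hs hbar K c r) x = pd i (\<lambda>x. \<Sum>j\<le>K. r ^ (2*j) *\<^sub>R hs j c x) x
       + pd i (\<lambda>x. if even CARD('n) then (r ^ CARD('n) * ln r) *\<^sub>R hbar c x else 0) x"
      unfolding fg_family_def[abs_def]
    proof (intro pd_add differentiable_sum ballI)
      show "(\<lambda>x. if even CARD('n) then (r ^ CARD('n) * ln r) *\<^sub>R hbar c x else 0) differentiable (at x)"
        using db by (cases "even CARD('n)") (auto intro!: differentiable_linear[OF bounded_linear_scaleR_right])
    qed (use dh in \<open>auto intro!: differentiable_linear[OF bounded_linear_scaleR_right]\<close>)
    moreover have "pd i (\<lambda>x. \<Sum>j\<le>K. r ^ (2*j) *\<^sub>R hs j c x) x = (\<Sum>j\<le>K. r ^ (2*j) *\<^sub>R pd i (hs j c) x)"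
      using dh by (subst pd_sum)
        (auto intro!: sum.cong differentiable_linear[OF bounded_linear_scaleR_right] pd_linear[OF bounded_linear_scaleR_right])
    moreover have "pd i (\<lambda>x. if even CARD('n) then (r ^ CARD('n) * ln r) *\<^sub>R hbar c x else 0) x
       = (if even CARD('n) then (r ^ CARD('n) * ln r) *\<^sub>R pd i (hbar c) x else 0)"
      using db by (auto intro!: pd_linear[OF bounded_linear_scaleR_right])
    ultimately show ?thesis by simp
  qed
  show "expands m (\<lambda>r. pd i (fg_family hs hbar K c r) x) (\<lambda>k. pd i (hs k c) x)" for i
    unfolding pd by (rule e)
qed

lemma expands_volume:
  assumes c: "c \<in> A" "x \<in> chart_image c" and m: "admissible m"
  shows "\<forall>\<^sub>F K in levels. expands m (\<lambda>r. sqrt (det (fg_family hs hbar K c r x))) (\<lambda>k. Vc c k x)"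
proof -
  let ?q = "\<lambda>K r. sqrt (det (fg_family hs hbar K c r x)) / sqrt (det (h c x))"
  let ?R = "\<lambda>K r. ?q K r - (\<Sum>j\<le>K. v j (chart_point c x) * r ^ (2*j))"
  have "expands m (\<lambda>r. sqrt (det (fg_family hs hbar K c r x))) (\<lambda>k. Vc c k x)"
    if K: "m \<le> K" and R: "((\<lambda>r. ?R K r /\<^sub>R r ^ (2*m)) \<longlongrightarrow> 0) (at_right 0)" for K
  proof -
    have "expands m (?q K) (\<lambda>k. v k (chart_point c x))"
      using expands_remainder[OF expands_finite_sum[OF K] R, of "\<lambda>k. v k (chart_point c x)"] by (simp add: mult.commute)
    from expands_linear[OF bounded_linear_mult_right this, of "sqrt (det (h c x))"] det_h_pos[OF c]
    show ?thesis by (simp add: Vc_def)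
  qed
  note * = this
  show ?thesis
  proof (cases "even CARD('n)")
    case True
    let ?K = "CARD('n) div 2"
    have "?R ?K \<in> o[at_right 0](\<lambda>r. r ^ CARD('n))"
      using coeffs c True by (auto simp: holographic_coeffs_def Let_def)
    then have "((\<lambda>r. ?R ?K r / r ^ CARD('n)) \<longlongrightarrow> 0) (at_right 0)"
      by (rule smalloD_tendsto)
    then have "expands ?K (\<lambda>r. sqrt (det (fg_family hs hbar ?K c r x))) (\<lambda>k. Vc c k x)"
    proof -
      assume a: "((\<lambda>r. ?R ?K r / r ^ CARD('n)) \<longlongrightarrow> 0) (at_right 0)"
      have "expands ?K (?q ?K) (\<lambda>k. v k (chart_point c x))"
        using expands_remainder[OF expands_finite_sum[of ?K ?K "\<lambda>k. v k (chart_point c x)"], of "?R ?K"] a True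
        by (simp add: mult.commute divide_inverse)
      from expands_linear[OF bounded_linear_mult_right this, of "sqrt (det (h c x))"] det_h_pos[OF c]
      show ?thesis by (simp add: Vc_def)
    qed
    then have "expands m (\<lambda>r. sqrt (det (fg_family hs hbar ?K c r x))) (\<lambda>k. Vc c k x)"
      by (rule expands_le) (use m True in \<open>auto simp: admissible_def\<close>)
    then show ?thesis using True by (simp add: levels_def eventually_principal)
  next
    case False
    have "\<forall>\<^sub>F K in sequentially. ?R K \<in> O[at_right 0](\<lambda>r. r ^ (2*m+1))"
      using coeffs c False unfolding holographic_coeffs_def Let_def by meson
    then have "\<forall>\<^sub>F K in sequentially. expands m (\<lambda>r. sqrt (det (fg_family hs hbar K c r x))) (\<lambda>k. Vc c k x)"
      using eventually_ge_at_top[of m]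
    proof eventually_elim
      case (elim K)
      obtain C where C: "\<forall>\<^sub>F r in at_right 0. norm (?R K r) \<le> C * norm (r ^ (2*m+1))"
        using elim(1) unfolding bigo_def by auto
      have "((\<lambda>r::real. C * r ^ Suc 0) \<longlongrightarrow> C * 0) (at_right 0)"
        by (intro tendsto_mult tendsto_const tendsto_power_zero)
      then have lim: "((\<lambda>r::real. C * r) \<longlongrightarrow> 0) (at_right 0)" by simp
      have "((\<lambda>r. ?R K r /\<^sub>R r ^ (2*m)) \<longlongrightarrow> 0) (at_right 0)"
      proof (rule Lim_null_comparison[OF _ lim])
        show "\<forall>\<^sub>F r in at_right 0. norm (?R K r /\<^sub>R r ^ (2*m)) \<le> C * r"
          using C eventually_pos
        proof eventually_elim
          case (elim r)
          then show ?case by (simp add: field_simps abs_mult)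
        qed
      qed
      then show ?case by (rule *[OF elim(2)])
    qed
    then show ?thesis using False by (simp add: levels_def)
  qed
qed

lemma good_level:
  assumes c: "c \<in> A" "x \<in> chart_image c" and m: "admissible (Suc m)"
  shows "\<forall>\<^sub>F K in levels. Suc m \<le> K \<and> (\<forall>j\<le>K. admissible j) \<and>
    expands (Suc m) (\<lambda>r. sqrt (det (fg_family hs hbar K c r x))) (\<lambda>k. Vc c k x) \<and>
    jet_expands m (fg_family hs hbar K c) (\<lambda>k. hs k c) x"
  using expands_volume[OF c m] eventually_levels[OF m]
  by eventually_elim (use jet_expands_fg_family[OF c _ _ m] in auto)

text \<open>As \<open>h\<^sub>r\<close> tends to \<open>h\<close>, the coefficient \<open>v 0\<close> is \<open>1\<close>.\<close>

lemma Vc_0: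
  assumes c: "c \<in> A" "x \<in> chart_image c"
  shows "Vc c 0 x = sqrt (det (h c x))"
proof -
  obtain K where K: "expands (Suc 0) (\<lambda>r. sqrt (det (fg_family hs hbar K c r x))) (\<lambda>k. Vc c k x)"
    "jet_expands 0 (fg_family hs hbar K c) (\<lambda>k. hs k c) x"
    using eventually_happens'[OF levels_nontrivial good_level[OF c admissible_1]] by blast
  have "((\<lambda>r. fg_family hs hbar K c r x) \<longlongrightarrow> h c x) (at_right 0)"
    using expands_limit[of 0 "\<lambda>r. fg_family hs hbar K c r x" "\<lambda>k. hs k c x"] K(2) by (simp add: jet_expands_def hs_0)
  then have "((\<lambda>r. sqrt (det (fg_family hs hbar K c r x))) \<longlongrightarrow> sqrt (det (h c x))) (at_right 0)"
    unfolding det_def by (intro tendsto_intros)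
  then show ?thesis using tendsto_unique[OF _ expands_limit[OF K(1)]] by simp
qed

lemma Vc_0_pos: "c \<in> A \<Longrightarrow> x \<in> chart_image c \<Longrightarrow> Vc c 0 x > 0"
  by (simp add: Vc_0 det_h_pos)

lemma jet_expands_dual:
  assumes c: "c \<in> A" "x \<in> chart_image c" and m: "admissible (Suc m)" and K: "\<forall>j\<le>K. admissible j"
    "expands (Suc m) (\<lambda>r. sqrt (det (fg_family hs hbar K c r x))) (\<lambda>k. Vc c k x)"
    "jet_expands m (fg_family hs hbar K c) (\<lambda>k. hs k c) x"
  shows "jet_expands m (dual_density (fg_family hs hbar K c)) (wc c) x"
    and "\<forall>\<^sub>F r in at_right 0. det (fg_family hs hbar K c r x) > 0"
proof -
  have e: "expands m (\<lambda>r. sqrt (det (fg_family hs hbar K c r x))) (\<lambda>k. Vc c k x)"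
    by (rule expands_le[OF K(2)]) simp
  have ex: "\<exists>H. jet_expands m H (\<lambda>k. hs k c) z \<and> expands m (\<lambda>r. sqrt (det (H r z))) (\<lambda>k. Vc c k z)"
    if z: "z \<in> chart_image c" for z
  proof -
    obtain K where K: "expands (Suc m) (\<lambda>r. sqrt (det (fg_family hs hbar K c r z))) (\<lambda>k. Vc c k z)"
      "jet_expands m (fg_family hs hbar K c) (\<lambda>k. hs k c) z"
      using eventually_happens'[OF levels_nontrivial good_level[OF c(1) z m]] by blast
    then show ?thesis using expands_le[OF K(1), of m] by (intro exI[of _ "fg_family hs hbar K c"]) simp
  qed
  have "wc c = (\<lambda>k x. dual_coeff (\<lambda>j. hs j c x) (\<lambda>j. Vc c j x) k)"
    by (simp add: fun_eq_iff wc_def)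
  moreover have "jet_expands m (dual_density (fg_family hs hbar K c)) (\<lambda>k x. dual_coeff (\<lambda>j. hs j c x) (\<lambda>j. Vc c j x) k) x"
    by (rule jet_expands_dual_density[where S="chart_image c"])
       (use c m K e ex chart_facts(1) det_h_pos hs_0 smooth_hs smooth_Vc Vc_0_pos smooth_fg_family admissible_mono[OF m] in auto)
  ultimately show "jet_expands m (dual_density (fg_family hs hbar K c)) (wc c) x" by simp
  show "\<forall>\<^sub>F r in at_right 0. det (fg_family hs hbar K c r x) > 0"
    using order_tendstoD(1)[OF expands_limit[OF K(2)] Vc_0_pos[OF c]] by simp
qed

text \<open>Symmetry of the matrices \<open>W\<^sub>r\<close> passes to their coefficients, by uniqueness.\<close>

lemma transpose_wc:
  assumes c: "c \<in> A" "x \<in> chart_image c" and m: "admissible (Suc m)"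
  shows "transpose (wc c m x) = wc c m x"
proof -
  obtain K where K: "\<forall>j\<le>K. admissible j"
    "expands (Suc m) (\<lambda>r. sqrt (det (fg_family hs hbar K c r x))) (\<lambda>k. Vc c k x)"
    "jet_expands m (fg_family hs hbar K c) (\<lambda>k. hs k c) x"
    using eventually_happens'[OF levels_nontrivial good_level[OF c m]] by blast
  let ?W = "\<lambda>r. dual_density (fg_family hs hbar K c) r x"
  have W: "expands m ?W (\<lambda>k. wc c k x)"
    using jet_expands_dual(1)[OF c m K] by (simp add: jet_expands_def)
  have "expands m ?W (\<lambda>k. transpose (wc c k x))"
  proof (rule expands_cong[THEN iffD1, OF _ _ expands_linear[OF bounded_linear_transpose W]])
    show "\<forall>\<^sub>F r in at_right 0. transpose (?W r) = ?W r"
      using jet_expands_dual(2)[OF c m K]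
    proof eventually_elim
      case (elim r)
      then have "transpose (matrix_inv (fg_family hs hbar K c r x)) = matrix_inv (fg_family hs hbar K c r x)"
        by (intro transpose_matrix_inv transpose_fg_family c K) simp
      then show ?case
        by (simp add: dual_density_def linear_scale[OF bounded_linear.linear[OF bounded_linear_transpose]])
    qed
  qed simp
  from expands_unique[OF this W, of m] show ?thesis by simp
qed

definition T :: "nat \<Rightarrow> complex \<Rightarrow> ('a \<Rightarrow> complex) \<Rightarrow> 'a \<Rightarrow> complex" where
  "T = T_op CARD('n) P"

lemma union_charts: "(\<Union>c\<in>A. fst c) = topspace X"
  using atlas by (simp add: smooth_atlas_def)

lemma P_coeffs:
  assumes "admissible j"
  shows "\<exists>d C. (\<forall>k f. smooth_fun A f \<longrightarrow> smooth_fun A (C k f)) \<and>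
                (\<forall>s f. smooth_fun A f \<longrightarrow>
                   (\<forall>p \<in> topspace X. P j s f p = (\<Sum>k\<le>(d::nat). s ^ k * C k f p)))"
  using ops assms unfolding poisson_operators_def Let_def admissible_def union_charts[symmetric] by blast

lemma smooth_fun_cong:
  assumes "\<And>p. p \<in> topspace X \<Longrightarrow> f p = g p" "smooth_fun A g"
  shows "smooth_fun A f"
  unfolding smooth_fun_def
proof
  fix c assume c: "c \<in> A"
  show "smooth_on (chart_image c) (f \<circ> chart_point c)"
  proof (rule smooth_on_cong[OF chart_facts(1)[OF c]])
    show "smooth_on (chart_image c) (g \<circ> chart_point c)" using assms(2) c by (simp add: smooth_fun_def)
    show "(f \<circ> chart_point c) z = (g \<circ> chart_point c) z" if "z \<in> chart_image c" for z
      using assms(1) chart_facts(5,8)[OF c] that by auto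
  qed
qed

lemma smooth_fun_sum:
  assumes "\<And>j. j \<in> I \<Longrightarrow> smooth_fun A (f j)"
  shows "smooth_fun A (\<lambda>p. \<Sum>j\<in>I. f j p)"
  using assms chart_facts(1) by (auto simp: smooth_fun_def comp_def intro!: smooth_on_sum)

lemma smooth_fun_linear:
  assumes "bounded_linear L" "smooth_fun A f"
  shows "smooth_fun A (\<lambda>p. L (f p))"
  unfolding smooth_fun_def comp_def
proof
  fix c assume c: "c \<in> A"
  have "smooth_on (chart_image c) (\<lambda>x. f (chart_point c x))"
    using assms(2) c by (simp add: smooth_fun_def comp_def)
  then show "smooth_on (chart_image c) (\<lambda>x. L (f (chart_point c x)))"
    by (rule smooth_on_linear[OF chart_facts(1)[OF c] assms(1)])
qed

lemma smooth_fun_mult: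
  assumes "smooth_fun A f" "smooth_fun A g"
  shows "smooth_fun A (\<lambda>p. f p * g p :: complex)"
  using assms chart_facts(1) by (auto simp: smooth_fun_def comp_def intro!: smooth_on_mult)

lemma smooth_fun_diff:
  assumes "smooth_fun A f" "smooth_fun A g"
  shows "smooth_fun A (\<lambda>p. f p - g p)"
  using assms chart_facts(1) by (auto simp: smooth_fun_def comp_def intro!: smooth_on_diff)

lemma smooth_fun_const: "smooth_fun A (\<lambda>p. c)"
  by (auto simp: smooth_fun_def comp_def smooth_on_const)

lemma smooth_P:
  assumes "smooth_fun A f" "admissible j"
  shows "smooth_fun A (P j s f)"
proof -
  obtain d C where "\<forall>k f. smooth_fun A f \<longrightarrow> smooth_fun A (C k f)"
    "\<forall>s f. smooth_fun A f \<longrightarrow> (\<forall>p \<in> topspace X. P j s f p = (\<Sum>k\<le>(d::nat). s ^ k * C k f p))"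
    using P_coeffs[OF assms(2)] by (elim exE conjE)
  note C = this[rule_format]
  show ?thesis
    by (rule smooth_fun_cong[OF C(2)[OF assms(1)]])
       (auto intro!: smooth_fun_sum smooth_fun_linear[OF bounded_linear_mult_right] C(1) assms)
qed

lemma smooth_T:
  assumes "smooth_fun A f" "admissible j"
  shows "smooth_fun A (T j s f)"
  unfolding T_def T_op_def[abs_def] divide_inverse
  by (rule smooth_fun_linear[OF bounded_linear_mult_left smooth_P[OF assms]])

lemma T_0:
  assumes "smooth_fun A f" "p \<in> topspace X"
  shows "T 0 s f p = f p"
proof -
  have "P 0 s f p = f p"
    using ops assms unfolding poisson_operators_def Let_def union_charts by blast
  then show ?thesis by (simp add: T_def T_op_def)
qed

lemma eigen_limit:
  assumes c: "c \<in> A" "x \<in> chart_image c" and f: "smooth_fun A f" and \<sigma>: "\<sigma> \<ge> real CARD('n) + 1"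
    and m: "admissible m"
  shows "\<forall>\<^sub>F K in levels. ((\<lambda>r. eigen_defect hs hbar P K c (of_real \<sigma>) f x r /\<^sub>R r powr (\<sigma> + 2 * real m)) \<longlongrightarrow> 0) (at_right 0)"
proof -
  have ns: "of_real \<sigma> \<noteq> (of_nat CARD('n) / 2 - of_nat i :: complex)" for i
  proof
    assume "of_real \<sigma> = (of_nat CARD('n) / 2 - of_nat i :: complex)"
    then have "\<sigma> = real CARD('n) / 2 - real i" by (auto dest: arg_cong[of _ _ Re])
    then show False using \<sigma> by simp
  qed
  then have *: "if even CARD('n) then eigen_defect hs hbar P (CARD('n) div 2) c (of_real \<sigma>) f x
                   \<in> O[at_right 0](\<lambda>r. complex_of_real r powr (of_real \<sigma> + of_nat CARD('n) + 1))
               else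
                 (\<forall>L::nat. \<forall>\<^sub>F K in sequentially.
                    eigen_defect hs hbar P K c (of_real \<sigma>) f x
                      \<in> O[at_right 0](\<lambda>r. complex_of_real r powr (of_real \<sigma> + of_nat L)))"
    using ns by (intro ops[unfolded poisson_operators_def Let_def, THEN conjunct2, THEN conjunct2, rule_format, OF _ f c])
  show ?thesis
  proof (cases "even CARD('n)")
    case True
    have "of_real \<sigma> + of_nat CARD('n) + 1 = (of_real \<sigma> + of_nat (Suc CARD('n)) :: complex)" by simp
    then have "eigen_defect hs hbar P (CARD('n) div 2) c (of_real \<sigma>) f x
        \<in> O[at_right 0](\<lambda>r. complex_of_real r powr (of_real \<sigma> + of_nat (Suc CARD('n))))"
      using * True by (simp only: if_True)
    from bigo_radial_limit[OF this, of m] m True show ?thesis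
      by (simp add: levels_def eventually_principal admissible_def)
  next
    case False
    \<comment> \<open>The error order \<open>2m + 1\<close> is one more than the order of the coefficient that is extracted.\<close>
    then have "\<forall>\<^sub>F K in sequentially. eigen_defect hs hbar P K c (of_real \<sigma>) f x
                      \<in> O[at_right 0](\<lambda>r. complex_of_real r powr (of_real \<sigma> + of_nat (2*m+1)))"
      using * by meson
    then show ?thesis using False bigo_radial_limit[of _ \<sigma> "2*m+1" m]
      by (auto simp: levels_def elim!: eventually_mono)
  qed
qed

text \<open>Real parameters from \<open>n + 1\<close> on suffice: they are never exceptional, all powers of \<open>r\<close> are real, and
  \<open>\<sigma> - n \<ge> 1\<close> as the integration of the radial equation requires.\<close>

lemma solution_recursion_real:
  assumes c: "c \<in> A" "x \<in> chart_image c" and f: "smooth_fun A f" and \<sigma>: "\<sigma> \<ge> real CARD('n) + 1"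
    and m: "admissible (Suc m)"
  shows "(\<Sum>j\<le>Suc m. ((\<sigma> + 2 * real j) * (\<sigma> + 2 * real (Suc m) - real CARD('n)) + \<sigma> * (real CARD('n) - \<sigma>)) *\<^sub>R
        (Vc c (Suc m - j) x *\<^sub>R T j (of_real \<sigma>) f (chart_point c x)))
     + (\<Sum>j\<le>m. div_form (wc c (m - j)) (T j (of_real \<sigma>) f \<circ> chart_point c) x) = 0"
proof -
  have "\<forall>\<^sub>F K in levels. (Suc m \<le> K \<and> (\<forall>j\<le>K. admissible j) \<and>
    expands (Suc m) (\<lambda>r. sqrt (det (fg_family hs hbar K c r x))) (\<lambda>k. Vc c k x) \<and>
    jet_expands m (fg_family hs hbar K c) (\<lambda>k. hs k c) x) \<and>
    ((\<lambda>r. eigen_defect hs hbar P K c (of_real \<sigma>) f x r /\<^sub>R r powr (\<sigma> + 2 * real (Suc m))) \<longlongrightarrow> 0) (at_right 0)"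
    by (intro eventually_conj good_level[OF c m] eigen_limit[OF c f \<sigma> m])
  from eventually_happens'[OF levels_nontrivial this]
  obtain K where K: "Suc m \<le> K" "\<forall>j\<le>K. admissible j"
    "expands (Suc m) (\<lambda>r. sqrt (det (fg_family hs hbar K c r x))) (\<lambda>k. Vc c k x)"
    "jet_expands m (fg_family hs hbar K c) (\<lambda>k. hs k c) x"
    "((\<lambda>r. eigen_defect hs hbar P K c (of_real \<sigma>) f x r /\<^sub>R r powr (\<sigma> + 2 * real (Suc m))) \<longlongrightarrow> 0) (at_right 0)"
    by blast
  let ?u = "poisson_sum P c K (of_real \<sigma>) f"
  have u: "?u y = (\<Sum>j\<le>K. (y $ None) powr (\<sigma> + 2 * real j) *\<^sub>R (T j (of_real \<sigma>) f \<circ> chart_point c) (base_part y))"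
    if "y $ None > 0" for y
  proof -
    have "complex_of_real (y $ None) powr (of_real \<sigma> + 2 * of_nat j) = of_real ((y $ None) powr (\<sigma> + 2 * real j))" for j
    proof -
      have "of_real \<sigma> + 2 * of_nat j = (of_real (\<sigma> + 2 * real j) :: complex)" by simp
      then show ?thesis using that by (simp only: powr_of_real less_imp_le)
    qed
    then show ?thesis by (simp add: poisson_sum_def scaleR_conv_of_real T_def)
  qed
  have "\<And>j. j \<le> K \<Longrightarrow> smooth_on (chart_image c) (T j (of_real \<sigma>) f \<circ> chart_point c)"
    using smooth_T[OF f] K(2) c(1) by (simp add: smooth_fun_def)
  note sm = this
  have E: "((\<lambda>r. (laplacian (g_plus (fg_family hs hbar K c)) ?u (join x r)
      + (\<sigma> * (real CARD('n) - \<sigma>)) *\<^sub>R ?u (join x r)) /\<^sub>R r powr (\<sigma> + 2 * real (Suc m))) \<longlongrightarrow> 0) (at_right 0)"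
    using K(5) by (simp add: eigen_defect_def scaleR_conv_of_real)
  show ?thesis
    using radial_recursion[where s=\<sigma> and \<phi>="\<lambda>j. T j (of_real \<sigma>) f \<circ> chart_point c" and u="?u"
        and H="fg_family hs hbar K c" and V="\<lambda>k. Vc c k x" and w="wc c" and m'=m and K=K and S="chart_image c" and x=x,
        OF chart_facts(1)[OF c(1)] c(2) \<sigma> smooth_fg_family_joint[OF c(1) K(2)] sm
        jet_expands_dual(1)[OF c m K(2-4)] K(3) jet_expands_dual(2)[OF c m K(2-4)] K(1) u E]
    by simp
qed

end

section \<open>Integration by parts in coordinates\<close>

lemma integrable_compact_support:
  fixes F :: "real^'m::finite \<Rightarrow> 'b::{banach, second_countable_topology}"
  assumes "continuous_on UNIV F" "compact K" "\<And>x. x \<notin> K \<Longrightarrow> F x = 0"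
  shows "integrable lborel F"
proof -
  have "integrable lborel (\<lambda>x. indicator K x *\<^sub>R F x)"
    using borel_integrable_compact[OF assms(2), of F] continuous_on_subset[OF assms(1)] by simp
  moreover have "(\<lambda>x. indicator K x *\<^sub>R F x) = F" using assms(3) by (auto simp: fun_eq_iff indicator_def)
  ultimately show ?thesis by simp
qed

lemma pd_outside_support:
  fixes F :: "real^'m::finite \<Rightarrow> 'b::real_normed_vector"
  assumes "closed K" "\<And>x. x \<notin> K \<Longrightarrow> F x = 0" "x \<notin> K"
  shows "pd i F x = 0"
  using pd_cong[of "- K" x F "\<lambda>_. 0"] assms by (simp add: open_Compl)

lemma integral_translate:
  fixes F :: "'m::euclidean_space \<Rightarrow> 'b::{banach, second_countable_topology}"
  assumes "F \<in> borel_measurable borel"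
  shows "(LINT x|lborel. F (a + x)) = (LINT x|lborel. F x)"
proof -
  have "(LINT x|lborel. F x) = (LINT x|distr lborel borel ((+) a). F x)" by (simp add: lborel_distr_plus)
  also have "\<dots> = (LINT x|lborel. F (a + x))"
    by (rule integral_distr) (use assms in auto)
  finally show ?thesis by simp
qed

text \<open>The integral of a partial derivative is the derivative of the integrals of the translates, which
  are constant.\<close>

lemma integral_pd_eq_0:
  fixes F :: "real^'m::finite \<Rightarrow> complex"
  assumes dF: "\<And>x. F differentiable (at x)" and cont: "continuous_on UNIV (pd i F)"
    and K: "compact K" "\<And>x. x \<notin> K \<Longrightarrow> F x = 0"
  shows "(LINT x|lborel. pd i F x) = 0" "integrable lborel (pd i F)"
proof -
  define e where "e = (axis i 1 :: real^'m)"
  have ne: "norm e = 1" by (simp add: e_def)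
  have cF: "continuous_on UNIV F"
    by (meson continuous_at_imp_continuous_on dF differentiable_imp_continuous_within)
  have pd0: "pd i F x = 0" if "x \<notin> K" for x
    by (rule pd_outside_support[OF compact_imp_closed[OF K(1)] K(2) that])
  show "integrable lborel (pd i F)" by (rule integrable_compact_support[OF cont K(1) pd0])
  have "compact (pd i F ` K)" using continuous_on_subset[OF cont] K(1) by (intro compact_continuous_image) auto
  then obtain B where B': "\<And>x. x \<in> K \<Longrightarrow> norm (pd i F x) \<le> B"
    using compact_imp_bounded[of "pd i F ` K"] by (auto simp: bounded_iff)
  have B: "norm (pd i F x) \<le> max B 0" for x
    using pd0[of x] B'[of x] by (cases "x \<in> K") (auto simp: le_max_iff_disj)
  obtain R where R: "\<And>x. x \<in> K \<Longrightarrow> norm x \<le> R" using compact_imp_bounded[OF K(1)] by (auto simp: bounded_iff)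
  have der: "((\<lambda>t. F (x + t *\<^sub>R e)) has_vector_derivative pd i F (x + t *\<^sub>R e)) (at t)" for x t
  proof -
    obtain F' where F': "(F has_derivative F') (at (x + t *\<^sub>R e))" using dF by (auto simp: differentiable_def)
    have "((\<lambda>t. x + t *\<^sub>R e) has_derivative (\<lambda>h. h *\<^sub>R e)) (at t)" by (auto intro!: derivative_eq_intros)
    from has_derivative_compose[OF this F']
    show ?thesis using pd_at[OF F', of i]
      by (simp add: has_vector_derivative_def e_def linear_scale[OF has_derivative_linear[OF F']])
  qed
  have lip: "norm (F (x + t *\<^sub>R e) - F x) \<le> max B 0 * t" if "t \<ge> 0" for x t
  proof -
    have "norm (F (x + t *\<^sub>R e) - F (x + 0 *\<^sub>R e)) \<le> max B 0 * norm (t - 0)"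
    proof (rule differentiable_bound[where S="{0..t}" and f="\<lambda>t. F (x + t *\<^sub>R e)" and f'="\<lambda>s h. h *\<^sub>R pd i F (x + s *\<^sub>R e)"])
      show "((\<lambda>t. F (x + t *\<^sub>R e)) has_derivative (\<lambda>h. h *\<^sub>R pd i F (x + s *\<^sub>R e))) (at s within {0..t})" for s
        using der[of x s] by (simp add: has_vector_derivative_def has_derivative_at_withinI)
      show "onorm (\<lambda>h. h *\<^sub>R pd i F (x + s *\<^sub>R e)) \<le> max B 0" for s
        using B[of "x + s *\<^sub>R e"] by (intro onorm_le) (simp add: mult.commute[of "max B 0"] mult_left_mono)
    qed (use that in auto)
    then show ?thesis using that by simp
  qed
  define t where "t k = inverse (real (Suc k))" for k
  have t: "t k > 0" "t k \<le> 1" for k by (auto simp: t_def inverse_eq_divide)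
  define G where "G k x = (F (t k *\<^sub>R e + x) - F x) /\<^sub>R t k" for k x
  have intF: "integrable lborel F" by (rule integrable_compact_support[OF cF K])
  have mF: "F \<in> borel_measurable borel" using cF by (simp add: borel_measurable_continuous_onI)
  have cFt: "continuous_on UNIV (\<lambda>x. F (a + x))" for a
    by (rule continuous_on_compose2[OF cF]) (auto intro!: continuous_intros)
  have intFt: "integrable lborel (\<lambda>x. F (a + x))" for a
  proof (rule integrable_compact_support[OF cFt])
    show "compact ((+) (- a) ` K)" using K(1) by (rule compact_translation)
    show "F (a + x) = 0" if "x \<notin> (+) (- a) ` K" for x
    proof (rule K(2))
      show "a + x \<notin> K"
      proof
        assume "a + x \<in> K"
        then have "- a + (a + x) \<in> (+) (- a) ` K" by blast
        then show False using that by simp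
      qed
    qed
  qed
  have G0: "(LINT x|lborel. G k x) = 0" for k
    unfolding G_def using intF intFt[of "t k *\<^sub>R e"] integral_translate[OF mF, of "t k *\<^sub>R e"] by simp
  have "(\<lambda>k. LINT x|lborel. G k x) \<longlonglongrightarrow> (LINT x|lborel. pd i F x)"
  proof (rule integral_dominated_convergence[where w="\<lambda>x. max B 0 * indicator (cball 0 (R + 1)) x"])
    show "pd i F \<in> borel_measurable lborel" using cont by (simp add: borel_measurable_continuous_onI)
    show "G k \<in> borel_measurable lborel" for k
    proof -
      have "continuous_on UNIV (G k)" unfolding G_def by (intro continuous_intros cFt cF)
      then show ?thesis by (simp add: borel_measurable_continuous_onI)
    qed
    show "integrable lborel (\<lambda>x. max B 0 * indicator (cball 0 (R + 1)) x :: real)"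
      by (intro integrable_mult_right integrable_real_indicator)
         (use emeasure_bounded_finite[OF bounded_cball, of 0 "R + 1"] in auto)
    show "AE x in lborel. (\<lambda>k. G k x) \<longlonglongrightarrow> pd i F x"
    proof (rule AE_I2)
      fix x
      have lim: "((\<lambda>s. norm (F (x + s *\<^sub>R e) - F x - s *\<^sub>R pd i F x) / norm s) \<longlongrightarrow> 0) (at 0)"
        using der[of x 0] by (simp add: has_vector_derivative_def has_derivative_at)
      have "((\<lambda>s. norm ((F (x + s *\<^sub>R e) - F x) /\<^sub>R s - pd i F x)) \<longlongrightarrow> 0) (at 0)"
      proof (rule Lim_transform_eventually[OF lim])
        show "\<forall>\<^sub>F s in at 0. norm (F (x + s *\<^sub>R e) - F x - s *\<^sub>R pd i F x) / norm s = norm ((F (x + s *\<^sub>R e) - F x) /\<^sub>R s - pd i F x)"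
        proof (rule eventually_mono[OF eventually_neq_at_within[of 0]])
          fix s :: real assume "s \<noteq> 0"
          then have "(F (x + s *\<^sub>R e) - F x) /\<^sub>R s - pd i F x = (F (x + s *\<^sub>R e) - F x - s *\<^sub>R pd i F x) /\<^sub>R s"
            by (simp add: scaleR_diff_right)
          then show "norm (F (x + s *\<^sub>R e) - F x - s *\<^sub>R pd i F x) / norm s = norm ((F (x + s *\<^sub>R e) - F x) /\<^sub>R s - pd i F x)"
            by (simp only: norm_scaleR) (simp add: divide_inverse mult.commute)
        qed
      qed
      then have 1: "((\<lambda>s. (F (x + s *\<^sub>R e) - F x) /\<^sub>R s) \<longlongrightarrow> pd i F x) (at 0)"
        by (simp add: tendsto_norm_zero_iff LIM_zero_iff)
      have 2: "filterlim t (at 0) sequentially"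
        unfolding filterlim_at t_def using LIMSEQ_inverse_real_of_nat by auto
      show "(\<lambda>k. G k x) \<longlonglongrightarrow> pd i F x"
        using filterlim_compose[OF 1 2] by (simp add: G_def add.commute)
    qed
    show "AE x in lborel. norm (G k x) \<le> max B 0 * indicator (cball 0 (R + 1)) x" for k
    proof (rule AE_I2)
      fix x
      have *: "norm (G k x) \<le> max B 0"
      proof -
        have "norm (F (x + t k *\<^sub>R e) - F x) / t k \<le> max B 0"
          using lip[of "t k" x] t[of k] by (simp add: pos_divide_le_eq)
        then show ?thesis using t(1)[of k] by (simp add: G_def add.commute divide_inverse mult.commute)
      qed
      have "G k x = 0" if "norm x > R + 1"
      proof -
        have "norm (t k *\<^sub>R e + x) \<ge> norm x - 1"
          using norm_triangle_ineq2[of x "- (t k *\<^sub>R e)"] t[of k] ne by (simp add: add.commute)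
        then have "t k *\<^sub>R e + x \<notin> K" "x \<notin> K" using R that by fastforce+
        then show ?thesis using K(2) by (simp add: G_def)
      qed
      then show "norm (G k x) \<le> max B 0 * indicator (cball 0 (R + 1)) x"
        using * by (cases "norm x > R + 1") (auto simp: indicator_def)
    qed
  qed
  then show "(LINT x|lborel. pd i F x) = 0" using G0 by (simp add: LIMSEQ_const_iff)
qed

text \<open>The domains \<open>S\<close> and \<open>- K\<close> cover the space, and the extension is smooth on each.\<close>

lemma smooth_extend_zero:
  fixes F :: "real^'m::finite \<Rightarrow> 'b::real_normed_vector"
  assumes "open S" "smooth_on S F" "compact K" "K \<subseteq> S" "\<And>x. x \<in> S - K \<Longrightarrow> F x = 0"
  shows "smooth_on UNIV (\<lambda>x. if x \<in> S then F x else 0)"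
proof -
  have "smooth_on S (\<lambda>x. if x \<in> S then F x else 0)"
    by (rule smooth_on_cong[OF assms(1) _ assms(2)]) simp
  moreover have "smooth_on (- K) (\<lambda>x. if x \<in> S then F x else 0)"
    by (rule smooth_on_cong[OF _ _ smooth_on_const[of _ 0]])
       (use assms compact_imp_closed in \<open>auto intro: open_Compl\<close>)
  moreover have "S \<union> - K = UNIV" using assms(4) by auto
  ultimately show ?thesis using smooth_on_Un by metis
qed

lemma integral_pd_on_eq_0:
  fixes F :: "real^'m::finite \<Rightarrow> complex"
  assumes "open S" "smooth_on S F" "compact K" "K \<subseteq> S" "\<And>x. x \<in> S - K \<Longrightarrow> F x = 0"
  shows "(LINT x|lborel. indicator S x *\<^sub>R pd i F x) = 0"
    "integrable lborel (\<lambda>x. indicator S x *\<^sub>R pd i F x)"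
proof -
  let ?F = "\<lambda>x. if x \<in> S then F x else 0"
  have sm: "smooth_on UNIV ?F" by (rule smooth_extend_zero[OF assms])
  have d: "?F differentiable (at x)" for x by (rule smooth_on_differentiable[OF sm]) simp
  have c: "continuous_on UNIV (pd i ?F)" by (rule smooth_on_continuous_on[OF smooth_on_pd[OF sm]])
  have 0: "?F x = 0" if "x \<notin> K" for x using assms(4,5) that by auto
  have eq: "indicator S x *\<^sub>R pd i F x = pd i ?F x" for x
  proof (cases "x \<in> S")
    case True
    then show ?thesis using pd_cong[OF assms(1) True, of ?F F i] by simp
  next
    case False
    then have "x \<notin> K" using assms(4) by auto
    have "pd i ?F x = 0"
      by (rule pd_outside_support[OF compact_imp_closed[OF assms(3)] 0 \<open>x \<notin> K\<close>])
    then show ?thesis using False by simp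
  qed
  show "(LINT x|lborel. indicator S x *\<^sub>R pd i F x) = 0"
    "integrable lborel (\<lambda>x. indicator S x *\<^sub>R pd i F x)"
    unfolding eq using integral_pd_eq_0[OF d c assms(3) 0] by simp_all
qed

text \<open>The integrand is the divergence of \<open>w (\<psi> grad \<phi> - \<phi> grad \<psi>)\<close>: the products of two gradients cancel because
  \<open>w\<close> is symmetric.\<close>

lemma green_div_form:
  fixes w :: "real^'n::finite \<Rightarrow> real^'n^'n"
  assumes S: "open S" and w: "smooth_on S w" "\<And>x. x \<in> S \<Longrightarrow> transpose (w x) = w x"
    and \<phi>: "smooth_on S \<phi>" and \<psi>: "smooth_on S \<psi>"
    and K: "compact K" "K \<subseteq> S" "\<And>x. x \<in> S - K \<Longrightarrow> \<phi> x = 0"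
  shows "(LINT x|lborel. indicator S x *\<^sub>R (\<psi> x * div_form w \<phi> x - \<phi> x * div_form w \<psi> x)) = 0"
    "integrable lborel (\<lambda>x. indicator S x *\<^sub>R (\<psi> x * div_form w \<phi> x - \<phi> x * div_form w \<psi> x))"
proof -
  define F where "F i x = (\<Sum>j\<in>UNIV. (w x $ i $ j) *\<^sub>R (\<psi> x * pd j \<phi> x - \<phi> x * pd j \<psi> x))" for i x
  have we: "smooth_on S (\<lambda>x. w x $ i $ j)" for i j by (rule smooth_on_entry[OF S w(1)])
  have smF: "smooth_on S (F i)" for i
    unfolding F_def by (intro smooth_on_sum smooth_on_scaleR smooth_on_diff smooth_on_mult S we \<phi> \<psi> smooth_on_pd)
  have pd\<phi>: "pd j \<phi> x = 0" if "x \<in> S - K" for j x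
  proof -
    have "open (S - K)" using S K(1) by (simp add: open_Diff compact_imp_closed)
    from pd_cong[OF this that, of \<phi> "\<lambda>_. 0"] K(3) show ?thesis by simp
  qed
  have F0: "F i x = 0" if "x \<in> S - K" for i x
    using K(3)[OF that] pd\<phi>[OF that] by (simp add: F_def)
  have key: "(\<Sum>i\<in>UNIV. pd i (F i) x) = \<psi> x * div_form w \<phi> x - \<phi> x * div_form w \<psi> x" if x: "x \<in> S" for x
  proof -
    note d = smooth_on_differentiable[OF _ x]
    have d1: "(\<lambda>x. w x $ i $ j *\<^sub>R pd j \<phi> x) differentiable (at x)" "(\<lambda>x. w x $ i $ j *\<^sub>R pd j \<psi> x) differentiable (at x)" for i j
      by (intro d smooth_on_scaleR S we smooth_on_pd \<phi> \<psi>)+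
    have pdF: "pd i (F i) x = (\<Sum>j\<in>UNIV. (\<psi> x * pd i (\<lambda>x. w x $ i $ j *\<^sub>R pd j \<phi> x) x + pd i \<psi> x * (w x $ i $ j *\<^sub>R pd j \<phi> x))
        - (\<phi> x * pd i (\<lambda>x. w x $ i $ j *\<^sub>R pd j \<psi> x) x + pd i \<phi> x * (w x $ i $ j *\<^sub>R pd j \<psi> x)))" for i
    proof -
      have "F i = (\<lambda>x. \<Sum>j\<in>UNIV. \<psi> x * (w x $ i $ j *\<^sub>R pd j \<phi> x) - \<phi> x * (w x $ i $ j *\<^sub>R pd j \<psi> x))"
        by (simp add: F_def fun_eq_iff scaleR_diff_right)
      moreover have "pd i (\<lambda>x. \<Sum>j\<in>UNIV. \<psi> x * (w x $ i $ j *\<^sub>R pd j \<phi> x) - \<phi> x * (w x $ i $ j *\<^sub>R pd j \<psi> x)) x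
         = (\<Sum>j\<in>UNIV. pd i (\<lambda>x. \<psi> x * (w x $ i $ j *\<^sub>R pd j \<phi> x) - \<phi> x * (w x $ i $ j *\<^sub>R pd j \<psi> x)) x)"
        by (rule pd_sum) (intro differentiable_diff differentiable_mult d[OF \<phi>] d[OF \<psi>] d1)
      ultimately have "pd i (F i) x = (\<Sum>j\<in>UNIV. pd i (\<lambda>x. \<psi> x * (w x $ i $ j *\<^sub>R pd j \<phi> x) - \<phi> x * (w x $ i $ j *\<^sub>R pd j \<psi> x)) x)"
        by simp
      also have "\<dots> = (\<Sum>j\<in>UNIV. pd i (\<lambda>x. \<psi> x * (w x $ i $ j *\<^sub>R pd j \<phi> x)) x - pd i (\<lambda>x. \<phi> x * (w x $ i $ j *\<^sub>R pd j \<psi> x)) x)"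
      proof (intro sum.cong refl)
        fix j
        have "pd i (\<lambda>x. \<psi> x * (w x $ i $ j *\<^sub>R pd j \<phi> x) + - (\<phi> x * (w x $ i $ j *\<^sub>R pd j \<psi> x))) x
          = pd i (\<lambda>x. \<psi> x * (w x $ i $ j *\<^sub>R pd j \<phi> x)) x + pd i (\<lambda>x. - (\<phi> x * (w x $ i $ j *\<^sub>R pd j \<psi> x))) x"
          by (intro pd_add differentiable_mult differentiable_minus d[OF \<phi>] d[OF \<psi>] d1)
        moreover have "pd i (\<lambda>x. - (\<phi> x * (w x $ i $ j *\<^sub>R pd j \<psi> x))) x = - pd i (\<lambda>x. \<phi> x * (w x $ i $ j *\<^sub>R pd j \<psi> x)) x"
          by (intro pd_linear[OF bounded_linear_minus[OF bounded_linear_ident]] differentiable_mult d[OF \<phi>] d1)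
        ultimately show "pd i (\<lambda>x. \<psi> x * (w x $ i $ j *\<^sub>R pd j \<phi> x) - \<phi> x * (w x $ i $ j *\<^sub>R pd j \<psi> x)) x
          = pd i (\<lambda>x. \<psi> x * (w x $ i $ j *\<^sub>R pd j \<phi> x)) x - pd i (\<lambda>x. \<phi> x * (w x $ i $ j *\<^sub>R pd j \<psi> x)) x" by simp
      qed
      also have "\<dots> = (\<Sum>j\<in>UNIV. (\<psi> x * pd i (\<lambda>x. w x $ i $ j *\<^sub>R pd j \<phi> x) x + pd i \<psi> x * (w x $ i $ j *\<^sub>R pd j \<phi> x))
        - (\<phi> x * pd i (\<lambda>x. w x $ i $ j *\<^sub>R pd j \<psi> x) x + pd i \<phi> x * (w x $ i $ j *\<^sub>R pd j \<psi> x)))"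
        by (simp only: pd_bilinear[OF bounded_bilinear_mult d[OF \<phi>] d1(2)] pd_bilinear[OF bounded_bilinear_mult d[OF \<psi>] d1(1)])
      finally show ?thesis .
    qed
    have "(\<Sum>i\<in>UNIV. pd i (F i) x) = \<psi> x * div_form w \<phi> x - \<phi> x * div_form w \<psi> x
       + ((\<Sum>i\<in>UNIV. \<Sum>j\<in>UNIV. pd i \<psi> x * (w x $ i $ j *\<^sub>R pd j \<phi> x)) - (\<Sum>i\<in>UNIV. \<Sum>j\<in>UNIV. pd i \<phi> x * (w x $ i $ j *\<^sub>R pd j \<psi> x)))"
      by (simp add: pdF div_form_def sum.distrib sum_subtractf sum_distrib_left)
    moreover have "(\<Sum>i\<in>UNIV. \<Sum>j\<in>UNIV. pd i \<psi> x * (w x $ i $ j *\<^sub>R pd j \<phi> x)) = (\<Sum>i\<in>UNIV. \<Sum>j\<in>UNIV. pd i \<phi> x * (w x $ i $ j *\<^sub>R pd j \<psi> x))"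
    proof -
      have sym: "w x $ i $ j = w x $ j $ i" for i j
        using arg_cong[OF w(2)[OF x], of "\<lambda>M. M $ j $ i"] by (simp add: transpose_def)
      show ?thesis
        by (subst sum.swap) (intro sum.cong refl, subst sym, simp add: mult_ac)
    qed
    ultimately show ?thesis by simp
  qed
  have eq: "indicator S x *\<^sub>R (\<psi> x * div_form w \<phi> x - \<phi> x * div_form w \<psi> x) = (\<Sum>i\<in>UNIV. indicator S x *\<^sub>R pd i (F i) x)" for x
    using key[of x] by (cases "x \<in> S") auto
  note int = integral_pd_on_eq_0[OF S smF K(1,2) F0]
  have "(LINT x|lborel. (\<Sum>i\<in>UNIV. indicator S x *\<^sub>R pd i (F i) x)) = (\<Sum>i\<in>UNIV. (LINT x|lborel. indicator S x *\<^sub>R pd i (F i) x))"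
    by (rule Bochner_Integration.integral_sum) (rule int(2))
  then show "(LINT x|lborel. indicator S x *\<^sub>R (\<psi> x * div_form w \<phi> x - \<phi> x * div_form w \<psi> x)) = 0"
    unfolding eq by (simp only: int(1) sum.neutral_const)
  show "integrable lborel (\<lambda>x. indicator S x *\<^sub>R (\<psi> x * div_form w \<phi> x - \<phi> x * div_form w \<psi> x))"
    unfolding eq by (rule Bochner_Integration.integrable_sum) (rule int(2))
qed

section \<open>Bump functions\<close>

text \<open>All derivatives of \<open>exp (- 1 / t)\<close>, extended by \<open>0\<close> to \<open>t \<le> 0\<close>, have the form
  \<open>p (1 / t) exp (- 1 / t)\<close> with a polynomial \<open>p\<close>.\<close>

definition flat_fun :: "real poly \<Rightarrow> real \<Rightarrow> real" where
  "flat_fun p t = (if t > 0 then poly p (1 / t) * exp (- (1 / t)) else 0)"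

lemma poly_div_exp_tendsto_0: "((\<lambda>u::real. poly p u * exp (- u)) \<longlongrightarrow> 0) at_top"
proof -
  have "((\<lambda>u::real. \<Sum>k\<le>degree p. coeff p k * (u ^ k / exp u)) \<longlongrightarrow> (\<Sum>k\<le>degree p. coeff p k * 0)) at_top"
    by (intro tendsto_sum tendsto_mult tendsto_const tendsto_power_div_exp_0)
  then show ?thesis by (simp add: poly_altdef exp_minus field_simps sum_distrib_left)
qed

lemma flat_fun_derivative:
  "(flat_fun p has_real_derivative flat_fun (monom 1 2 * (p - pderiv p)) t) (at t)"
proof (cases t "0::real" rule: linorder_cases)
  case less
  have "((\<lambda>t. 0) has_real_derivative flat_fun (monom 1 2 * (p - pderiv p)) t) (at t)"
    using less by (simp add: flat_fun_def)
  then show ?thesis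
    by (rule has_field_derivative_transform_within_open[of _ _ _ "{..<0}"]) (use less in \<open>auto simp: flat_fun_def\<close>)
next
  case greater
  have "((\<lambda>t. poly p (1 / t) * exp (- (1 / t))) has_real_derivative
      poly p (1 / t) * (exp (- (1 / t)) * (1 / t\<^sup>2)) + poly (pderiv p) (1 / t) * (- (1 / t\<^sup>2)) * exp (- (1 / t))) (at t)"
    using greater by (auto intro!: derivative_eq_intros DERIV_chain'[OF _ poly_DERIV] simp: power2_eq_square)
  moreover have "poly p (1 / t) * (exp (- (1 / t)) * (1 / t\<^sup>2)) + poly (pderiv p) (1 / t) * (- (1 / t\<^sup>2)) * exp (- (1 / t))
      = flat_fun (monom 1 2 * (p - pderiv p)) t"
    using greater by (simp add: flat_fun_def poly_monom algebra_simps power_one_over)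
  ultimately have "((\<lambda>t. poly p (1 / t) * exp (- (1 / t))) has_real_derivative flat_fun (monom 1 2 * (p - pderiv p)) t) (at t)"
    by simp
  then show ?thesis
    by (rule has_field_derivative_transform_within_open[of _ _ _ "{0<..}"]) (use greater in \<open>auto simp: flat_fun_def\<close>)
next
  case equal
  have "((\<lambda>h. flat_fun p h / h) \<longlongrightarrow> 0) (at_right 0)"
  proof -
    have "((\<lambda>h. poly (pCons 0 p) (inverse h) * exp (- inverse h)) \<longlongrightarrow> 0) (at_right (0::real))"
      by (rule filterlim_compose[OF poly_div_exp_tendsto_0 filterlim_inverse_at_top_right])
    then show ?thesis
      by (rule Lim_transform_eventually)
         (use eventually_pos in \<open>eventually_elim, simp add: flat_fun_def inverse_eq_divide\<close>)
  qed
  moreover have "((\<lambda>h. flat_fun p h / h) \<longlongrightarrow> 0) (at_left 0)"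
    by (rule tendsto_eventually) (auto simp: eventually_at_filter flat_fun_def)
  ultimately have "((\<lambda>h. flat_fun p h / h) \<longlongrightarrow> 0) (at 0)"
    by (simp add: filterlim_at_split)
  then show ?thesis using equal by (simp add: has_field_derivative_iff flat_fun_def)
qed

lemma smooth_bump:
  fixes x0 :: "real^'m::finite"
  assumes "\<epsilon> > 0"
  obtains b :: "real^'m \<Rightarrow> real" where "smooth_on UNIV b" "\<And>x. b x \<ge> 0" "b x0 > 0"
    "\<And>x. dist x x0 \<ge> \<epsilon> \<Longrightarrow> b x = 0"
proof
  let ?b = "\<lambda>x. flat_fun 1 (\<epsilon>\<^sup>2 - (x - x0) \<bullet> (x - x0))"
  show "smooth_on UNIV ?b"
  proof (rule smooth_on_real_compose[where \<G>="range flat_fun" and g="flat_fun 1" and F="\<lambda>x. \<epsilon>\<^sup>2 - (x - x0) \<bullet> (x - x0)"])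
    show "smooth_on UNIV (\<lambda>x. \<epsilon>\<^sup>2 - (x - x0) \<bullet> (x - x0))"
      by (intro smooth_on_diff smooth_on_bilinear[OF _ bounded_bilinear_inner] smooth_on_const smooth_on_ident) auto
    show "\<exists>g'\<in>range flat_fun. \<forall>x\<in>UNIV. (g has_real_derivative g' (\<epsilon>\<^sup>2 - (x - x0) \<bullet> (x - x0))) (at (\<epsilon>\<^sup>2 - (x - x0) \<bullet> (x - x0)))"
      if "g \<in> range flat_fun" for g
      using that flat_fun_derivative by blast
  qed auto
  show "?b x \<ge> 0" for x by (simp add: flat_fun_def)
  show "?b x0 > 0" using assms by (simp add: flat_fun_def)
  show "?b x = 0" if "dist x x0 \<ge> \<epsilon>" for x
  proof -
    have "(x - x0) \<bullet> (x - x0) = (dist x x0)\<^sup>2" by (simp add: dist_norm power2_norm_eq_inner)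
    then have "(x - x0) \<bullet> (x - x0) \<ge> \<epsilon>\<^sup>2" using that assms by (simp add: power_mono)
    then show ?thesis by (simp add: flat_fun_def)
  qed
qed

lemma continuous_integral_0_imp_0:
  fixes Q :: "real^'m::finite \<Rightarrow> real"
  assumes "continuous_on UNIV Q" "compact K" "\<And>x. x \<notin> K \<Longrightarrow> Q x = 0" "\<And>x. Q x \<ge> 0" "(LINT x|lborel. Q x) = 0"
  shows "Q x = 0"
proof (rule ccontr)
  assume "Q x \<noteq> 0"
  have "AE x in lborel. Q x = 0"
    using integral_nonneg_eq_0_iff_AE[OF integrable_compact_support[OF assms(1-3)]] assms(4,5) by simp
  then have "AE x in lebesgue. Q x = 0" by (rule AE_completion)
  then obtain N where "N \<in> null_sets lebesgue" "{x. Q x \<noteq> 0} \<subseteq> N" by (auto simp: eventually_ae_filter)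
  then have "negligible {x. Q x \<noteq> 0}" using negligible_iff_null_sets negligible_subset by blast
  moreover have "open {x. Q x \<noteq> 0}" using assms(1) by (intro open_Collect_neq) auto
  ultimately show False using open_not_negligible[of "{x. Q x \<noteq> 0}"] \<open>Q x \<noteq> 0\<close> by auto
qed

section \<open>Functions supported in a chart\<close>

context holographic
begin

lemma chart_point_continuous:
  assumes c: "c \<in> A"
  shows "continuous_map (top_of_set (chart_image c)) (subtopology X (fst c)) (chart_point c)"
proof -
  obtain g where g: "homeomorphic_maps (subtopology X (fst c)) (top_of_set (chart_image c)) (snd c) g"
    using chart_facts(7)[OF c] homeomorphic_map_maps by blast
  then have cg: "continuous_map (top_of_set (chart_image c)) (subtopology X (fst c)) g"
    and inv: "\<And>y. y \<in> chart_image c \<Longrightarrow> snd c (g y) = y"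
    by (auto simp: homeomorphic_maps_def)
  show ?thesis
  proof (rule continuous_map_eq[OF cg])
    fix y assume "y \<in> topspace (top_of_set (chart_image c))"
    then have y: "y \<in> chart_image c" by simp
    then have "g y \<in> fst c" using continuous_map_image_subset_topspace[OF cg] by auto
    then show "g y = chart_point c y" using chart_facts(4)[OF c, of "g y"] inv[OF y] by simp
  qed
qed

lemma open_chart_image:
  assumes c: "c \<in> A" and U: "openin X U" "U \<subseteq> fst c"
  shows "open (snd c ` U)"
proof -
  have "open_map (subtopology X (fst c)) (top_of_set (chart_image c)) (snd c)"
    using homeomorphic_imp_open_map[OF chart_facts(7)[OF c]] .
  moreover have "openin (subtopology X (fst c)) U" using U by (auto simp: openin_subtopology)
  ultimately have "openin (top_of_set (chart_image c)) (snd c ` U)" by (simp add: open_map_def)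
  then show ?thesis using openin_open_eq[OF chart_facts(1)[OF c]] by blast
qed

lemma compactin_chart_point:
  assumes c: "c \<in> A" and K: "compact K" "K \<subseteq> chart_image c"
  shows "compactin X (chart_point c ` K)" "closedin X (chart_point c ` K)" "chart_point c ` K \<subseteq> fst c"
proof -
  have "compactin (top_of_set (chart_image c)) K" using K by (simp add: compactin_subtopology)
  from image_compactin[OF this chart_point_continuous[OF c]]
  show "compactin X (chart_point c ` K)" by (simp add: compactin_subtopology)
  then show "closedin X (chart_point c ` K)"
    using atlas by (intro compactin_imp_closedin) (auto simp: smooth_atlas_def)
  show "chart_point c ` K \<subseteq> fst c" using chart_facts(5)[OF c] K by auto
qed

definition chart_extend :: "('a, 'n) chart \<Rightarrow> (real^'n \<Rightarrow> complex) \<Rightarrow> 'a \<Rightarrow> complex" where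
  "chart_extend c \<phi> p = (if p \<in> fst c then \<phi> (snd c p) else 0)"

lemma smooth_chart_extend:
  assumes c: "c \<in> A" and \<phi>: "smooth_on (chart_image c) \<phi>"
    and K: "compact K" "K \<subseteq> chart_image c" "\<And>x. x \<in> chart_image c - K \<Longrightarrow> \<phi> x = 0"
  shows "smooth_fun A (chart_extend c \<phi>)"
    and "\<And>p. p \<in> topspace X - chart_point c ` K \<Longrightarrow> chart_extend c \<phi> p = 0"
proof -
  note KM = compactin_chart_point[OF c K(1,2)]
  show 0: "chart_extend c \<phi> p = 0" if "p \<in> topspace X - chart_point c ` K" for p
  proof (cases "p \<in> fst c")
    case True
    then have "snd c p \<notin> K" using that chart_facts(4)[OF c True] by force
    then show ?thesis using K(3)[of "snd c p"] chart_facts(3)[OF c True] by (simp add: chart_extend_def)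
  qed (simp add: chart_extend_def)
  show "smooth_fun A (chart_extend c \<phi>)"
    unfolding smooth_fun_def
  proof
    fix d assume d: "d \<in> A"
    let ?S1 = "snd d ` (fst d \<inter> fst c)" and ?S2 = "snd d ` (fst d - chart_point c ` K)"
    have o1: "open ?S1" using chart_facts(2)[OF c] chart_facts(2)[OF d] by (intro open_chart_image[OF d]) auto
    have o2: "open ?S2" using chart_facts(2)[OF d] KM(2) by (intro open_chart_image[OF d] openin_diff) auto
    have "smooth_on ?S1 (chart_extend c \<phi> \<circ> chart_point d)"
    proof (rule smooth_on_cong[OF o1])
      show "smooth_on ?S1 (\<lambda>y. \<phi> ((snd c \<circ> chart_point d) y))"
      proof (rule smooth_on_compose[OF o1 _ _ \<phi>])
        show "smooth_on ?S1 (snd c \<circ> chart_point d)" using atlas c d by (simp add: smooth_atlas_def)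
        show "(snd c \<circ> chart_point d) ` ?S1 \<subseteq> chart_image c"
          using chart_facts(4)[OF d] chart_facts(3)[OF c] by auto
      qed
      show "(chart_extend c \<phi> \<circ> chart_point d) y = \<phi> ((snd c \<circ> chart_point d) y)" if "y \<in> ?S1" for y
        using that chart_facts(4)[OF d] by (auto simp: chart_extend_def)
    qed
    moreover have "smooth_on ?S2 (chart_extend c \<phi> \<circ> chart_point d)"
    proof (rule smooth_on_cong[OF o2 _ smooth_on_const[of _ 0]])
      show "(chart_extend c \<phi> \<circ> chart_point d) y = 0" if "y \<in> ?S2" for y
        using that chart_facts(4,8)[OF d] by (auto intro!: 0)
    qed
    moreover have "chart_image d = ?S1 \<union> ?S2"
    proof -
      have "fst d = (fst d \<inter> fst c) \<union> (fst d - chart_point c ` K)" using KM(3) by auto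
      then show ?thesis unfolding chart_image_def by (metis image_Un)
    qed
    ultimately show "smooth_on (chart_image d) (chart_extend c \<phi> \<circ> chart_point d)" using smooth_on_Un by metis
  qed
qed

text \<open>The factor that the radial part of the eigenvalue equation of order \<open>k\<close> attaches to \<open>T j s f\<close>. It vanishes for
  \<open>j = k\<close> at \<open>s = n / 2 - k\<close>, the pole of \<open>T k s\<close>.\<close>

definition alpha :: "complex \<Rightarrow> nat \<Rightarrow> nat \<Rightarrow> complex" where
  "alpha s j k = (s + 2 * of_nat j) * (s + 2 * of_nat k - of_nat CARD('n)) + s * (of_nat CARD('n) - s)"

lemma alpha_diag: "alpha s k k = 2 * of_nat k * (2 * s + 2 * of_nat k - of_nat CARD('n))"
  by (simp add: alpha_def algebra_simps)

lemma alpha_diag_nonzero: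
  assumes "\<sigma> \<ge> real CARD('n) + 1" "k > 0"
  shows "alpha (of_real \<sigma>) k k \<noteq> 0"
proof -
  have "2 * \<sigma> + 2 * real k - real CARD('n) > 0" using assms by simp
  then have "(of_real (2 * real k * (2 * \<sigma> + 2 * real k - real CARD('n))) :: complex) \<noteq> 0" using assms(2)
    by (simp only: of_real_eq_0_iff) simp
  then show ?thesis by (simp add: alpha_diag)
qed

lemma solution_recursion:
  assumes c: "c \<in> A" "x \<in> chart_image c" and f: "smooth_fun A f" and \<sigma>: "\<sigma> \<ge> real CARD('n) + 1"
    and k: "admissible k"
  shows "(\<Sum>j\<le>k. alpha (of_real \<sigma>) j k * (of_real (Vc c (k - j) x) * T j (of_real \<sigma>) f (chart_point c x)))
     + (\<Sum>j<k. div_form (wc c (k - 1 - j)) (T j (of_real \<sigma>) f \<circ> chart_point c) x) = 0"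
proof (cases k)
  case 0
  then show ?thesis by (simp add: alpha_diag)
next
  case (Suc m)
  show ?thesis
    using solution_recursion_real[OF c f \<sigma> k[unfolded Suc]]
    unfolding Suc by (simp add: alpha_def scaleR_conv_of_real lessThan_Suc_atMost del: sum.atMost_Suc sum.lessThan_Suc)
qed

lemma div_form_const [simp]: "div_form w (\<lambda>z. a) x = 0"
  by (simp add: div_form_def)

text \<open>The recursion expresses each solution operator through derivatives of the previous ones, so that none of them
  enlarges supports.\<close>

lemma T_local:
  assumes f: "smooth_fun A f" and \<sigma>: "\<sigma> \<ge> real CARD('n) + 1"
    and C: "closedin X C" "\<And>p. p \<in> topspace X - C \<Longrightarrow> f p = 0"
    and j: "admissible j" and p: "p \<in> topspace X - C"
  shows "T j (of_real \<sigma>) f p = 0"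
  using j p
proof (induction j arbitrary: p rule: less_induct)
  case (less j p)
  show ?case
  proof (cases "j = 0")
    case True
    then show ?thesis using T_0[OF f] C(2)[OF less.prems(2)] less.prems(2) by simp
  next
    case False
    obtain d where d: "d \<in> A" "p \<in> fst d" using less.prems(2) union_charts by blast
    define x where "x = snd d p"
    have x: "x \<in> chart_image d" "chart_point d x = p" using chart_facts(3,4)[OF d] by (simp_all add: x_def)
    let ?S = "snd d ` (fst d - C)"
    have oS: "open ?S" using chart_facts(2)[OF d(1)] C(1) by (intro open_chart_image[OF d(1)] openin_diff) auto
    have IH: "T i (of_real \<sigma>) f q = 0" if "i < j" "q \<in> topspace X - C" for i q
      using less.IH[OF that(1) _ that(2)] less.prems(1) admissible_mono that(1) by simp
    have "div_form w (T i (of_real \<sigma>) f \<circ> chart_point d) x = div_form w (\<lambda>z. 0) x" if "i < j" for i w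
    proof (rule div_form_cong[OF oS])
      show "x \<in> ?S" using d less.prems(2) by (simp add: x_def)
      show "(T i (of_real \<sigma>) f \<circ> chart_point d) z = 0" if "z \<in> ?S" for z
        using that chart_facts(4,8)[OF d(1)] IH[OF \<open>i < j\<close>] by auto
    qed
    then have "(\<Sum>i<j. div_form (wc d (j - 1 - i)) (T i (of_real \<sigma>) f \<circ> chart_point d) x) = 0" by simp
    moreover have "(\<Sum>i\<le>j. alpha (of_real \<sigma>) i j * (of_real (Vc d (j - i) x) * T i (of_real \<sigma>) f (chart_point d x)))
      = alpha (of_real \<sigma>) j j * (of_real (Vc d 0 x) * T j (of_real \<sigma>) f p)"
    proof -
      have "{..j} = insert j {..<j}" by auto
      then show ?thesis using IH[OF _ less.prems(2)] by (simp add: x(2))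
    qed
    ultimately have "alpha (of_real \<sigma>) j j * (of_real (Vc d 0 x) * T j (of_real \<sigma>) f p) = 0"
      using solution_recursion[OF d(1) x(1) f \<sigma> less.prems(1)] by simp
    then show ?thesis using alpha_diag_nonzero[OF \<sigma>, of j] False Vc_0_pos[OF d(1) x(1)] by simp
  qed
qed

definition qden :: "nat \<Rightarrow> complex \<Rightarrow> complex" where
  "qden j s = 2 ^ (2*j) * fact j * (\<Prod>i=1..j. of_nat CARD('n) / 2 - s - of_nat i)"

lemma T_qden: "T j s f p = P j s f p / qden j s"
  by (simp add: T_def T_op_def qden_def)

lemma qden_real_nonzero:
  assumes "\<sigma> \<ge> real CARD('n) + 1"
  shows "qden j (of_real \<sigma>) \<noteq> 0"
proof -
  have "of_nat CARD('n) / 2 - of_real \<sigma> - of_nat i \<noteq> (0 :: complex)" for i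
  proof -
    have "real CARD('n) / 2 - \<sigma> - real i < 0" using assms by simp
    then have "(of_real (real CARD('n) / 2 - \<sigma> - real i) :: complex) \<noteq> 0" by (simp only: of_real_eq_0_iff)
    then show ?thesis by simp
  qed
  then show ?thesis by (simp add: qden_def)
qed

text \<open>The polynomial coefficients of \<open>P j s f\<close> inherit the locality.\<close>

lemma P_coeffs_local:
  assumes j: "admissible j" and f: "smooth_fun A f"
    and C: "closedin X C" "\<And>p. p \<in> topspace X - C \<Longrightarrow> f p = 0"
  shows "\<exists>d B. (\<forall>k. smooth_fun A (B k)) \<and> (\<forall>s. \<forall>p\<in>topspace X. P j s f p = (\<Sum>k\<le>(d::nat). s ^ k * B k p))
     \<and> (\<forall>k\<le>d. \<forall>p\<in>topspace X - C. B k p = 0)"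
proof -
  obtain d B where B: "\<forall>k f. smooth_fun A f \<longrightarrow> smooth_fun A (B k f)"
    "\<forall>s f. smooth_fun A f \<longrightarrow> (\<forall>p \<in> topspace X. P j s f p = (\<Sum>k\<le>(d::nat). s ^ k * B k f p))"
    using P_coeffs[OF j] by (elim exE conjE)
  have "B k f p = 0" if p: "p \<in> topspace X - C" and k: "k \<le> d" for k p
  proof (rule ccontr)
    assume nz: "B k f p \<noteq> 0"
    have "finite {s. (\<Sum>k\<le>d. B k f p * s ^ k) = 0}" by (rule polyfun_roots_finite[of "\<lambda>k. B k f p", OF nz k])
    moreover have "of_real ` {real CARD('n) + 1..} \<subseteq> {s::complex. (\<Sum>k\<le>d. B k f p * s ^ k) = 0}"
    proof (clarsimp simp del: of_real_add)
      fix \<sigma> :: real assume \<sigma>: "real CARD('n) + 1 \<le> \<sigma>"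
      have "P j (of_real \<sigma>) f p = 0"
        using T_local[OF f \<sigma> C j p] qden_real_nonzero[OF \<sigma>, of j] by (simp add: T_qden)
      then show "(\<Sum>k\<le>d. B k f p * of_real \<sigma> ^ k) = 0"
        using B(2) f p by (simp add: mult.commute)
    qed
    ultimately have "finite (of_real ` {real CARD('n) + 1..} :: complex set)" by (rule rev_finite_subset)
    then have "finite {real CARD('n) + 1..}" by (rule finite_imageD) (simp add: inj_on_def)
    then show False by (simp add: infinite_Ici)
  qed
  then show ?thesis using B f by (intro exI[of _ d] exI[of _ "\<lambda>k. B k f"]) auto
qed

end

section \<open>Integration over a chart domain\<close>

lemma borel_measurable_restrict_lborel:
  "continuous_on S f \<Longrightarrow> f \<in> borel_measurable (restrict_space lborel S)"
  by (subst measurable_cong_sets[OF restrict_space_sets_cong[OF refl sets_lborel] refl])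
     (rule borel_measurable_continuous_on_restrict)

locale holographic_volume = holographic X A h hbar hs v P
  for X :: "'a topology" and A :: "('a, 'n::finite) chart set" and h hbar hs v P +
  fixes \<mu> :: "'a measure"
  assumes vol: "riemannian_volume X A h \<mu>"
begin

lemma space_\<mu>: "space \<mu> = topspace X" and sets_\<mu>: "sets \<mu> = sigma_sets (topspace X) {U. openin X U}"
  using vol by (auto simp: riemannian_volume_def)

lemma open_sets_\<mu>: "openin X U \<Longrightarrow> U \<in> sets \<mu>"
  by (simp add: sets_\<mu> sigma_sets.Basic)

text \<open>The values on Borel sets agree by the definition of the Riemannian volume; measurability holds because the
  coordinate map is a homeomorphism.\<close>

lemma restrict_volume:
  assumes c: "c \<in> A"
  shows "restrict_space \<mu> (fst c) =
    distr (density (restrict_space lborel (chart_image c)) (\<lambda>x. ennreal (sqrt (det (h c x)))))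
      (restrict_space \<mu> (fst c)) (chart_point c)"
    and "chart_point c \<in> measurable (restrict_space lborel (chart_image c)) (restrict_space \<mu> (fst c))"
proof -
  let ?S = "chart_image c" and ?U = "fst c"
  have U: "?U \<in> sets \<mu>" using chart_facts(2)[OF c] by (rule open_sets_\<mu>)
  have oS: "open ?S" by (rule chart_facts(1)[OF c])
  have img: "snd c ` B = chart_point c -` B \<inter> ?S" if "B \<subseteq> ?U" for B
    using that chart_facts(3,4,6)[OF c] by (auto intro!: rev_image_eqI)
  have "chart_point c \<in> measurable (restrict_space lborel ?S) \<mu>"
  proof (rule measurable_sigma_sets[OF sets_\<mu>])
    show "chart_point c \<in> space (restrict_space lborel ?S) \<rightarrow> topspace X"
      using chart_facts(5,8)[OF c] by (auto simp: space_restrict_space)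
    fix W assume "W \<in> {U. openin X U}"
    then have W: "openin X (W \<inter> ?U)" using chart_facts(2)[OF c] by auto
    have "chart_point c -` W \<inter> space (restrict_space lborel ?S) = snd c ` (W \<inter> ?U)"
      using img[of "W \<inter> ?U"] chart_facts(5)[OF c] by (auto simp: space_restrict_space)
    moreover have "open (snd c ` (W \<inter> ?U))" by (rule open_chart_image[OF c W]) auto
    moreover have "snd c ` (W \<inter> ?U) \<subseteq> ?S" using chart_facts(3)[OF c] by auto
    ultimately show "chart_point c -` W \<inter> space (restrict_space lborel ?S) \<in> sets (restrict_space lborel ?S)"
      using oS by (simp add: sets_restrict_space_iff)
  qed (auto dest: openin_subset)
  then show m: "chart_point c \<in> measurable (restrict_space lborel ?S) (restrict_space \<mu> ?U)"
    using chart_facts(5)[OF c] by (intro measurable_restrict_space2) (auto simp: space_restrict_space)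
  have "continuous_on ?S (\<lambda>x. sqrt (det (h c x)))"
    using smooth_on_continuous_on[OF smooth_on_det[OF oS smooth_h[OF c]]] by (intro continuous_intros)
  then have sq: "(\<lambda>x. sqrt (det (h c x))) \<in> borel_measurable (restrict_space lborel ?S)"
    by (rule borel_measurable_restrict_lborel)
  show "restrict_space \<mu> ?U = distr (density (restrict_space lborel ?S) (\<lambda>x. ennreal (sqrt (det (h c x)))))
      (restrict_space \<mu> ?U) (chart_point c)" (is "_ = ?R")
  proof (rule measure_eqI)
    fix B assume B: "B \<in> sets (restrict_space \<mu> ?U)"
    then have B': "B \<in> sets \<mu>" "B \<subseteq> ?U" using U by (auto simp: sets_restrict_space_iff)
    have im: "chart_point c -` B \<inter> ?S \<in> sets (restrict_space lborel ?S)"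
      using measurable_sets[OF m B] by (simp add: space_restrict_space)
    then have im': "chart_point c -` B \<inter> ?S \<in> sets lborel" using oS by (auto simp: sets_restrict_space_iff)
    have "emeasure ?R B = emeasure (density (restrict_space lborel ?S) (\<lambda>x. ennreal (sqrt (det (h c x))))) (chart_point c -` B \<inter> ?S)"
      using m B by (subst emeasure_distr) (auto simp: space_restrict_space)
    also have "\<dots> = (\<integral>\<^sup>+x. ennreal (sqrt (det (h c x))) * indicator (chart_point c -` B \<inter> ?S) x \<partial>restrict_space lborel ?S)"
      using sq im by (subst emeasure_density) auto
    also have "\<dots> = (\<integral>\<^sup>+x\<in>snd c ` B. ennreal (sqrt (det (h c x))) \<partial>lborel)"
      unfolding img[OF B'(2)] using oS
      by (subst nn_integral_restrict_space) (auto intro!: nn_integral_cong simp: indicator_def)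
    also have "\<dots> = emeasure \<mu> B" using vol c B' by (simp add: riemannian_volume_def)
    finally show "emeasure (restrict_space \<mu> ?U) B = emeasure ?R B"
      using U B' by (simp add: emeasure_restrict_space)
  qed simp
qed

lemma chart_integral:
  fixes F :: "'a \<Rightarrow> complex"
  assumes c: "c \<in> A" and F: "continuous_on (chart_image c) (F \<circ> chart_point c)"
    and 0: "\<And>p. p \<in> topspace X - fst c \<Longrightarrow> F p = 0"
  shows "(LINT p|\<mu>. F p) = (LINT x|lborel. indicator (chart_image c) x *\<^sub>R (sqrt (det (h c x)) *\<^sub>R F (chart_point c x)))"
proof -
  let ?S = "chart_image c" and ?U = "fst c"
  have U: "?U \<in> sets \<mu>" using chart_facts(2)[OF c] by (rule open_sets_\<mu>)
  have oS: "open ?S" by (rule chart_facts(1)[OF c])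
  have "continuous_on ?S (\<lambda>x. sqrt (det (h c x)))"
    using smooth_on_continuous_on[OF smooth_on_det[OF oS smooth_h[OF c]]] by (intro continuous_intros)
  then have sq: "(\<lambda>x. sqrt (det (h c x))) \<in> borel_measurable (restrict_space lborel ?S)"
    by (rule borel_measurable_restrict_lborel)
  have mF: "F \<in> borel_measurable (restrict_space \<mu> ?U)"
  proof (rule borel_measurableI)
    fix W :: "complex set" assume W: "open W"
    have cm: "continuous_map (subtopology X ?U) euclidean ((F \<circ> chart_point c) \<circ> snd c)"
      by (rule continuous_map_compose[OF homeomorphic_imp_continuous_map[OF chart_facts(7)[OF c]]])
         (use F in \<open>simp add: continuous_map_iff_continuous\<close>)
    have "openin (subtopology X ?U) {p \<in> topspace (subtopology X ?U). ((F \<circ> chart_point c) \<circ> snd c) p \<in> W}"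
      by (rule openin_continuous_map_preimage[OF cm]) (use W in simp)
    moreover have "{p \<in> topspace (subtopology X ?U). ((F \<circ> chart_point c) \<circ> snd c) p \<in> W} = F -` W \<inter> ?U"
      using chart_facts(4,8)[OF c] by auto
    ultimately have "openin X (F -` W \<inter> ?U)"
      using chart_facts(2)[OF c] openin_trans_full by metis
    then show "F -` W \<inter> space (restrict_space \<mu> ?U) \<in> sets (restrict_space \<mu> ?U)"
      using U chart_facts(8)[OF c] open_sets_\<mu>
      by (simp add: space_restrict_space sets_restrict_space_iff space_\<mu> inf_absorb1)
  qed
  have "(LINT p|\<mu>. F p) = (LINT p|\<mu>. indicator ?U p *\<^sub>R F p)"
    by (rule Bochner_Integration.integral_cong) (auto simp: space_\<mu> indicator_def 0)
  also have "\<dots> = (LINT p|restrict_space \<mu> ?U. F p)"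
    using U by (subst integral_restrict_space) auto
  also have "\<dots> = (LINT x|density (restrict_space lborel ?S) (\<lambda>x. ennreal (sqrt (det (h c x)))). F (chart_point c x))"
    by (subst restrict_volume(1)[OF c], rule integral_distr) (use restrict_volume(2)[OF c] mF in auto)
  also have "\<dots> = (LINT x|restrict_space lborel ?S. sqrt (det (h c x)) *\<^sub>R F (chart_point c x))"
  proof (rule integral_density)
    show "(\<lambda>x. F (chart_point c x)) \<in> borel_measurable (restrict_space lborel ?S)"
      by (rule measurable_compose[OF restrict_volume(2)[OF c] mF])
    show "AE x in restrict_space lborel ?S. 0 \<le> sqrt (det (h c x))"
      by (rule AE_I2) (use det_h_pos[OF c] in \<open>auto simp: space_restrict_space less_imp_le\<close>)
  qed (rule sq)
  also have "\<dots> = (LINT x|lborel. indicator ?S x *\<^sub>R (sqrt (det (h c x)) *\<^sub>R F (chart_point c x)))"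
    using oS by (subst integral_restrict_space) auto
  finally show ?thesis .
qed

text \<open>The fundamental lemma of the calculus of variations: test with a bump function times the conjugate of \<open>G\<close>.\<close>

lemma test_functions_separate:
  fixes G :: "'a \<Rightarrow> complex"
  assumes c: "c \<in> A" and G: "smooth_fun A G"
    and test: "\<And>f K. smooth_fun A f \<Longrightarrow> compact K \<Longrightarrow> K \<subseteq> chart_image c \<Longrightarrow>
       (\<And>p. p \<in> topspace X - chart_point c ` K \<Longrightarrow> f p = 0) \<Longrightarrow> (LINT p|\<mu>. f p * G p) = 0"
    and p: "p \<in> fst c"
  shows "G p = 0"
proof -
  let ?S = "chart_image c"
  define x0 where "x0 = snd c p"
  have x0: "x0 \<in> ?S" "chart_point c x0 = p" using chart_facts(3,4)[OF c p] by (simp_all add: x0_def)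
  have oS: "open ?S" by (rule chart_facts(1)[OF c])
  obtain \<epsilon> where \<epsilon>: "\<epsilon> > 0" "cball x0 \<epsilon> \<subseteq> ?S" using oS x0(1) open_contains_cball by blast
  obtain b :: "_ \<Rightarrow> real" where b: "smooth_on UNIV b" "\<And>x. b x \<ge> 0" "b x0 > 0" "\<And>x. dist x x0 \<ge> \<epsilon> \<Longrightarrow> b x = 0"
    by (rule smooth_bump[OF \<epsilon>(1), of x0]) blast
  define g where "g = G \<circ> chart_point c"
  have g: "smooth_on ?S g" using G c by (simp add: smooth_fun_def g_def)
  define \<phi> where "\<phi> x = b x *\<^sub>R cnj (g x)" for x
  have \<phi>: "smooth_on ?S \<phi>" unfolding \<phi>_def
    by (intro smooth_on_scaleR oS smooth_on_subset[OF b(1)] smooth_on_linear[OF oS bounded_linear_cnj g]) simp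
  have K0: "\<phi> x = 0" if "x \<in> ?S - cball x0 \<epsilon>" for x
    using b(4)[of x] that by (auto simp: \<phi>_def dist_commute)
  note ext = smooth_chart_extend[OF c \<phi> compact_cball \<epsilon>(2) K0]
  have "(LINT p|\<mu>. chart_extend c \<phi> p * G p) = 0"
    by (rule test[OF ext(1) compact_cball \<epsilon>(2) ext(2)])
  moreover have "(LINT p|\<mu>. chart_extend c \<phi> p * G p) =
      (LINT x|lborel. indicator ?S x *\<^sub>R (sqrt (det (h c x)) *\<^sub>R (chart_extend c \<phi> (chart_point c x) * G (chart_point c x))))"
  proof (rule chart_integral[OF c])
    have "smooth_fun A (\<lambda>p. chart_extend c \<phi> p * G p)" by (rule smooth_fun_mult[OF ext(1) G])
    then show "continuous_on ?S ((\<lambda>p. chart_extend c \<phi> p * G p) \<circ> chart_point c)"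
      using c by (intro smooth_on_continuous_on) (simp add: smooth_fun_def)
  qed (simp add: chart_extend_def)
  moreover have eq: "indicator ?S x *\<^sub>R (sqrt (det (h c x)) *\<^sub>R (chart_extend c \<phi> (chart_point c x) * G (chart_point c x)))
     = of_real (if x \<in> ?S then sqrt (det (h c x)) * (b x * (norm (g x))\<^sup>2) else 0)" for x
    using chart_facts(5,6)[OF c]
    by (cases "x \<in> ?S") (auto simp: chart_extend_def \<phi>_def g_def scaleR_conv_of_real complex_norm_square mult.commute[of "cnj _"] simp del: of_real_power)
  ultimately have int0: "(LINT x|lborel. (if x \<in> ?S then sqrt (det (h c x)) * (b x * (norm (g x))\<^sup>2) else 0)) = 0"
    by (simp only: integral_complex_of_real of_real_eq_0_iff)
  have "(if x0 \<in> ?S then sqrt (det (h c x0)) * (b x0 * (norm (g x0))\<^sup>2) else 0) = 0"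
  proof (rule continuous_integral_0_imp_0[OF _ compact_cball[of x0 \<epsilon>] _ _ int0])
    have n2: "(norm (g x))\<^sup>2 = g x \<bullet> g x" for x by (simp add: power2_norm_eq_inner)
    have "smooth_on UNIV (\<lambda>x. if x \<in> ?S then sqrt (det (h c x)) * (b x * (norm (g x))\<^sup>2) else 0)"
      unfolding n2
    proof (rule smooth_extend_zero[OF oS _ compact_cball \<epsilon>(2)])
      show "smooth_on ?S (\<lambda>x. sqrt (det (h c x)) * (b x * (g x \<bullet> g x)))"
        by (intro smooth_on_mult smooth_on_sqrt smooth_on_det smooth_on_bilinear[OF oS bounded_bilinear_inner] oS
            smooth_h[OF c] g smooth_on_subset[OF b(1)] det_h_pos[OF c]) auto
      show "sqrt (det (h c x)) * (b x * (g x \<bullet> g x)) = 0" if "x \<in> ?S - cball x0 \<epsilon>" for x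
        using b(4)[of x] that by (auto simp: dist_commute)
    qed
    then show "continuous_on UNIV (\<lambda>x. if x \<in> ?S then sqrt (det (h c x)) * (b x * (norm (g x))\<^sup>2) else 0)"
      by (rule smooth_on_continuous_on)
    show "(if x \<in> ?S then sqrt (det (h c x)) * (b x * (norm (g x))\<^sup>2) else 0) = 0" if "x \<notin> cball x0 \<epsilon>" for x
      using b(4)[of x] that by (auto simp: dist_commute)
    show "(if x \<in> ?S then sqrt (det (h c x)) * (b x * (norm (g x))\<^sup>2) else 0) \<ge> 0" for x
      using b(2)[of x] det_h_pos[OF c, of x] by (simp add: less_imp_le)
  qed
  then show ?thesis using x0 b(3) det_h_pos[OF c x0(1)] by (simp add: g_def)
qed

end

section \<open>Pairing the solutions with boundary values \<open>1\<close> and \<open>f\<close>\<close>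

lemma sum_simplex:
  fixes g :: "nat \<Rightarrow> nat \<Rightarrow> complex"
  shows "(\<Sum>(i,j)\<in>{(i,j). i + j \<le> N}. g i j) = (\<Sum>i\<le>N. \<Sum>j\<le>N - i. g i j)"
    and "(\<Sum>(i,j)\<in>{(i,j). i + j \<le> N}. g i j) = (\<Sum>j\<le>N. \<Sum>i\<le>N - j. g i j)"
    and "(\<Sum>(i,j)\<in>{(i,j). i + j < N}. g i j) = (\<Sum>i\<le>N. \<Sum>j<N - i. g i j)"
    and "(\<Sum>(i,j)\<in>{(i,j). i + j < N}. g i j) = (\<Sum>j\<le>N. \<Sum>i<N - j. g i j)"
proof -
  have e: "{(i,j). i + j \<le> N} = Sigma {..N} (\<lambda>i. {..N - i})" "{(i,j). i + j < N} = Sigma {..N} (\<lambda>i. {..<N - i})"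
    by auto
  show 1: "(\<Sum>(i,j)\<in>{(i,j). i + j \<le> N}. g i j) = (\<Sum>i\<le>N. \<Sum>j\<le>N - i. g i j)"
    "(\<Sum>(i,j)\<in>{(i,j). i + j < N}. g i j) = (\<Sum>i\<le>N. \<Sum>j<N - i. g i j)" for g
    unfolding e by (simp_all add: sum.Sigma)
  have s: "(\<Sum>(i,j)\<in>{(i,j). i + j \<le> N}. g i j) = (\<Sum>(i,j)\<in>{(i,j). i + j \<le> N}. g j i)"
    "(\<Sum>(i,j)\<in>{(i,j). i + j < N}. g i j) = (\<Sum>(i,j)\<in>{(i,j). i + j < N}. g j i)"
    by (rule sum.reindex_bij_witness[of _ "\<lambda>(i,j). (j,i)" "\<lambda>(i,j). (j,i)"]; auto)+
  show "(\<Sum>(i,j)\<in>{(i,j). i + j \<le> N}. g i j) = (\<Sum>j\<le>N. \<Sum>i\<le>N - j. g i j)"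
    "(\<Sum>(i,j)\<in>{(i,j). i + j < N}. g i j) = (\<Sum>j\<le>N. \<Sum>i<N - j. g i j)"
    unfolding s using 1 by simp_all
qed

text \<open>Multiply the recursion of order \<open>N - i\<close> for \<open>p\<close> by \<open>q i\<close>, sum over \<open>i\<close>, and subtract the same with \<open>p\<close> and \<open>q\<close>
  exchanged. The terms can then be sorted by the pairs of factors.\<close>

lemma bilinear_identity:
  fixes V p q :: "nat \<Rightarrow> complex" and \<alpha> Bp Bq :: "nat \<Rightarrow> nat \<Rightarrow> complex"
  assumes p: "\<And>k. k \<le> N \<Longrightarrow> (\<Sum>j\<le>k. \<alpha> j k * (V (k - j) * p j)) + (\<Sum>j<k. Bp (k - 1 - j) j) = 0"
    and q: "\<And>k. k \<le> N \<Longrightarrow> (\<Sum>j\<le>k. \<alpha> j k * (V (k - j) * q j)) + (\<Sum>j<k. Bq (k - 1 - j) j) = 0"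
  shows "(\<Sum>(i,j)\<in>{(i,j). i + j \<le> N}. (\<alpha> j (N - i) - \<alpha> i (N - j)) * (V (N - i - j) * p j * q i))
    + (\<Sum>(i,j)\<in>{(i,j). i + j < N}. q i * Bp (N - 1 - i - j) j - p j * Bq (N - 1 - i - j) i) = 0"
proof -
  have "(\<Sum>i\<le>N. q i * ((\<Sum>j\<le>N - i. \<alpha> j (N - i) * (V (N - i - j) * p j)) + (\<Sum>j<N - i. Bp (N - i - 1 - j) j))) = 0"
    by (intro sum.neutral ballI) (subst p, auto)
  then have 1: "(\<Sum>(i,j)\<in>{(i,j). i + j \<le> N}. \<alpha> j (N - i) * (V (N - i - j) * p j * q i))
      + (\<Sum>(i,j)\<in>{(i,j). i + j < N}. q i * Bp (N - 1 - i - j) j) = 0"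
    unfolding sum_simplex(1,3)
    by (simp add: distrib_left sum.distrib sum_distrib_left mult_ac diff_right_commute)
  have "(\<Sum>j\<le>N. p j * ((\<Sum>i\<le>N - j. \<alpha> i (N - j) * (V (N - j - i) * q i)) + (\<Sum>i<N - j. Bq (N - j - 1 - i) i))) = 0"
    by (intro sum.neutral ballI) (subst q, auto)
  then have 2: "(\<Sum>(i,j)\<in>{(i,j). i + j \<le> N}. \<alpha> i (N - j) * (V (N - i - j) * p j * q i))
      + (\<Sum>(i,j)\<in>{(i,j). i + j < N}. p j * Bq (N - 1 - i - j) i) = 0"
    unfolding sum_simplex(2,4)
    by (simp add: distrib_left sum.distrib sum_distrib_left mult_ac diff_right_commute add.commute)
  have "(\<Sum>(i,j)\<in>{(i,j). i + j \<le> N}. (\<alpha> j (N - i) - \<alpha> i (N - j)) * (V (N - i - j) * p j * q i))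
    + (\<Sum>(i,j)\<in>{(i,j). i + j < N}. q i * Bp (N - 1 - i - j) j - p j * Bq (N - 1 - i - j) i)
   = ((\<Sum>(i,j)\<in>{(i,j). i + j \<le> N}. \<alpha> j (N - i) * (V (N - i - j) * p j * q i))
      + (\<Sum>(i,j)\<in>{(i,j). i + j < N}. q i * Bp (N - 1 - i - j) j))
   - ((\<Sum>(i,j)\<in>{(i,j). i + j \<le> N}. \<alpha> i (N - j) * (V (N - i - j) * p j * q i))
      + (\<Sum>(i,j)\<in>{(i,j). i + j < N}. p j * Bq (N - 1 - i - j) i))"
    by (simp add: left_diff_distrib split_def sum_subtractf)
  also have "\<dots> = 0" unfolding 1 2 by simp
  finally show ?thesis .
qed

context holographic
begin

text \<open>After antisymmetrization the factors of the radial part depend on \<open>i\<close> and \<open>j\<close> only through \<open>j - i\<close>.\<close>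

lemma alpha_swap:
  assumes "i + j \<le> N"
  shows "alpha s j (N - i) - alpha s i (N - j) = 2 * (of_nat j - of_nat i) * (2 * s + 2 * of_nat N - of_nat CARD('n))"
proof -
  have "of_nat (N - i) = (of_nat N - of_nat i :: complex)" "of_nat (N - j) = (of_nat N - of_nat j :: complex)"
    using assms by (simp_all add: of_nat_diff)
  note * = this
  show ?thesis unfolding alpha_def * by (simp add: algebra_simps)
qed

lemma qden_Suc: "qden (Suc k) s = qden k s * (4 * of_nat (Suc k)) * (of_nat CARD('n) / 2 - s - of_nat (Suc k))"
  by (simp add: qden_def)

definition cint :: "('a, 'n) chart \<Rightarrow> (real^'n \<Rightarrow> complex) \<Rightarrow> complex" where
  "cint c \<phi> = (LINT x|lborel. indicator (chart_image c) x *\<^sub>R \<phi> x)"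

abbreviation cintegrable :: "('a, 'n) chart \<Rightarrow> (real^'n \<Rightarrow> complex) \<Rightarrow> bool" where
  "cintegrable c \<phi> \<equiv> integrable lborel (\<lambda>x. indicator (chart_image c) x *\<^sub>R \<phi> x)"

lemma cint_integrable:
  fixes \<phi> :: "real^'n \<Rightarrow> complex"
  assumes "compact K" "K \<subseteq> chart_image c" "continuous_on (chart_image c) \<phi>"
    "\<And>x. x \<in> chart_image c - K \<Longrightarrow> \<phi> x = 0"
  shows "cintegrable c \<phi>"
proof -
  have "integrable lborel (\<lambda>x. indicator K x *\<^sub>R \<phi> x)"
    by (rule borel_integrable_compact[OF assms(1) continuous_on_subset[OF assms(3,2)]])
  moreover have "indicator K x *\<^sub>R \<phi> x = indicator (chart_image c) x *\<^sub>R \<phi> x" for x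
    using assms(2,4) by (auto simp: indicator_def)
  ultimately show ?thesis by simp
qed

lemma cint_cong: "(\<And>x. x \<in> chart_image c \<Longrightarrow> \<phi> x = \<psi> x) \<Longrightarrow> cint c \<phi> = cint c \<psi>"
  unfolding cint_def by (rule Bochner_Integration.integral_cong) (auto simp: indicator_def)

lemma cint_mult: "cint c (\<lambda>x. a * \<phi> x) = a * cint c \<phi>"
proof -
  have "(\<lambda>x. indicator (chart_image c) x *\<^sub>R (a * \<phi> x)) = (\<lambda>x. a * (indicator (chart_image c) x *\<^sub>R \<phi> x))"
    by (simp add: fun_eq_iff)
  then show ?thesis unfolding cint_def by (simp only: integral_mult_right_zero)
qed

lemma cint_sum:
  assumes "\<And>j. j \<in> I \<Longrightarrow> cintegrable c (\<phi> j)"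
  shows "cint c (\<lambda>x. \<Sum>j\<in>I. \<phi> j x) = (\<Sum>j\<in>I. cint c (\<phi> j))"
  unfolding cint_def scaleR_sum_right using assms by (rule Bochner_Integration.integral_sum)

lemma cint_add:
  assumes "cintegrable c \<phi>" "cintegrable c \<psi>"
  shows "cint c (\<lambda>x. \<phi> x + \<psi> x) = cint c \<phi> + cint c \<psi>"
  unfolding cint_def scaleR_add_right using assms by (rule Bochner_Integration.integral_add)

lemma cint_two_sums:
  assumes "\<And>j. j \<in> I \<Longrightarrow> cintegrable c (\<phi> j)"
    "\<And>j. j \<in> J \<Longrightarrow> cintegrable c (\<psi> j)"
  shows "cint c (\<lambda>x. (\<Sum>j\<in>I. \<phi> j x) + (\<Sum>j\<in>J. \<psi> j x)) = (\<Sum>j\<in>I. cint c (\<phi> j)) + (\<Sum>j\<in>J. cint c (\<psi> j))"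
proof -
  have "cintegrable c (\<lambda>x. (\<Sum>j\<in>I. \<phi> j x))"
    "cintegrable c (\<lambda>x. (\<Sum>j\<in>J. \<psi> j x))"
    unfolding scaleR_sum_right using assms by (auto intro!: Bochner_Integration.integrable_sum simp del: indicator_scaleR_eq_if)
  then show ?thesis using cint_sum[of I c \<phi>] cint_sum[of J c \<psi>] assms by (simp add: cint_add)
qed

text \<open>Test functions are supported in one chart, so that no partition of unity is needed.\<close>

definition test_fun :: "('a, 'n) chart \<Rightarrow> (real^'n) set \<Rightarrow> ('a \<Rightarrow> complex) \<Rightarrow> bool" where
  "test_fun c K f \<longleftrightarrow> c \<in> A \<and> compact K \<and> K \<subseteq> chart_image c \<and> smooth_fun A f \<and>
     (\<forall>p\<in>topspace X - chart_point c ` K. f p = 0)"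

lemma test_fun_facts:
  assumes "test_fun c K f"
  shows "c \<in> A" "compact K" "K \<subseteq> chart_image c" "smooth_fun A f" "closedin X (chart_point c ` K)"
    "\<And>p. p \<in> topspace X - chart_point c ` K \<Longrightarrow> f p = 0"
  using assms compactin_chart_point(2) by (auto simp: test_fun_def)

lemma chart_point_outside:
  assumes "c \<in> A" "x \<in> chart_image c - K" "K \<subseteq> chart_image c"
  shows "chart_point c x \<in> topspace X - chart_point c ` K"
proof -
  have "chart_point c x \<notin> chart_point c ` K"
  proof
    assume "chart_point c x \<in> chart_point c ` K"
    then obtain y where y: "y \<in> K" "chart_point c x = chart_point c y" by blast
    then have "x = y" using chart_facts(6)[OF assms(1)] assms by (metis DiffD1 subsetD)
    then show False using y assms by blast
  qed
  then show ?thesis using chart_facts(5,8)[OF assms(1)] assms by auto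
qed

lemma smooth_on_chart: "c \<in> A \<Longrightarrow> smooth_fun A f \<Longrightarrow> smooth_on (chart_image c) (\<lambda>x. f (chart_point c x))"
  by (simp add: smooth_fun_def comp_def)

lemma smooth_on_of_real: "open S \<Longrightarrow> smooth_on S g \<Longrightarrow> smooth_on S (\<lambda>x. complex_of_real (g x))"
  by (rule smooth_on_linear[OF _ bounded_linear_of_real])

lemma pairing_integrable:
  assumes t: "test_fun c K f" and l: "admissible l" and g: "smooth_fun A g"
  shows "integrable lborel (\<lambda>x. indicator (chart_image c) x *\<^sub>R
    (of_real (Vc c l x) * f (chart_point c x) * g (chart_point c x)))"
proof (rule cint_integrable[OF test_fun_facts(2,3)[OF t]])
  note tf = test_fun_facts[OF t]
  show "continuous_on (chart_image c) (\<lambda>x. of_real (Vc c l x) * f (chart_point c x) * g (chart_point c x))"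
    by (intro smooth_on_continuous_on smooth_on_mult smooth_on_of_real chart_facts(1) smooth_Vc smooth_on_chart tf l g)
  show "of_real (Vc c l x) * f (chart_point c x) * g (chart_point c x) = 0" if "x \<in> chart_image c - K" for x
    using tf(6)[OF chart_point_outside[OF tf(1) that tf(3)]] by simp
qed

lemma test_fun_T:
  assumes t: "test_fun c K f" and j: "admissible j" and \<sigma>: "\<sigma> \<ge> real CARD('n) + 1"
  shows "test_fun c K (T j (of_real \<sigma>) f)"
  using test_fun_facts[OF t] smooth_T[OF _ j] T_local[OF _ \<sigma> _ _ j] by (simp add: test_fun_def)

text \<open>\<open>pair c N s f i j\<close> is the coefficient that belongs to \<open>T i s 1\<close> and \<open>T j s f\<close> in the expansion
  of the pairing of the solutions with boundary values \<open>1\<close> and \<open>f\<close>.\<close>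

definition pair :: "('a, 'n) chart \<Rightarrow> nat \<Rightarrow> complex \<Rightarrow> ('a \<Rightarrow> complex) \<Rightarrow> nat \<Rightarrow> nat \<Rightarrow> complex" where
  "pair c N s f i j = cint c (\<lambda>x. of_real (Vc c (N - i - j) x) * T j s f (chart_point c x) * T i s (\<lambda>_. 1) (chart_point c x))"

text \<open>The pairing of \<open>f\<close> with \<open>T N s 1\<close>, without the denominator of \<open>T N s\<close>.\<close>

definition pairP :: "('a, 'n) chart \<Rightarrow> nat \<Rightarrow> complex \<Rightarrow> ('a \<Rightarrow> complex) \<Rightarrow> complex" where
  "pairP c N s f = cint c (\<lambda>x. of_real (Vc c 0 x) * f (chart_point c x) * P N s (\<lambda>_. 1) (chart_point c x))"

lemma green_chart:
  assumes t: "test_fun c K f" and g: "smooth_fun A g" and l: "admissible (Suc l)"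
  shows "cint c (\<lambda>x. g (chart_point c x) * div_form (wc c l) (f \<circ> chart_point c) x
      - f (chart_point c x) * div_form (wc c l) (g \<circ> chart_point c) x) = 0"
    and "cintegrable c (\<lambda>x. (g (chart_point c x) * div_form (wc c l) (f \<circ> chart_point c) x
      - f (chart_point c x) * div_form (wc c l) (g \<circ> chart_point c) x))"
proof -
  note tf = test_fun_facts[OF t]
  have l': "admissible l" using admissible_mono[OF l] by simp
  have sm: "smooth_on (chart_image c) (f \<circ> chart_point c)" "smooth_on (chart_image c) (g \<circ> chart_point c)"
    using tf g by (auto simp: smooth_fun_def)
  have z: "(f \<circ> chart_point c) x = 0" if "x \<in> chart_image c - K" for x
    using tf(6)[OF chart_point_outside[OF tf(1) that tf(3)]] by simp
  note gr = green_div_form[OF chart_facts(1)[OF tf(1)] smooth_wc[OF tf(1) l'] transpose_wc[OF tf(1) _ l] sm tf(2,3) z]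
  show "cint c (\<lambda>x. g (chart_point c x) * div_form (wc c l) (f \<circ> chart_point c) x
      - f (chart_point c x) * div_form (wc c l) (g \<circ> chart_point c) x) = 0"
    unfolding cint_def using gr(1) by (simp only: comp_def)
  show "cintegrable c (\<lambda>x. (g (chart_point c x) * div_form (wc c l) (f \<circ> chart_point c) x
      - f (chart_point c x) * div_form (wc c l) (g \<circ> chart_point c) x))"
    using gr(2) by (simp only: comp_def)
qed

lemma pair_0:
  assumes "c \<in> A"
  shows "pair c N s f 0 j = cint c (\<lambda>x. of_real (Vc c (N - j) x) * T j s f (chart_point c x))"
  unfolding pair_def
proof (rule cint_cong)
  fix x assume "x \<in> chart_image c"
  then have "chart_point c x \<in> topspace X" using chart_facts(5,8)[OF assms] by auto
  then have "T 0 s (\<lambda>_. 1) (chart_point c x) = 1" by (rule T_0[OF smooth_fun_const])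
  then show "of_real (Vc c (N - 0 - j) x) * T j s f (chart_point c x) * T 0 s (\<lambda>_. 1) (chart_point c x)
      = of_real (Vc c (N - j) x) * T j s f (chart_point c x)" by simp
qed

text \<open>The divergence terms of the recursion integrate to zero.\<close>

lemma pair_first:
  assumes t: "test_fun c K f" and N: "admissible N" and \<sigma>: "\<sigma> \<ge> real CARD('n) + 1"
  shows "(\<Sum>j\<le>N. alpha (of_real \<sigma>) j N * pair c N (of_real \<sigma>) f 0 j) = 0"
proof -
  note tf = test_fun_facts[OF t]
  let ?\<phi> = "\<lambda>j. T j (of_real \<sigma>) f"
  have tj: "test_fun c K (?\<phi> j)" if "j \<le> N" for j by (rule test_fun_T[OF t admissible_mono[OF N that] \<sigma>])
  have i1: "cintegrable c (\<lambda>x. (of_real (Vc c (N - j) x) * ?\<phi> j (chart_point c x)))"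
    if "j \<le> N" for j
    using pairing_integrable[OF tj[OF that] admissible_mono[OF N] smooth_fun_const[of 1], of "N - j"] by simp
  have g: "cint c (div_form (wc c (N - 1 - j)) (?\<phi> j \<circ> chart_point c)) = 0"
    "cintegrable c (\<lambda>x. div_form (wc c (N - 1 - j)) (?\<phi> j \<circ> chart_point c) x)"
    if "j < N" for j
  proof -
    have a: "admissible (Suc (N - 1 - j))" using admissible_mono[OF N] that by simp
    have "((\<lambda>_. 1) :: 'a \<Rightarrow> complex) \<circ> chart_point c = (\<lambda>_. 1)" by auto
    then show "cint c (div_form (wc c (N - 1 - j)) (?\<phi> j \<circ> chart_point c)) = 0"
      "cintegrable c (\<lambda>x. div_form (wc c (N - 1 - j)) (?\<phi> j \<circ> chart_point c) x)"
      using green_chart[OF tj smooth_fun_const[of 1] a, of j] that by simp_all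
  qed
  have i1': "cintegrable c (\<lambda>x. (alpha (of_real \<sigma>) j N * (of_real (Vc c (N - j) x) * ?\<phi> j (chart_point c x))))"
    if "j \<le> N" for j
    using integrable_mult_right[of "alpha (of_real \<sigma>) j N", OF i1[OF that]] by (simp add: mult_ac)
  have "0 = cint c (\<lambda>x. (\<Sum>j\<le>N. alpha (of_real \<sigma>) j N * (of_real (Vc c (N - j) x) * ?\<phi> j (chart_point c x)))
     + (\<Sum>j<N. div_form (wc c (N - 1 - j)) (?\<phi> j \<circ> chart_point c) x))"
  proof -
    have "cint c (\<lambda>x. 0) = 0" by (simp add: cint_def)
    then show ?thesis
      by (subst cint_cong[where \<psi>="\<lambda>x. 0"]) (use solution_recursion[OF tf(1) _ tf(4) \<sigma> N] in auto)
  qed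
  also have "\<dots> = (\<Sum>j\<le>N. cint c (\<lambda>x. alpha (of_real \<sigma>) j N * (of_real (Vc c (N - j) x) * ?\<phi> j (chart_point c x))))
     + (\<Sum>j<N. cint c (div_form (wc c (N - 1 - j)) (?\<phi> j \<circ> chart_point c)))"
    by (rule cint_two_sums) (use i1' g(2) in \<open>auto simp del: indicator_scaleR_eq_if\<close>)
  also have "(\<Sum>j<N. cint c (div_form (wc c (N - 1 - j)) (?\<phi> j \<circ> chart_point c))) = 0"
    by (intro sum.neutral ballI g(1)) simp
  finally show ?thesis by (simp add: cint_mult pair_0[OF tf(1)])
qed

text \<open>The divergence terms cancel in pairs by Green's formula, and the common factor \<open>2 (2 s + 2 N - n)\<close> of the other terms
  does not vanish for the parameters considered.\<close>

lemma pair_second: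
  assumes t: "test_fun c K f" and N: "admissible N" and \<sigma>: "\<sigma> \<ge> real CARD('n) + 1" and N1: "N > 0"
  shows "(\<Sum>(i,j)\<in>{(i,j). i + j \<le> N}. (of_nat j - of_nat i) * pair c N (of_real \<sigma>) f i j) = 0"
proof -
  note tf = test_fun_facts[OF t]
  let ?\<phi> = "\<lambda>j. T j (of_real \<sigma>) f" and ?\<psi> = "\<lambda>j. T j (of_real \<sigma>) (\<lambda>_. 1)"
  let ?D = "{(i,j). i + j \<le> N}" and ?D' = "{(i,j). i + j < N}"
  let ?b = "2 * of_real \<sigma> + 2 * of_nat N - of_nat CARD('n) :: complex"
  have tj: "test_fun c K (?\<phi> j)" if "j \<le> N" for j by (rule test_fun_T[OF t admissible_mono[OF N that] \<sigma>])
  have sj: "smooth_fun A (?\<psi> j)" if "j \<le> N" for j by (rule smooth_T[OF smooth_fun_const admissible_mono[OF N that]])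
  have fin: "finite ?D" "finite ?D'"
    by (rule finite_subset[of _ "{..N} \<times> {..N}"]; auto)+
  define F where "F = (\<lambda>(i,j) x. 2 * (of_nat j - of_nat i) * ?b * (of_real (Vc c (N - i - j) x) * ?\<phi> j (chart_point c x) * ?\<psi> i (chart_point c x)))"
  define G where "G = (\<lambda>(i,j) x. ?\<psi> i (chart_point c x) * div_form (wc c (N - 1 - i - j)) (?\<phi> j \<circ> chart_point c) x
      - ?\<phi> j (chart_point c x) * div_form (wc c (N - 1 - i - j)) (?\<psi> i \<circ> chart_point c) x)"
  have iF: "cintegrable c (F ij)" if D: "ij \<in> ?D" for ij
  proof -
    obtain i j where ij: "ij = (i,j)" "i + j \<le> N" using D by auto
    have "cintegrable c (\<lambda>x. (of_real (Vc c (N - i - j) x) * ?\<phi> j (chart_point c x) * ?\<psi> i (chart_point c x)))"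
      using ij by (intro pairing_integrable[OF tj] admissible_mono[OF N] sj) auto
    from integrable_mult_right[of "2 * (of_nat j - of_nat i) * ?b", OF this]
    show ?thesis by (simp add: F_def ij mult_ac)
  qed
  have G: "cintegrable c (G ij)" "cint c (G ij) = 0" if D: "ij \<in> ?D'" for ij
  proof -
    obtain i j where ij: "ij = (i,j)" "i + j < N" using D by auto
    then have "admissible (Suc (N - 1 - i - j))" by (intro admissible_mono[OF N]) auto
    from green_chart[OF tj sj this, of j i] ij
    show "cintegrable c (G ij)" "cint c (G ij) = 0"
      by (simp_all add: G_def)
  qed
  have zero: "(\<Sum>ij\<in>?D. F ij x) + (\<Sum>ij\<in>?D'. G ij x) = 0" if x: "x \<in> chart_image c" for x
  proof -
    have "(\<Sum>(i,j)\<in>?D. (alpha (of_real \<sigma>) j (N - i) - alpha (of_real \<sigma>) i (N - j)) * (of_real (Vc c (N - i - j) x) * ?\<phi> j (chart_point c x) * ?\<psi> i (chart_point c x)))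
      + (\<Sum>(i,j)\<in>?D'. ?\<psi> i (chart_point c x) * div_form (wc c (N - 1 - i - j)) (?\<phi> j \<circ> chart_point c) x
      - ?\<phi> j (chart_point c x) * div_form (wc c (N - 1 - i - j)) (?\<psi> i \<circ> chart_point c) x) = 0"
    proof (rule bilinear_identity[where \<alpha>="alpha (of_real \<sigma>)" and V="\<lambda>l. of_real (Vc c l x)"
          and p="\<lambda>j. ?\<phi> j (chart_point c x)" and q="\<lambda>i. ?\<psi> i (chart_point c x)"
          and Bp="\<lambda>l j. div_form (wc c l) (?\<phi> j \<circ> chart_point c) x"
          and Bq="\<lambda>l i. div_form (wc c l) (?\<psi> i \<circ> chart_point c) x"])
      fix k assume "k \<le> N"
      note a = admissible_mono[OF N this]
      show "(\<Sum>j\<le>k. alpha (of_real \<sigma>) j k * (of_real (Vc c (k - j) x) * ?\<phi> j (chart_point c x)))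
        + (\<Sum>j<k. div_form (wc c (k - 1 - j)) (?\<phi> j \<circ> chart_point c) x) = 0"
        by (rule solution_recursion[OF tf(1) x tf(4) \<sigma> a])
      show "(\<Sum>j\<le>k. alpha (of_real \<sigma>) j k * (of_real (Vc c (k - j) x) * ?\<psi> j (chart_point c x)))
        + (\<Sum>j<k. div_form (wc c (k - 1 - j)) (?\<psi> j \<circ> chart_point c) x) = 0"
        by (rule solution_recursion[OF tf(1) x smooth_fun_const \<sigma> a])
    qed
    moreover have "(\<Sum>ij\<in>?D. F ij x) = (\<Sum>(i,j)\<in>?D. (alpha (of_real \<sigma>) j (N - i) - alpha (of_real \<sigma>) i (N - j)) * (of_real (Vc c (N - i - j) x) * ?\<phi> j (chart_point c x) * ?\<psi> i (chart_point c x)))"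
      by (intro sum.cong refl) (auto simp: F_def alpha_swap)
    ultimately show ?thesis by (simp add: G_def split_def)
  qed
  have "0 = cint c (\<lambda>x. (\<Sum>ij\<in>?D. F ij x) + (\<Sum>ij\<in>?D'. G ij x))"
  proof -
    have "cint c (\<lambda>x. 0) = 0" by (simp add: cint_def)
    then show ?thesis by (subst cint_cong[where \<psi>="\<lambda>x. 0"]) (use zero in auto)
  qed
  also have "\<dots> = (\<Sum>ij\<in>?D. cint c (F ij)) + (\<Sum>ij\<in>?D'. cint c (G ij))"
    by (rule cint_two_sums) (use iF G(1) in auto)
  also have "\<dots> = (\<Sum>ij\<in>?D. cint c (F ij))" by (simp add: G(2))
  also have "\<dots> = (\<Sum>(i,j)\<in>?D. 2 * ?b * ((of_nat j - of_nat i) * pair c N (of_real \<sigma>) f i j))"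
    by (intro sum.cong refl) (clarsimp simp only: F_def pair_def cint_mult case_prod_conv, simp only: mult_ac)
  also have "\<dots> = 2 * ?b * (\<Sum>(i,j)\<in>?D. (of_nat j - of_nat i) * pair c N (of_real \<sigma>) f i j)"
    by (simp add: sum_distrib_left split_def)
  finally have eq: "0 = 2 * ?b * (\<Sum>(i,j)\<in>?D. (of_nat j - of_nat i) * pair c N (of_real \<sigma>) f i j)" .
  have "?b \<noteq> 0" using alpha_diag_nonzero[OF \<sigma> N1] by (simp add: alpha_diag)
  then have b2: "2 * ?b \<noteq> 0" by (rule no_zero_divisors[OF zero_neq_numeral[symmetric]])
  show ?thesis
    by (rule mult_left_cancel[OF b2, THEN iffD1]) (simp only: eq[symmetric] mult_zero_right)
qed

text \<open>The terms of the second identity in which neither operator has order \<open>N\<close>.\<close>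

definition cross :: "('a, 'n) chart \<Rightarrow> nat \<Rightarrow> complex \<Rightarrow> ('a \<Rightarrow> complex) \<Rightarrow> complex" where
  "cross c N s f = (\<Sum>(i,j)\<in>{(i,j). i < N \<and> j < N \<and> i + j \<le> N}. (of_nat j - of_nat i) * pair c N s f i j)"

text \<open>Both identities contain \<open>pair c N s f 0 N\<close>, with factors \<open>alpha s N N = - 4 N (n / 2 - s - N)\<close> and \<open>N\<close>. Eliminating it
  leaves only \<open>pair c N s f N 0\<close>, multiplied by \<open>4 N (n / 2 - s - N)\<close>, as a term of order \<open>N\<close>; this factor cancels the last
  factor of the denominator of \<open>T N s\<close>, so that no pole at \<open>s = n / 2 - N\<close> remains.\<close>

lemma pairing_identity_real:
  assumes t: "test_fun c K f" and N: "admissible N" and \<sigma>: "\<sigma> \<ge> real CARD('n) + 1" and N1: "N > 0"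
  shows "pairP c N (of_real \<sigma>) f / qden (N - 1) (of_real \<sigma>)
    = (\<Sum>j<N. alpha (of_real \<sigma>) j N * pair c N (of_real \<sigma>) f 0 j)
      + 4 * (of_nat CARD('n) / 2 - of_real \<sigma> - of_nat N) * cross c N (of_real \<sigma>) f"
proof -
  let ?s = "of_real \<sigma> :: complex" and ?D = "{(i,j). i + j \<le> N}" and ?E = "{(i,j). i < N \<and> j < N \<and> i + j \<le> N}"
  let ?g = "\<lambda>(i,j). (of_nat j - of_nat i) * pair c N ?s f i j"
  let ?d = "of_nat CARD('n) / 2 - ?s - of_nat N"
  note tf = test_fun_facts[OF t]
  have finE: "finite ?E" by (rule finite_subset[of _ "{..N} \<times> {..N}"]) auto
  have "?D = insert (0,N) (insert (N,0) ?E)" using N1 by auto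
  then have "sum ?g ?D = ?g (0,N) + (?g (N,0) + sum ?g ?E)"
    using finE N1 by (simp add: sum.insert)
  then have 2: "of_nat N * pair c N ?s f 0 N - of_nat N * pair c N ?s f N 0 + cross c N ?s f = 0"
    using pair_second[OF t N \<sigma> N1] by (simp add: cross_def algebra_simps)
  have "{..N} = insert N {..<N}" by auto
  then have 1: "alpha ?s N N * pair c N ?s f 0 N + (\<Sum>j<N. alpha ?s j N * pair c N ?s f 0 j) = 0"
    using pair_first[OF t N \<sigma>] by simp
  have qN: "qden N ?s = qden (N - 1) ?s * (4 * of_nat N) * ?d" using qden_Suc[of "N - 1" ?s] N1 by simp
  have nz: "qden N ?s \<noteq> 0" by (rule qden_real_nonzero[OF \<sigma>])
  have "pair c N ?s f N 0 = cint c (\<lambda>x. (1 / qden N ?s) * (of_real (Vc c 0 x) * f (chart_point c x) * P N ?s (\<lambda>_. 1) (chart_point c x)))"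
    unfolding pair_def
  proof (rule cint_cong)
    fix x assume "x \<in> chart_image c"
    then have "chart_point c x \<in> topspace X" using chart_facts(5,8)[OF tf(1)] by auto
    then have "T 0 ?s f (chart_point c x) = f (chart_point c x)" by (rule T_0[OF tf(4)])
    then show "of_real (Vc c (N - N - 0) x) * T 0 ?s f (chart_point c x) * T N ?s (\<lambda>_. 1) (chart_point c x)
      = (1 / qden N ?s) * (of_real (Vc c 0 x) * f (chart_point c x) * P N ?s (\<lambda>_. 1) (chart_point c x))"
      by (simp add: T_qden[of N])
  qed
  then have "pair c N ?s f N 0 = pairP c N ?s f / qden N ?s"
    by (simp only: cint_mult pairP_def) simp
  then have 3: "pairP c N ?s f / qden (N - 1) ?s = 4 * of_nat N * ?d * pair c N ?s f N 0"
  proof -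
    have gen: "B = p / (Q * m * d) \<Longrightarrow> Q * m * d \<noteq> 0 \<Longrightarrow> p / Q = m * d * B" for B p Q m d :: complex
      by (simp add: field_simps)
    assume "pair c N ?s f N 0 = pairP c N ?s f / qden N ?s"
    then show ?thesis using nz unfolding qN by (rule gen)
  qed
  have a: "alpha ?s N N = - 4 * of_nat N * ?d" by (simp add: alpha_diag algebra_simps)
  have eq2: "of_nat N * pair c N ?s f N 0 = of_nat N * pair c N ?s f 0 N + cross c N ?s f"
    using 2 by (simp add: algebra_simps)
  have eq1: "(\<Sum>j<N. alpha ?s j N * pair c N ?s f 0 j) = 4 * of_nat N * ?d * pair c N ?s f 0 N"
    using 1 unfolding a by (simp add: add_eq_0_iff2)
  have "4 * of_nat N * ?d * pair c N ?s f N 0 = 4 * ?d * (of_nat N * pair c N ?s f N 0)" by simp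
  then show ?thesis unfolding 3 eq1 by (simp only: eq2) (simp add: distrib_left mult_ac)
qed

text \<open>The complement of the poles of \<open>T 0 s\<close>, ..., \<open>T m s\<close>.\<close>

definition regular :: "nat \<Rightarrow> complex set" where
  "regular m = {s. \<forall>i\<in>{1..m}. s \<noteq> of_nat CARD('n) / 2 - of_nat i}"

lemma regular_Compl: "regular m = UNIV - (\<lambda>i. of_nat CARD('n) / 2 - of_nat i) ` {1..m}"
  by (auto simp: regular_def)

lemma open_regular: "open (regular m)"
  unfolding regular_Compl by (intro open_Diff open_UNIV finite_imp_closed) simp

lemma connected_regular: "connected (regular m)"
  unfolding regular_Compl by (rule connected_open_delete_finite) auto

lemma qden_nonzero: "s \<in> regular m \<Longrightarrow> j \<le> m \<Longrightarrow> qden j s \<noteq> 0"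
proof -
  assume s: "s \<in> regular m" "j \<le> m"
  have "of_nat CARD('n) / 2 - s - of_nat i \<noteq> 0" if "i \<in> {1..j}" for i
  proof
    assume "of_nat CARD('n) / 2 - s - of_nat i = 0"
    then have "s = of_nat CARD('n) / 2 - of_nat i" by (simp add: algebra_simps)
    moreover have "i \<in> {1..m}" using that s(2) by auto
    ultimately show False using s(1) unfolding regular_def by blast
  qed
  then show "qden j s \<noteq> 0" by (simp add: qden_def)
qed

text \<open>The complement of a finite set is connected, and the parameters from \<open>n + 1\<close> on accumulate at \<open>n + 1\<close>.\<close>

lemma regular_continuation:
  assumes hol: "F holomorphic_on regular m" and 0: "\<And>\<sigma>. \<sigma> \<ge> real CARD('n) + 1 \<Longrightarrow> F (of_real \<sigma>) = 0"
    and s: "s \<in> regular m"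
  shows "F s = 0"
proof -
  let ?U = "of_real ` {real CARD('n) + 1..} :: complex set" and ?\<xi> = "of_real (real CARD('n) + 1) :: complex"
  have sub: "?U \<subseteq> regular m"
  proof
    fix z assume "z \<in> ?U"
    then obtain \<sigma> where \<sigma>: "z = of_real \<sigma>" "\<sigma> \<ge> real CARD('n) + 1" by auto
    have "z \<noteq> of_nat CARD('n) / 2 - of_nat i" for i
    proof
      assume "z = of_nat CARD('n) / 2 - of_nat i"
      then have "\<sigma> = real CARD('n) / 2 - real i" by (auto simp: \<sigma> dest: arg_cong[of _ _ Re])
      then show False using \<sigma> by simp
    qed
    then show "z \<in> regular m" by (simp add: regular_def)
  qed
  have lim: "?\<xi> islimpt ?U"
    unfolding islimpt_sequential
  proof (intro exI conjI allI)
    show "of_real (real CARD('n) + 1 + inverse (real (Suc k))) \<in> ?U - {?\<xi>}" for k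
      by (auto simp del: of_real_add)
    have "(\<lambda>k. real CARD('n) + 1 + inverse (real (Suc k))) \<longlonglongrightarrow> real CARD('n) + 1 + 0"
      by (intro tendsto_add tendsto_const LIMSEQ_inverse_real_of_nat)
    then show "(\<lambda>k. of_real (real CARD('n) + 1 + inverse (real (Suc k))) :: complex) \<longlonglongrightarrow> ?\<xi>"
      by (intro tendsto_of_real) simp
  qed
  have "?\<xi> \<in> regular m" using sub by auto
  then show ?thesis
    using analytic_continuation[OF hol open_regular connected_regular sub _ lim _ s] 0 by auto
qed

text \<open>It is a polynomial in \<open>s\<close>. The coefficients of \<open>P j s f\<close> are supported in \<open>K\<close>, so they can be integrated one by one.\<close>

lemma pairing_holomorphic:
  assumes t: "test_fun c K f" and l: "admissible l" and ij: "admissible i" "admissible j" and g: "smooth_fun A g"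
  shows "(\<lambda>s. cint c (\<lambda>x. of_real (Vc c l x) * P j s f (chart_point c x) * P i s g (chart_point c x))) holomorphic_on S"
proof -
  note tf = test_fun_facts[OF t]
  obtain d B where B: "\<forall>k. smooth_fun A (B k)" "\<forall>s. \<forall>p\<in>topspace X. P j s f p = (\<Sum>k\<le>(d::nat). s ^ k * B k p)"
     "\<forall>k\<le>d. \<forall>p\<in>topspace X - chart_point c ` K. B k p = 0"
    using P_coeffs_local[OF ij(2) tf(4,5,6)] by blast
  obtain e C where C': "\<forall>k f. smooth_fun A f \<longrightarrow> smooth_fun A (C k f)"
    "\<forall>s f. smooth_fun A f \<longrightarrow> (\<forall>p \<in> topspace X. P i s f p = (\<Sum>k\<le>(e::nat). s ^ k * C k f p))"
    using P_coeffs[OF ij(1)] by (elim exE conjE)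
  note C = C'(1)[rule_format, OF g] C'(2)[rule_format, OF g]
  have tB: "test_fun c K (B k)" if "k \<le> d" for k using B tf that by (simp add: test_fun_def)
  define J where "J k m = cint c (\<lambda>x. of_real (Vc c l x) * B k (chart_point c x) * C m g (chart_point c x))" for k m
  have "cint c (\<lambda>x. of_real (Vc c l x) * P j s f (chart_point c x) * P i s g (chart_point c x))
      = (\<Sum>k\<le>d. \<Sum>m\<le>e. s ^ (k + m) * J k m)" for s
  proof -
    have "cint c (\<lambda>x. of_real (Vc c l x) * P j s f (chart_point c x) * P i s g (chart_point c x))
      = cint c (\<lambda>x. \<Sum>km\<in>{..d} \<times> {..e}. s ^ (fst km + snd km) * (of_real (Vc c l x) * B (fst km) (chart_point c x) * C (snd km) g (chart_point c x)))"
    proof (rule cint_cong)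
      fix x assume "x \<in> chart_image c"
      then have "chart_point c x \<in> topspace X" using chart_facts(5,8)[OF tf(1)] by auto
      then have "of_real (Vc c l x) * P j s f (chart_point c x) * P i s g (chart_point c x)
        = of_real (Vc c l x) * ((\<Sum>k\<le>d. s ^ k * B k (chart_point c x)) * (\<Sum>m\<le>e. s ^ m * C m g (chart_point c x)))"
        using B(2) C(2) by (simp add: mult.assoc)
      also have "\<dots> = (\<Sum>km\<in>{..d} \<times> {..e}. s ^ (fst km + snd km) * (of_real (Vc c l x) * B (fst km) (chart_point c x) * C (snd km) g (chart_point c x)))"
        by (subst sum_product, subst sum.cartesian_product, subst sum_distrib_left, intro sum.cong refl)
           (simp add: split_def power_add)
      finally show "of_real (Vc c l x) * P j s f (chart_point c x) * P i s g (chart_point c x)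
        = (\<Sum>km\<in>{..d} \<times> {..e}. s ^ (fst km + snd km) * (of_real (Vc c l x) * B (fst km) (chart_point c x) * C (snd km) g (chart_point c x)))" .
    qed
    also have "\<dots> = (\<Sum>km\<in>{..d} \<times> {..e}. cint c (\<lambda>x. s ^ (fst km + snd km) * (of_real (Vc c l x) * B (fst km) (chart_point c x) * C (snd km) g (chart_point c x))))"
    proof (rule cint_sum)
      fix km assume km: "km \<in> {..d} \<times> {..e}"
      have "cintegrable c (\<lambda>x. (of_real (Vc c l x) * B (fst km) (chart_point c x) * C (snd km) g (chart_point c x)))"
        using km by (intro pairing_integrable[OF tB] l C) auto
      from integrable_mult_right[of "s ^ (fst km + snd km)", OF this]
      show "cintegrable c (\<lambda>x. (s ^ (fst km + snd km) * (of_real (Vc c l x) * B (fst km) (chart_point c x) * C (snd km) g (chart_point c x))))"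
        by (simp add: mult_ac)
    qed
    also have "\<dots> = (\<Sum>k\<le>d. \<Sum>m\<le>e. s ^ (k + m) * J k m)"
      by (simp add: cint_mult J_def sum.cartesian_product split_def)
    finally show ?thesis .
  qed
  then show ?thesis by (auto intro!: holomorphic_intros)
qed

lemma pair_qden: "pair c N s f i j =
    cint c (\<lambda>x. of_real (Vc c (N - i - j) x) * P j s f (chart_point c x) * P i s (\<lambda>_. 1) (chart_point c x)) / (qden j s * qden i s)"
proof -
  have "pair c N s f i j = cint c (\<lambda>x. (1 / (qden j s * qden i s)) * (of_real (Vc c (N - i - j) x) * P j s f (chart_point c x) * P i s (\<lambda>_. 1) (chart_point c x)))"
    unfolding pair_def T_qden by (simp add: field_simps)
  then show ?thesis by (simp only: cint_mult) simp
qed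

lemma holomorphic_qden: "qden j holomorphic_on S"
  unfolding qden_def[abs_def] by (intro holomorphic_intros)

lemma pair_holomorphic:
  assumes t: "test_fun c K f" and N: "admissible N" and ij: "i \<le> m" "j \<le> m" "i + j \<le> N"
  shows "(\<lambda>s. pair c N s f i j) holomorphic_on regular m"
  unfolding pair_qden
  by (intro holomorphic_on_divide holomorphic_on_mult holomorphic_qden pairing_holomorphic[OF t] admissible_mono[OF N] smooth_fun_const)
     (use ij qden_nonzero in auto)

lemma pairP_holomorphic:
  assumes t: "test_fun c K f" and N: "admissible N"
  shows "(\<lambda>s. pairP c N s f) holomorphic_on S"
proof -
  note tf = test_fun_facts[OF t]
  have "pairP c N s f = cint c (\<lambda>x. of_real (Vc c 0 x) * P 0 s f (chart_point c x) * P N s (\<lambda>_. 1) (chart_point c x))" for s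
    unfolding pairP_def
  proof (rule cint_cong)
    fix x assume "x \<in> chart_image c"
    then have "chart_point c x \<in> topspace X" using chart_facts(5,8)[OF tf(1)] by auto
    from T_0[OF tf(4) this, of s] show "of_real (Vc c 0 x) * f (chart_point c x) * P N s (\<lambda>_. 1) (chart_point c x)
      = of_real (Vc c 0 x) * P 0 s f (chart_point c x) * P N s (\<lambda>_. 1) (chart_point c x)"
      by (simp add: T_qden qden_def)
  qed
  then show ?thesis
    using pairing_holomorphic[OF t _ N _ smooth_fun_const, of 0 0 1 S] admissible_mono[OF N, of 0] by simp
qed

lemma cross_holomorphic:
  assumes t: "test_fun c K f" and N: "admissible N"
  shows "(\<lambda>s. cross c N s f) holomorphic_on regular (N - 1)"
  unfolding cross_def split_def
  by (intro holomorphic_intros pair_holomorphic[OF t N]) auto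

lemma pairing_identity:
  assumes t: "test_fun c K f" and N: "admissible N" and N1: "N > 0" and s: "s \<in> regular (N - 1)"
  shows "pairP c N s f / qden (N - 1) s
    = (\<Sum>j<N. alpha s j N * pair c N s f 0 j) + 4 * (of_nat CARD('n) / 2 - s - of_nat N) * cross c N s f"
proof -
  let ?F = "\<lambda>s. pairP c N s f / qden (N - 1) s
    - ((\<Sum>j<N. alpha s j N * pair c N s f 0 j) + 4 * (of_nat CARD('n) / 2 - s - of_nat N) * cross c N s f)"
  have "?F s = 0"
  proof (rule regular_continuation[OF _ _ s])
    show "?F holomorphic_on regular (N - 1)"
      unfolding alpha_def
      by (intro holomorphic_intros pairP_holomorphic[OF t N] holomorphic_qden cross_holomorphic[OF t N] pair_holomorphic[OF t N])
         (use qden_nonzero in auto)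
    show "?F (of_real \<sigma>) = 0" if "\<sigma> \<ge> real CARD('n) + 1" for \<sigma>
      using pairing_identity_real[OF t N that N1] by simp
  qed
  then show ?thesis by simp
qed

end

section \<open>Q-curvature and the holographic formula\<close>

context holographic_volume
begin

lemma test_fun_T_complex:
  assumes t: "test_fun c K f" and j: "admissible j"
  shows "test_fun c K (T j s f)"
proof -
  note tf = test_fun_facts[OF t]
  obtain d B where B: "\<forall>k. smooth_fun A (B k)" "\<forall>s. \<forall>p\<in>topspace X. P j s f p = (\<Sum>k\<le>(d::nat). s ^ k * B k p)"
     "\<forall>k\<le>d. \<forall>p\<in>topspace X - chart_point c ` K. B k p = 0"
    using P_coeffs_local[OF j tf(4,5,6)] by blast
  then have "\<forall>p\<in>topspace X - chart_point c ` K. T j s f p = 0"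
    by (simp add: T_qden)
  then show ?thesis using tf smooth_T[OF tf(4) j] by (simp add: test_fun_def)
qed

lemma volume_integral:
  assumes t: "test_fun c K f" and G: "smooth_fun A G"
  shows "(LINT p|\<mu>. f p * G p) = cint c (\<lambda>x. of_real (Vc c 0 x) * f (chart_point c x) * G (chart_point c x))"
proof -
  note tf = test_fun_facts[OF t]
  have "(LINT p|\<mu>. f p * G p) = (LINT x|lborel. indicator (chart_image c) x *\<^sub>R (sqrt (det (h c x)) *\<^sub>R (f (chart_point c x) * G (chart_point c x))))"
  proof (rule chart_integral[OF tf(1)])
    show "continuous_on (chart_image c) ((\<lambda>p. f p * G p) \<circ> chart_point c)"
      using smooth_fun_mult[OF tf(4) G] tf(1) by (intro smooth_on_continuous_on) (simp add: smooth_fun_def)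
    show "f p * G p = 0" if "p \<in> topspace X - fst c" for p
      using tf(6)[of p] compactin_chart_point(3)[OF tf(1-3)] that by auto
  qed
  also have "\<dots> = cint c (\<lambda>x. sqrt (det (h c x)) *\<^sub>R (f (chart_point c x) * G (chart_point c x)))"
    by (simp only: cint_def)
  also have "\<dots> = cint c (\<lambda>x. of_real (Vc c 0 x) * f (chart_point c x) * G (chart_point c x))"
    by (rule cint_cong) (simp add: Vc_0[OF tf(1)] scaleR_conv_of_real)
  finally show ?thesis .
qed

lemma pairing_separates:
  assumes c: "c \<in> A" and G: "smooth_fun A G" and p: "p \<in> fst c"
    and 0: "\<And>f K. test_fun c K f \<Longrightarrow> cint c (\<lambda>x. of_real (Vc c 0 x) * f (chart_point c x) * G (chart_point c x)) = 0"
  shows "G p = 0"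
proof (rule test_functions_separate[OF c G _ p])
  fix f :: "'a \<Rightarrow> complex" and K
  assume "smooth_fun A f" "compact K" "K \<subseteq> chart_image c" "\<And>p. p \<in> topspace X - chart_point c ` K \<Longrightarrow> f p = 0"
  then have "test_fun c K f" using c by (simp add: test_fun_def)
  then show "(LINT p|\<mu>. f p * G p) = 0" using volume_integral[OF _ G] 0 by simp
qed

text \<open>The terms with \<open>i > 0\<close> contain the factor \<open>T i s 1\<close>.\<close>

lemma cross_reduce:
  assumes t: "test_fun c K f" and N1: "N > 0"
    and 0: "\<And>i p. i \<in> {1..<N} \<Longrightarrow> p \<in> topspace X \<Longrightarrow> P i s (\<lambda>_. 1) p = 0"
  shows "cross c N s f = (\<Sum>j<N. of_nat j * pair c N s f 0 j)"
proof -
  note tf = test_fun_facts[OF t]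
  let ?E = "{(i,j). i < N \<and> j < N \<and> i + j \<le> N}"
  have fin: "finite ?E" by (rule finite_subset[of _ "{..N} \<times> {..N}"]) auto
  have z: "pair c N s f i j = 0" if "i \<in> {1..<N}" for i j
  proof -
    have "pair c N s f i j = cint c (\<lambda>x. 0)"
      unfolding pair_def
    proof (rule cint_cong)
      fix x assume "x \<in> chart_image c"
      then have "chart_point c x \<in> topspace X" using chart_facts(5,8)[OF tf(1)] by auto
      then have "T i s (\<lambda>_. 1) (chart_point c x) = 0" using 0[OF that] by (simp add: T_qden)
      then show "of_real (Vc c (N - i - j) x) * T j s f (chart_point c x) * T i s (\<lambda>_. 1) (chart_point c x) = 0" by simp
    qed
    then show ?thesis by (simp add: cint_def)
  qed
  have "cross c N s f = (\<Sum>(i,j)\<in>Pair 0 ` {..<N}. (of_nat j - of_nat i) * pair c N s f i j)"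
    unfolding cross_def
  proof (rule sum.mono_neutral_right[OF fin])
    show "Pair 0 ` {..<N} \<subseteq> ?E" using N1 by auto
    show "\<forall>ij\<in>?E - Pair 0 ` {..<N}. (case ij of (i,j) \<Rightarrow> (of_nat j - of_nat i) * pair c N s f i j) = 0"
    proof
      fix ij assume ij: "ij \<in> ?E - Pair 0 ` {..<N}"
      obtain i j where e: "ij = (i,j)" by (cases ij) auto
      have "i \<in> {1..<N}" using ij by (cases i) (auto simp: e)
      then show "(case ij of (i,j) \<Rightarrow> (of_nat j - of_nat i) * pair c N s f i j) = 0" by (simp add: e z)
    qed
  qed
  also have "\<dots> = (\<Sum>j<N. of_nat j * pair c N s f 0 j)"
    by (subst sum.reindex) (auto simp: inj_on_def)
  finally show ?thesis .
qed

lemma critical_regular: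
  assumes "N > 0"
  shows "of_nat CARD('n) / 2 - of_nat N \<in> regular (N - 1)"
proof -
  have "(of_nat N :: complex) \<noteq> of_nat i" if "i \<in> {1..N - 1}" for i
    using that assms by (simp only: of_nat_eq_iff) auto
  then show ?thesis by (auto simp: regular_def)
qed

lemma zero_regular:
  assumes "N > 0" "2 * N \<le> CARD('n)"
  shows "0 \<in> regular (N - 1)"
proof -
  have "(0 :: complex) \<noteq> of_nat CARD('n) / 2 - of_nat i" if "i \<in> {1..N - 1}" for i
  proof
    assume "(0 :: complex) = of_nat CARD('n) / 2 - of_nat i"
    then have "(of_nat CARD('n) :: complex) = of_nat (2 * i)" by (simp add: field_simps)
    then have "CARD('n) = 2 * i" by (simp only: of_nat_eq_iff)
    then show False using that assms by auto
  qed
  note * = this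
  show ?thesis unfolding regular_def by (rule CollectI, rule ballI, rule *)
qed

text \<open>This expresses that constants solve the eigenvalue equation for \<open>s = 0\<close>. It is read off from the pairing
  identity by induction: with \<open>alpha 0 j k = - 2 j (n - 2 k)\<close> the two sums on its right-hand side cancel.\<close>

lemma P_zero_const:
  assumes "2 * k \<le> CARD('n)" "k > 0" "even CARD('n)" "p \<in> topspace X"
  shows "P k 0 (\<lambda>_. 1) p = 0"
  using assms
proof (induction k arbitrary: p rule: less_induct)
  case (less k)
  have ad: "admissible k" using less.prems by (simp add: admissible_def)
  obtain c where c: "c \<in> A" "p \<in> fst c" using less.prems(4) union_charts by blast
  show ?case
  proof (rule pairing_separates[OF c(1) smooth_P[OF smooth_fun_const ad] c(2)])
    fix f K assume t: "test_fun c K f"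
    have r: "0 \<in> regular (k - 1)" using zero_regular less.prems by blast
    have IH: "P i 0 (\<lambda>_. 1) p = 0" if "i \<in> {1..<k}" "p \<in> topspace X" for i p
      using that less.prems by (intro less.IH) auto
    have al: "alpha 0 j k = - 4 * (of_nat CARD('n) / 2 - of_nat k) * of_nat j" for j
      by (simp add: alpha_def algebra_simps)
    have "pairP c k 0 f / qden (k - 1) 0 = (\<Sum>j<k. alpha 0 j k * pair c k 0 f 0 j) + 4 * (of_nat CARD('n) / 2 - of_nat k) * (\<Sum>j<k. of_nat j * pair c k 0 f 0 j)"
      using pairing_identity[OF t ad less.prems(2) r] cross_reduce[OF t less.prems(2) IH] by simp
    also have "\<dots> = 0"
      unfolding al sum_distrib_left sum.distrib[symmetric]
      by (intro sum.neutral ballI) (simp add: algebra_simps)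
    finally show "cint c (\<lambda>x. of_real (Vc c 0 x) * f (chart_point c x) * P k 0 (\<lambda>_. 1) (chart_point c x)) = 0"
      using qden_nonzero[OF r, of "k - 1"] by (simp add: pairP_def)
  qed
qed

lemma deriv_polyfun: "((\<lambda>s::complex. \<Sum>k\<le>d. s ^ k * a k) has_field_derivative (\<Sum>k\<le>d. of_nat k * z ^ (k - 1) * a k)) (at z)"
  by (auto intro!: derivative_eq_intros simp: mult_ac)

lemma smooth_deriv_P:
  assumes "admissible N"
  shows "smooth_fun A (\<lambda>p. deriv (\<lambda>s. P N s (\<lambda>_. 1) p) 0)"
proof -
  obtain e C where C': "\<forall>k f. smooth_fun A f \<longrightarrow> smooth_fun A (C k f)"
    "\<forall>s f. smooth_fun A f \<longrightarrow> (\<forall>p \<in> topspace X. P N s f p = (\<Sum>k\<le>(e::nat). s ^ k * C k f p))"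
    using P_coeffs[OF assms] by (elim exE conjE)
  note C = C'(1)[rule_format, OF smooth_fun_const] C'(2)[rule_format, OF smooth_fun_const]
  show ?thesis
  proof (rule smooth_fun_cong)
    show "deriv (\<lambda>s. P N s (\<lambda>_. 1) p) 0 = (\<Sum>k\<le>e. of_nat k * 0 ^ (k - 1) * C k (\<lambda>_. 1) p)" if "p \<in> topspace X" for p
      using DERIV_imp_deriv[OF deriv_polyfun[of "\<lambda>k. C k (\<lambda>_. 1) p" e 0]] that by (simp add: C(2))
    show "smooth_fun A (\<lambda>p. \<Sum>k\<le>e. of_nat k * 0 ^ (k - 1) * C k (\<lambda>_. 1) p)"
      by (intro smooth_fun_sum smooth_fun_linear[OF bounded_linear_mult_right] C)
  qed
qed

lemma pairP_derivative:
  assumes t: "test_fun c K f" and N: "admissible N"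
  shows "((\<lambda>s. pairP c N s f) has_field_derivative
     cint c (\<lambda>x. of_real (Vc c 0 x) * f (chart_point c x) * deriv (\<lambda>s. P N s (\<lambda>_. 1) (chart_point c x)) 0)) (at 0)"
proof -
  note tf = test_fun_facts[OF t]
  obtain e C where C': "\<forall>k f. smooth_fun A f \<longrightarrow> smooth_fun A (C k f)"
    "\<forall>s f. smooth_fun A f \<longrightarrow> (\<forall>p \<in> topspace X. P N s f p = (\<Sum>k\<le>(e::nat). s ^ k * C k f p))"
    using P_coeffs[OF N] by (elim exE conjE)
  note C = C'(1)[rule_format, OF smooth_fun_const] C'(2)[rule_format, OF smooth_fun_const]
  define J where "J k = cint c (\<lambda>x. of_real (Vc c 0 x) * f (chart_point c x) * C k (\<lambda>_. 1) (chart_point c x))" for k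
  have top: "chart_point c x \<in> topspace X" if "x \<in> chart_image c" for x
    using chart_facts(5,8)[OF tf(1)] that by auto
  have lin: "cint c (\<lambda>x. of_real (Vc c 0 x) * f (chart_point c x) * (\<Sum>k\<le>e. a k * C k (\<lambda>_. 1) (chart_point c x))) = (\<Sum>k\<le>e. a k * J k)" for a
  proof -
    have "cint c (\<lambda>x. of_real (Vc c 0 x) * f (chart_point c x) * (\<Sum>k\<le>e. a k * C k (\<lambda>_. 1) (chart_point c x)))
      = cint c (\<lambda>x. \<Sum>k\<le>e. a k * (of_real (Vc c 0 x) * f (chart_point c x) * C k (\<lambda>_. 1) (chart_point c x)))"
      by (rule cint_cong) (simp add: sum_distrib_left mult_ac)
    also have "\<dots> = (\<Sum>k\<le>e. cint c (\<lambda>x. a k * (of_real (Vc c 0 x) * f (chart_point c x) * C k (\<lambda>_. 1) (chart_point c x))))"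
    proof (rule cint_sum)
      fix k
      have "cintegrable c (\<lambda>x. (of_real (Vc c 0 x) * f (chart_point c x) * C k (\<lambda>_. 1) (chart_point c x)))"
        by (intro pairing_integrable[OF t] C admissible_mono[OF N]) simp
      from integrable_mult_right[of "a k", OF this]
      show "cintegrable c (\<lambda>x. (a k * (of_real (Vc c 0 x) * f (chart_point c x) * C k (\<lambda>_. 1) (chart_point c x))))"
        by (simp add: mult_ac)
    qed
    finally show ?thesis by (simp add: cint_mult J_def)
  qed
  have 1: "pairP c N s f = (\<Sum>k\<le>e. s ^ k * J k)" for s
    unfolding lin[symmetric] pairP_def by (rule cint_cong) (simp add: C(2)[OF top])
  have d: "deriv (\<lambda>s. P N s (\<lambda>_. 1) p) 0 = (\<Sum>k\<le>e. of_nat k * 0 ^ (k - 1) * C k (\<lambda>_. 1) p)" if "p \<in> topspace X" for p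
    using DERIV_imp_deriv[OF deriv_polyfun[of "\<lambda>k. C k (\<lambda>_. 1) p" e 0]] that by (simp add: C(2))
  have "cint c (\<lambda>x. of_real (Vc c 0 x) * f (chart_point c x) * deriv (\<lambda>s. P N s (\<lambda>_. 1) (chart_point c x)) 0)
     = (\<Sum>k\<le>e. (of_nat k * 0 ^ (k - 1)) * J k)"
    unfolding lin[symmetric] by (rule cint_cong) (simp only: d[OF top])
  then show ?thesis unfolding 1 using deriv_polyfun[of J e 0] by simp
qed

lemma prod_descending: "(\<Prod>i=1..k. of_nat (Suc k) - of_nat i) = (fact k :: complex)"
proof -
  have "(\<Prod>i=1..k. of_nat (Suc k) - of_nat i :: complex) = (\<Prod>i=1..k. of_nat (Suc k - i))"
    by (intro prod.cong refl) (auto simp: of_nat_diff)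
  also have "\<dots> = (\<Prod>i=1..k. of_nat i)"
    by (rule prod.reindex_bij_witness[of _ "\<lambda>i. Suc k - i" "\<lambda>i. Suc k - i"]) auto
  finally show ?thesis by (simp add: fact_prod)
qed

text \<open>At \<open>s = n / 2 - N\<close> the product in the denominator of \<open>T (N - 1) s\<close> is \<open>(N - 1)!\<close>.\<close>

lemma c_const_qden:
  assumes "N > 0"
  shows "4 * of_nat N * c_const N * (-1) ^ N = 1 / qden (N - 1) (of_nat CARD('n) / 2 - of_nat N)"
proof -
  obtain k where k: "N = Suc k" using assms by (cases N) auto
  have "qden k (of_nat CARD('n) / 2 - of_nat (Suc k)) = 2 ^ (2*k) * fact k * (\<Prod>i=1..k. of_nat (Suc k) - of_nat i)"
    by (simp add: qden_def)
  also have "\<dots> = 2 ^ (2*k) * fact k * fact k" by (simp only: prod_descending)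
  finally have q: "qden k (of_nat CARD('n) / 2 - of_nat (Suc k)) = 2 ^ (2*k) * fact k * fact k" .
  have gen: "4 * M * (1 / (u * (4 * E) * (M * F) * F)) * u = 1 / (E * F * F)"
    if "M \<noteq> 0" "F \<noteq> 0" "u \<noteq> 0" "E \<noteq> 0" for M F u E :: complex
    using that by (simp add: field_simps)
  have "(2::complex) ^ (2 * Suc k) = 4 * 2 ^ (2 * k)" by simp
  moreover have "(fact (Suc k) :: complex) = of_nat (Suc k) * fact k" by simp
  moreover have "(of_nat (Suc k) :: complex) \<noteq> 0" by (simp only: of_nat_eq_0_iff)
  ultimately have "4 * of_nat (Suc k) * (1 / ((-1) ^ Suc k * 2 ^ (2 * Suc k) * fact (Suc k) * fact k)) * (-1) ^ Suc k
    = (1 / (2 ^ (2*k) * fact k * fact k) :: complex)"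
    by (simp only:) (rule gen, simp_all del: of_nat_Suc)
  then show ?thesis unfolding k c_const_def diff_Suc_1 q .
qed

text \<open>For \<open>2 N \<noteq> n\<close> the pairing identity is evaluated at \<open>z = n / 2 - N\<close>, where \<open>alpha z j N = z (2 N - 2 j)\<close>; the factor
  \<open>z\<close> is the one in the definition of the Q-curvature. For \<open>2 N = n\<close> the identity has the form \<open>pairP = s g(s)\<close>, so that the
  derivative at \<open>0\<close> is \<open>g(0)\<close>. There the factors \<open>2 j + 2 N\<close> from \<open>alpha\<close> and \<open>- 4 j\<close> from \<open>cross\<close> add up to \<open>2 N - 2 j\<close>.\<close>

lemma Q_pairing:
  assumes t: "test_fun c K f" and N: "admissible N" and N1: "N > 0"
  shows "cint c (\<lambda>x. of_real (Vc c 0 x) * f (chart_point c x) * (4 * of_nat N * c_const N * Q_curvature CARD('n) P N (chart_point c x)))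
    = (\<Sum>j<N. of_nat (2*N - 2*j) * pair c N (of_nat CARD('n) / 2 - of_nat N) f 0 j)"
proof -
  define z :: complex where "z = of_nat CARD('n) / 2 - of_nat N"
  define q where "q = qden (N - 1) z"
  have rz: "z \<in> regular (N - 1)" unfolding z_def by (rule critical_regular[OF N1])
  have q0: "q \<noteq> 0" unfolding q_def using qden_nonzero[OF rz, of "N - 1"] by simp
  have cq: "4 * of_nat N * c_const N * (-1) ^ N = 1 / q" using c_const_qden[OF N1] by (simp add: q_def z_def)
  have sgn: "inverse ((-1) ^ N) = ((-1) ^ N :: complex)"
    by (rule inverse_unique) (simp flip: power_add mult_2)
  have nd: "of_nat (2*N - 2*j) = (2 * of_nat N - 2 * of_nat j :: complex)" if "j < N" for j
    using that by (simp add: of_nat_diff)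
  show ?thesis
  proof (cases "2 * N = CARD('n)")
    case False
    have z0: "z \<noteq> 0"
    proof
      assume "z = 0"
      then have "(of_nat CARD('n) :: complex) = of_nat (2 * N)" by (simp add: z_def field_simps)
      then show False using False by (simp only: of_nat_eq_iff)
    qed
    have "4 * of_nat N * c_const N * Q_curvature CARD('n) P N p = 1 / (q * z) * P N z (\<lambda>_. 1) p" for p
    proof -
      have "Q_curvature CARD('n) P N p = P N z (\<lambda>_. 1) p / ((-1) ^ N * z)"
        using False by (simp add: Q_curvature_def gjms_def z_def)
      also have "\<dots> = (-1) ^ N * (P N z (\<lambda>_. 1) p / z)"
        by (simp only: divide_inverse inverse_mult_distrib sgn mult_ac)
      finally have "Q_curvature CARD('n) P N p = (-1) ^ N * (P N z (\<lambda>_. 1) p / z)" .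
      then have "4 * of_nat N * c_const N * Q_curvature CARD('n) P N p = (4 * of_nat N * c_const N * (-1) ^ N) * (P N z (\<lambda>_. 1) p / z)"
        by simp
      then show ?thesis unfolding cq by simp
    qed
    then have "cint c (\<lambda>x. of_real (Vc c 0 x) * f (chart_point c x) * (4 * of_nat N * c_const N * Q_curvature CARD('n) P N (chart_point c x)))
      = cint c (\<lambda>x. 1 / (q * z) * (of_real (Vc c 0 x) * f (chart_point c x) * P N z (\<lambda>_. 1) (chart_point c x)))"
      by (simp add: mult_ac)
    also have "\<dots> = 1 / z * (pairP c N z f / q)" by (simp only: cint_mult pairP_def) simp
    also have "pairP c N z f / q = (\<Sum>j<N. alpha z j N * pair c N z f 0 j)"
      using pairing_identity[OF t N N1 rz] by (simp add: q_def z_def)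
    also have "\<dots> = (\<Sum>j<N. z * (of_nat (2*N - 2*j) * pair c N z f 0 j))"
    proof (rule sum.cong[OF refl])
      fix j assume "j \<in> {..<N}"
      then have j: "j < N" by simp
      have n: "of_nat CARD('n) = 2 * z + 2 * of_nat N" by (simp add: z_def)
      have "alpha z j N = z * (2 * of_nat N - 2 * of_nat j)"
        unfolding alpha_def n by (simp add: algebra_simps)
      then show "alpha z j N * pair c N z f 0 j = z * (of_nat (2*N - 2*j) * pair c N z f 0 j)"
        by (simp only: nd[OF j] mult.assoc)
    qed
    also have "1 / z * \<dots> = (\<Sum>j<N. of_nat (2*N - 2*j) * pair c N z f 0 j)"
      using z0 by (simp add: sum_distrib_left[symmetric])
    finally show ?thesis unfolding z_def .
  next
    case True
    then have n2: "(of_nat CARD('n) :: complex) = 2 * of_nat N" by (metis of_nat_mult of_nat_numeral)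
    have z: "z = 0" by (simp add: z_def n2)
    have ev: "even CARD('n)" using True by (metis dvd_triv_left)
    define D where "D = cint c (\<lambda>x. of_real (Vc c 0 x) * f (chart_point c x) * deriv (\<lambda>s. P N s (\<lambda>_. 1) (chart_point c x)) 0)"
    have "4 * of_nat N * c_const N * Q_curvature CARD('n) P N p = 1 / q * deriv (\<lambda>s. P N s (\<lambda>_. 1) p) 0" for p
      using True unfolding cq[symmetric] by (simp add: Q_curvature_def)
    then have Q: "cint c (\<lambda>x. of_real (Vc c 0 x) * f (chart_point c x) * (4 * of_nat N * c_const N * Q_curvature CARD('n) P N (chart_point c x)))
      = 1 / q * D"
      unfolding D_def cint_mult[symmetric] by (simp add: mult_ac)
    define g where "g s = qden (N - 1) s * ((\<Sum>j<N. (2 * of_nat j + 2 * of_nat N) * pair c N s f 0 j) - 4 * cross c N s f)" for s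
    have pg: "pairP c N s f = s * g s" if s: "s \<in> regular (N - 1)" for s
    proof -
      have "alpha s j N = s * (2 * of_nat j + 2 * of_nat N)" for j
        unfolding alpha_def n2 by (simp add: algebra_simps)
      then have "pairP c N s f / qden (N - 1) s = s * (\<Sum>j<N. (2 * of_nat j + 2 * of_nat N) * pair c N s f 0 j) - 4 * s * cross c N s f"
        using pairing_identity[OF t N N1 s] by (simp add: n2 sum_distrib_left mult.assoc)
      then show ?thesis using qden_nonzero[OF s, of "N - 1"] by (simp add: g_def field_simps)
    qed
    have "g holomorphic_on regular (N - 1)"
      unfolding g_def by (intro holomorphic_intros holomorphic_qden pair_holomorphic[OF t N] cross_holomorphic[OF t N]) auto
    then obtain g' where g': "(g has_field_derivative g') (at 0)"
      using open_regular rz z by (metis at_within_open field_differentiable_def holomorphic_on_def)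
    have "((\<lambda>s. s * g s) has_field_derivative (1 * g 0 + g' * 0)) (at 0)"
      by (rule DERIV_mult[OF DERIV_ident g'])
    then have "((\<lambda>s. pairP c N s f) has_field_derivative (1 * g 0 + g' * 0)) (at 0)"
      by (rule has_field_derivative_transform_within_open[OF _ open_regular[of "N - 1"]]) (use rz z pg in auto)
    then have D: "D = g 0" using DERIV_unique[OF pairP_derivative[OF t N]] by (simp add: D_def)
    have cr: "cross c N 0 f = (\<Sum>j<N. of_nat j * pair c N 0 f 0 j)"
      using True ev by (intro cross_reduce[OF t N1] P_zero_const) auto
    have "g 0 = q * (\<Sum>j<N. of_nat (2*N - 2*j) * pair c N 0 f 0 j)"
      unfolding g_def cr q_def z sum_distrib_left[of 4] sum_subtractf[symmetric]
      by (intro arg_cong2[of _ _ _ _ "(*)"] sum.cong refl) (auto simp: nd algebra_simps)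
    then show ?thesis unfolding Q D using q0 by (simp add: z[unfolded z_def])
  qed
qed

lemma smooth_Q:
  assumes N: "admissible N"
  shows "smooth_fun A (\<lambda>p. a * Q_curvature CARD('n) P N p)"
proof (cases "2 * N = CARD('n)")
  case True
  then show ?thesis unfolding Q_curvature_def
    using smooth_fun_linear[OF bounded_linear_mult_right smooth_fun_linear[OF bounded_linear_mult_right smooth_deriv_P[OF N]]] by simp
next
  case False
  then show ?thesis unfolding Q_curvature_def gjms_def divide_inverse
    using smooth_fun_linear[OF bounded_linear_mult_right smooth_fun_linear[OF bounded_linear_mult_left smooth_P[OF smooth_fun_const N]]] by simp
qed

lemma pair_volume:
  assumes t: "test_fun c K f" and N: "admissible N" and j: "j \<le> N"
  shows "pair c N s f 0 j = (LINT p|\<mu>. T j s f p * of_real (v (N - j) p))"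
proof -
  note tf = test_fun_facts[OF t]
  have sv: "smooth_fun A (\<lambda>p. complex_of_real (v (N - j) p))"
    by (intro smooth_fun_linear[OF bounded_linear_of_real] smooth_v admissible_mono[OF N]) simp
  have "pair c N s f 0 j = cint c (\<lambda>x. of_real (Vc c 0 x) * T j s f (chart_point c x) * of_real (v (N - j) (chart_point c x)))"
    unfolding pair_0[OF tf(1)]
    by (rule cint_cong) (simp add: Vc_0[OF tf(1)], simp add: Vc_def)
  also have "\<dots> = (LINT p|\<mu>. T j s f p * of_real (v (N - j) p))"
    using volume_integral[OF test_fun_T_complex[OF t admissible_mono[OF N j]] sv] by simp
  finally show ?thesis .
qed

text \<open>The difference of both sides is smooth and pairs to zero with all test functions of a chart; the term \<open>j = 0\<close> of
  \<open>Q_pairing\<close>, with \<open>T 0 s f = f\<close>, is the one with \<open>v N\<close>.\<close>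

lemma holographic_formula:
  assumes N: "admissible N" "N > 0"
    and adj: "\<And>j. j \<in> {1..N-1} \<Longrightarrow> formal_adjoint X A \<mu> (T j (of_nat CARD('n) / 2 - of_nat N)) (Tadj j)"
    and p: "p \<in> topspace X"
  shows "4 * of_nat N * c_const N * Q_curvature CARD('n) P N p = 2 * of_nat N * complex_of_real (v N p) +
           (\<Sum>j=1..N-1. of_nat (2*N - 2*j) * Tadj j (\<lambda>q. complex_of_real (v (N - j) q)) p)"
proof -
  let ?z = "of_nat CARD('n) / 2 - of_nat N :: complex"
  define w where "w j p = (if j = 0 then complex_of_real (v N p) else Tadj j (\<lambda>q. complex_of_real (v (N - j) q)) p)" for j p
  have sv: "smooth_fun A (\<lambda>p. complex_of_real (v (N - j) p))" for j
    by (intro smooth_fun_linear[OF bounded_linear_of_real] smooth_v admissible_mono[OF N(1)]) simp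
  have sw: "smooth_fun A (w j)" if "j < N" for j
    using sv[of 0] sv[of j] adj[of j] that unfolding w_def formal_adjoint_def by (cases "j = 0") auto
  define G where "G p = 4 * of_nat N * c_const N * Q_curvature CARD('n) P N p - (\<Sum>j<N. of_nat (2*N - 2*j) * w j p)" for p
  have sum_smooth: "smooth_fun A (\<lambda>p. \<Sum>j<N. of_nat (2*N - 2*j) * w j p)"
    by (intro smooth_fun_sum smooth_fun_linear[OF bounded_linear_mult_right] sw) simp
  have G: "smooth_fun A G"
    unfolding G_def[abs_def] by (intro smooth_fun_diff smooth_Q[OF N(1)] sum_smooth)
  obtain c where c: "c \<in> A" "p \<in> fst c" using p union_charts by blast
  have "G p = 0"
  proof (rule pairing_separates[OF c(1) G c(2)])
    fix f K assume t: "test_fun c K f"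
    note tf = test_fun_facts[OF t]
    have wp: "cint c (\<lambda>x. of_real (Vc c 0 x) * f (chart_point c x) * w j (chart_point c x)) = pair c N ?z f 0 j" if j: "j < N" for j
    proof -
      have "cint c (\<lambda>x. of_real (Vc c 0 x) * f (chart_point c x) * w j (chart_point c x)) = (LINT p|\<mu>. f p * w j p)"
        by (rule volume_integral[OF t sw[OF j], symmetric])
      also have "\<dots> = (LINT p|\<mu>. T j ?z f p * of_real (v (N - j) p))"
      proof (cases "j = 0")
        case True
        have "f p = T 0 ?z f p" if "p \<in> space \<mu>" for p using T_0[OF tf(4)] that by (simp add: space_\<mu>)
        then show ?thesis using True by (intro Bochner_Integration.integral_cong) (auto simp: w_def)
      next
        case False
        then have "formal_adjoint X A \<mu> (T j ?z) (Tadj j)" using adj j by auto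
        moreover have "\<exists>K. compactin X K \<and> (\<forall>p\<in>topspace X - K. f p = 0)"
          using compactin_chart_point(1)[OF tf(1-3)] tf(6) by blast
        ultimately have "(LINT p|\<mu>. T j ?z f p * of_real (v (N - j) p)) = (LINT p|\<mu>. f p * Tadj j (\<lambda>q. complex_of_real (v (N - j) q)) p)"
          using sv[of j] tf(4) unfolding formal_adjoint_def by blast
        then show ?thesis using False by (simp add: w_def)
      qed
      also have "\<dots> = pair c N ?z f 0 j" by (rule pair_volume[OF t N(1), symmetric]) (use j in simp)
      finally show ?thesis .
    qed
    have i: "cintegrable c (\<lambda>x. (of_real (Vc c 0 x) * f (chart_point c x) * H (chart_point c x)))"
      if "smooth_fun A H" for H
      by (intro pairing_integrable[OF t _ that] admissible_mono[OF N(1)]) simp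
    have iw: "cintegrable c (\<lambda>x. (- of_nat (2*N - 2*j) * (of_real (Vc c 0 x) * f (chart_point c x) * w j (chart_point c x))))"
      if "j < N" for j
      using integrable_mult_right[of "- of_nat (2*N - 2*j)", OF i[OF sw[OF that]]] by (simp add: mult_ac)
    have "cint c (\<lambda>x. of_real (Vc c 0 x) * f (chart_point c x) * G (chart_point c x))
      = cint c (\<lambda>x. (\<Sum>u\<in>{()}. of_real (Vc c 0 x) * f (chart_point c x) * (4 * of_nat N * c_const N * Q_curvature CARD('n) P N (chart_point c x)))
         + (\<Sum>j<N. - of_nat (2*N - 2*j) * (of_real (Vc c 0 x) * f (chart_point c x) * w j (chart_point c x))))"
    proof (rule cint_cong)
      have gen: "a * (b - (\<Sum>j<N. d j * e j)) = (\<Sum>u\<in>{()}. a * b) + (\<Sum>j<N. - d j * (a * e j))"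
        for a b :: complex and d e :: "nat \<Rightarrow> complex"
        by (simp add: right_diff_distrib sum_distrib_left sum_negf mult_ac)
      fix x
      show "of_real (Vc c 0 x) * f (chart_point c x) * G (chart_point c x)
        = (\<Sum>u\<in>{()}. of_real (Vc c 0 x) * f (chart_point c x) * (4 * of_nat N * c_const N * Q_curvature CARD('n) P N (chart_point c x)))
         + (\<Sum>j<N. - of_nat (2*N - 2*j) * (of_real (Vc c 0 x) * f (chart_point c x) * w j (chart_point c x)))"
        unfolding G_def by (rule gen)
    qed
    also have "\<dots> = cint c (\<lambda>x. of_real (Vc c 0 x) * f (chart_point c x) * (4 * of_nat N * c_const N * Q_curvature CARD('n) P N (chart_point c x)))
         + (\<Sum>j<N. cint c (\<lambda>x. - of_nat (2*N - 2*j) * (of_real (Vc c 0 x) * f (chart_point c x) * w j (chart_point c x))))"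
      by (subst cint_two_sums) (use i[OF smooth_Q[OF N(1)]] iw in auto)
    also have "\<dots> = 0"
      unfolding Q_pairing[OF t N] cint_mult
    proof -
      have "(\<Sum>j<N. - of_nat (2*N - 2*j) * cint c (\<lambda>x. of_real (Vc c 0 x) * f (chart_point c x) * w j (chart_point c x)))
        = (\<Sum>j<N. - of_nat (2*N - 2*j) * pair c N ?z f 0 j)"
        by (rule sum.cong) (simp_all only: lessThan_iff wp)
      then show "(\<Sum>j<N. of_nat (2*N - 2*j) * pair c N ?z f 0 j)
        + (\<Sum>j<N. - of_nat (2*N - 2*j) * cint c (\<lambda>x. of_real (Vc c 0 x) * f (chart_point c x) * w j (chart_point c x))) = 0"
        by (simp only: mult_minus_left sum_negf add.right_inverse)
    qed
    finally show "cint c (\<lambda>x. of_real (Vc c 0 x) * f (chart_point c x) * G (chart_point c x)) = 0" .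
  qed
  moreover have "(\<Sum>j<N. of_nat (2*N - 2*j) * w j p) = 2 * of_nat N * complex_of_real (v N p) +
           (\<Sum>j=1..N-1. of_nat (2*N - 2*j) * Tadj j (\<lambda>q. complex_of_real (v (N - j) q)) p)"
  proof -
    have "{..<N} = insert 0 {1..N-1}" using N(2) by auto
    then show ?thesis by (simp add: w_def)
  qed
  ultimately show ?thesis by (simp add: G_def)
qed

end

theorem theorem1p1:
  fixes X :: "'a topology"
    and A :: "('a, 'n::finite) chart set"
    and h hbar :: "('a, 'n) tensor2"
    and hs :: "nat \<Rightarrow> ('a, 'n) tensor2"
    and v :: "nat \<Rightarrow> 'a \<Rightarrow> real"
    and P :: "nat \<Rightarrow> complex \<Rightarrow> ('a \<Rightarrow> complex) \<Rightarrow> 'a \<Rightarrow> complex"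
    and \<mu> :: "'a measure"
    and Tadj :: "nat \<Rightarrow> ('a \<Rightarrow> complex) \<Rightarrow> 'a \<Rightarrow> complex"
    and n N :: nat
  assumes n: "n = CARD('n)" "n \<ge> 2"
    and M: "smooth_atlas X A"
    and h: "riemannian_metric A h"
    and PE: "poincare_einstein A h hs hbar"
    and v: "holographic_coeffs A h hs hbar v"
    and P: "poisson_operators A hs hbar P"
    and \<mu>: "riemannian_volume X A h \<mu>"
    and N: "N \<ge> 1" "even n \<Longrightarrow> 2 * N \<le> n"
    and Tadj: "\<And>j. j \<in> {1..N-1} \<Longrightarrow>
                 formal_adjoint X A \<mu> (T_op n P j (of_nat n / 2 - of_nat N)) (Tadj j)"
  shows "\<forall>p\<in>topspace X.
           4 * of_nat N * c_const N * Q_curvature n P N p =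
           2 * of_nat N * complex_of_real (v N p) +
           (\<Sum>j=1..N-1. of_nat (2*N - 2*j) * Tadj j (\<lambda>q. complex_of_real (v (N - j) q)) p)"
proof
  fix p assume p: "p \<in> topspace X"
  interpret holographic_volume X A h hbar hs v P \<mu>
    by unfold_locales fact+
  have ad: "admissible N" "N > 0" using N n by (auto simp: admissible_def)
  show "4 * of_nat N * c_const N * Q_curvature n P N p =
           2 * of_nat N * complex_of_real (v N p) +
           (\<Sum>j=1..N-1. of_nat (2*N - 2*j) * Tadj j (\<lambda>q. complex_of_real (v (N - j) q)) p)"
    unfolding n(1)
    by (rule holographic_formula[OF ad _ p]) (use Tadj in \<open>simp add: T_def n(1)\<close>)
qed

end
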